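(* Let $k$ be a commutative ring and let $C$ be a dual $k$-linear Hopf category whose underlying class $X$ is a finite set. Then $C=\bigoplus_{x,y\in X}C_{x,y}$, with the structure described in the context, is a weak Hopf algebra over $k$.
   Context: A dual $k$-linear Hopf category $C$ with underlying class $X$ consists of $k$-algebras $C_{x,y}$ ($x,y\in X$) with unit elements $1_{x,y}$, algebra morphisms $\Delta_{x,y,z}:C_{x,z}\to C_{x,y}\otimes C_{y,z}$, written $\Delta_{x,y,z}(h)=h_{(1,y)}\otimes h_{(2,y)}$, and $\varepsilon_x:C_{x,x}\to k$, and $k$-linear maps $S_{x,y}:C_{y,x}\to C_{x,y}$ such that, for $h\in C_{x,z}$ and $l\in C_{x,x}$: $(\Delta_{x,u,y}\otimes\mathrm{id})\Delta_{x,y,z}(h)=(\mathrm{id}\otimes\Delta_{u,y,z})\Delta_{x,u,z}(h)$; $\varepsilon_x(h_{(1,x)})h_{(2,x)}=h_{(1,z)}\varepsilon_z(h_{(2,z)})=h$; $l_{(1,y)}S_{x,y}(l_{(2,y)})=\varepsilon_x(l)1_{x,y}$ in $C_{x,y}$; $S_{y,x}(l_{(1,y)})l_{(2,y)}=\varepsilon_x(l)1_{y,x}$ in $C_{y,x}$. Structure on $\bigoplus_{x,y}C_{x,y}$: the algebra structure is that of the (finite) direct product of the algebras $C_{x,y}$, with unit $1=\sum_{x,z}1_{x,z}$. The comultiplication is $\Delta(h)=\sum_{y\in X}\Delta_{x,y,z}(h)$ for $h\in C_{x,z}$. The counit is $\varepsilon(h)=\varepsilon_x(h)$ for $h\in C_{x,x}$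 and $\varepsilon(h)=0$ for $h\in C_{x,y}$, $x\ne y$. The antipode $S$ restricts on $C_{x,y}$ to $S_{y,x}:C_{x,y}\to C_{y,x}$. All are extended linearly. A weak Hopf algebra over $k$ is a $k$-module $H$ with an (associative unital) algebra structure and a (coassociative counital) coalgebra structure $(\Delta,\varepsilon)$ such that $\Delta(hl)=\Delta(h)\Delta(l)$; $\varepsilon(hkl)=\varepsilon(hk_{(1)})\varepsilon(k_{(2)}l)=\varepsilon(hk_{(2)})\varepsilon(k_{(1)}l)$; $(\Delta\otimes\mathrm{id})\Delta(1)=(\Delta(1)\otimes1)(1\otimes\Delta(1))=(1\otimes\Delta(1))(\Delta(1)\otimes1)$; together with a $k$-linear map $S:H\to H$ such that $h_{(1)}S(h_{(2)})=\varepsilon(1_{(1)}h)1_{(2)}$, $S(h_{(1)})h_{(2)}=1_{(1)}\varepsilon(h1_{(2)})$ and $S(h_{(1)})h_{(2)}S(h_{(3)})=S(h)$ for all $h,k,l\in H$. *)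

theory Defs
  imports "HOL-Algebra.Module" "HOL-Algebra.AbelCoset"
begin

section \<open>Algebras and linear maps over a commutative ring\<close>

text \<open>The library locale \<^locale>\<open>algebra\<close> is restricted to commutative algebras.\<close>

locale assoc_algebra = module R A + ring A for R and A (structure) +
  assumes smult_mult_left:
      "\<lbrakk>r \<in> carrier R; a \<in> carrier A; b \<in> carrier A\<rbrakk> \<Longrightarrow> (r \<odot> a) \<otimes> b = r \<odot> (a \<otimes> b)"
    and smult_mult_right:
      "\<lbrakk>r \<in> carrier R; a \<in> carrier A; b \<in> carrier A\<rbrakk> \<Longrightarrow> a \<otimes> (r \<odot> b) = r \<odot> (a \<otimes> b)"

definition lin_hom ::
    "('k, 'r) ring_scheme \<Rightarrow> ('k, 'a, 'm) module_scheme \<Rightarrow> ('k, 'b, 'n) module_scheme \<Rightarrow> ('a \<Rightarrow> 'b) set"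
  where "lin_hom R M N =
    {f \<in> carrier M \<rightarrow> carrier N.
      (\<forall>a\<in>carrier M. \<forall>b\<in>carrier M. f (a \<oplus>\<^bsub>M\<^esub> b) = f a \<oplus>\<^bsub>N\<^esub> f b) \<and>
      (\<forall>r\<in>carrier R. \<forall>a\<in>carrier M. f (r \<odot>\<^bsub>M\<^esub> a) = r \<odot>\<^bsub>N\<^esub> f a)}"

definition alg_hom ::
    "('k, 'r) ring_scheme \<Rightarrow> ('k, 'a, 'm) module_scheme \<Rightarrow> ('k, 'b, 'n) module_scheme \<Rightarrow> ('a \<Rightarrow> 'b) set"
  where "alg_hom R A B = lin_hom R A B \<inter> ring_hom A B"

definition base_algebra :: "('k, 'r) ring_scheme \<Rightarrow> ('k, 'k) module"
  where "base_algebra R =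
    \<lparr>carrier = carrier R, mult = mult R, one = one R, zero = zero R, add = add R, smult = mult R\<rparr>"


section \<open>Tensor products over a commutative ring\<close>

text \<open>
  Elements of the free module on \<open>S\<close> are the finitely supported functions that vanish outside
  \<open>S\<close>. The tensor product \<open>M \<otimes> N\<close> is the free module on \<open>carrier M \<times> carrier N\<close> modulo the
  submodule generated by the bilinearity relations; its elements are cosets.
  The multiplicative fields of records that are only used as modules are left \<^const>\<open>undefined\<close>.
\<close>

definition free_module :: "('k, 'r) ring_scheme \<Rightarrow> 's set \<Rightarrow> ('k, 's \<Rightarrow> 'k) module"
  where "free_module R S =
    \<lparr>carrier = {f. (\<forall>s\<in>S. f s \<in> carrier R) \<and> (\<forall>s. s \<notin> S \<longrightarrow> f s = \<zero>\<^bsub>R\<^esub>) \<and> finite {s. f s \<noteq> \<zero>\<^bsub>R\<^esub>}},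
     mult = undefined, one = undefined,
     zero = (\<lambda>s. \<zero>\<^bsub>R\<^esub>),
     add = (\<lambda>f g s. f s \<oplus>\<^bsub>R\<^esub> g s),
     smult = (\<lambda>r f s. r \<otimes>\<^bsub>R\<^esub> f s)\<rparr>"

definition free_gen :: "('k, 'r) ring_scheme \<Rightarrow> 's \<Rightarrow> 's \<Rightarrow> 'k"
  where "free_gen R s = (\<lambda>t. if t = s then \<one>\<^bsub>R\<^esub> else \<zero>\<^bsub>R\<^esub>)"

definition generated_submodule ::
    "('k, 'r) ring_scheme \<Rightarrow> ('k, 'a, 'm) module_scheme \<Rightarrow> 'a set \<Rightarrow> 'a set"
  where "generated_submodule R M G = \<Inter>{H. submodule H R M \<and> G \<subseteq> H}"

definition quotient_module :: "('k, 'a, 'm) module_scheme \<Rightarrow> 'a set \<Rightarrow> ('k, 'a set) module"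
  where "quotient_module M H =
    \<lparr>carrier = a_rcosets\<^bsub>M\<^esub> H,
     mult = undefined, one = undefined,
     zero = H,
     add = set_add M,
     smult = (\<lambda>r T. \<Union>a\<in>T. H +>\<^bsub>M\<^esub> (r \<odot>\<^bsub>M\<^esub> a))\<rparr>"

definition bilinear_relations ::
    "('k, 'r) ring_scheme \<Rightarrow> ('k, 'a, 'm) module_scheme \<Rightarrow> ('k, 'b, 'n) module_scheme
      \<Rightarrow> ('a \<times> 'b \<Rightarrow> 'k) set"
  where "bilinear_relations R M N =
    (let F = free_module R (carrier M \<times> carrier N); e = free_gen R in
      {e (a \<oplus>\<^bsub>M\<^esub> a', b) \<ominus>\<^bsub>F\<^esub> (e (a, b) \<oplus>\<^bsub>F\<^esub> e (a', b)) | a a' b.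
          a \<in> carrier M \<and> a' \<in> carrier M \<and> b \<in> carrier N} \<union>
      {e (a, b \<oplus>\<^bsub>N\<^esub> b') \<ominus>\<^bsub>F\<^esub> (e (a, b) \<oplus>\<^bsub>F\<^esub> e (a, b')) | a b b'.
          a \<in> carrier M \<and> b \<in> carrier N \<and> b' \<in> carrier N} \<union>
      {e (r \<odot>\<^bsub>M\<^esub> a, b) \<ominus>\<^bsub>F\<^esub> (r \<odot>\<^bsub>F\<^esub> e (a, b)) | r a b.
          r \<in> carrier R \<and> a \<in> carrier M \<and> b \<in> carrier N} \<union>
      {e (a, r \<odot>\<^bsub>N\<^esub> b) \<ominus>\<^bsub>F\<^esub> (r \<odot>\<^bsub>F\<^esub> e (a, b)) | r a b.
          r \<in> carrier R \<and> a \<in> carrier M \<and> b \<in> carrier N})"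

definition tensor_null ::
    "('k, 'r) ring_scheme \<Rightarrow> ('k, 'a, 'm) module_scheme \<Rightarrow> ('k, 'b, 'n) module_scheme
      \<Rightarrow> ('a \<times> 'b \<Rightarrow> 'k) set"
  where "tensor_null R M N =
    generated_submodule R (free_module R (carrier M \<times> carrier N)) (bilinear_relations R M N)"

definition tensor_module ::
    "('k, 'r) ring_scheme \<Rightarrow> ('k, 'a, 'm) module_scheme \<Rightarrow> ('k, 'b, 'n) module_scheme
      \<Rightarrow> ('k, ('a \<times> 'b \<Rightarrow> 'k) set) module"
  where "tensor_module R M N =
    quotient_module (free_module R (carrier M \<times> carrier N)) (tensor_null R M N)"

definition pure_tensor ::
    "('k, 'r) ring_scheme \<Rightarrow> ('k, 'a, 'm) module_scheme \<Rightarrow> ('k, 'b, 'n) module_scheme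
      \<Rightarrow> 'a \<Rightarrow> 'b \<Rightarrow> ('a \<times> 'b \<Rightarrow> 'k) set"
  where "pure_tensor R M N a b =
    tensor_null R M N +>\<^bsub>free_module R (carrier M \<times> carrier N)\<^esub> free_gen R (a, b)"

text \<open>
  The linear map on a tensor product induced by a bilinear map \<open>\<phi>\<close> with values in \<open>P\<close>, computed on
  a representative of the coset \<open>t\<close>; for bilinear \<open>\<phi>\<close> the choice does not matter. In Sweedler
  notation, \<open>tensor_lift R P \<phi> (\<Delta> h)\<close> is \<open>\<phi>(h\<^sub>1, h\<^sub>2)\<close>.
\<close>

definition tensor_lift ::
    "('k, 'r) ring_scheme \<Rightarrow> ('k, 'c, 'p) module_scheme \<Rightarrow> ('a \<Rightarrow> 'b \<Rightarrow> 'c)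
      \<Rightarrow> ('a \<times> 'b \<Rightarrow> 'k) set \<Rightarrow> 'c"
  where "tensor_lift R P \<phi> t =
    (let f = (SOME f. f \<in> t) in
      \<Oplus>\<^bsub>P\<^esub>p\<in>{p. f p \<noteq> \<zero>\<^bsub>R\<^esub>}. f p \<odot>\<^bsub>P\<^esub> \<phi> (fst p) (snd p))"

text \<open>The tensor product of algebras, with \<open>(a \<otimes> b)(a' \<otimes> b') = aa' \<otimes> bb'\<close> and unit \<open>1 \<otimes> 1\<close>.\<close>

definition tensor ::
    "('k, 'r) ring_scheme \<Rightarrow> ('k, 'a, 'm) module_scheme \<Rightarrow> ('k, 'b, 'n) module_scheme
      \<Rightarrow> ('k, ('a \<times> 'b \<Rightarrow> 'k) set) module"
  where "tensor R A B = (tensor_module R A B)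
    \<lparr>mult := (\<lambda>t t'.
        tensor_lift R (tensor_module R A B)
          (\<lambda>a b. tensor_lift R (tensor_module R A B)
            (\<lambda>a' b'. pure_tensor R A B (a \<otimes>\<^bsub>A\<^esub> a') (b \<otimes>\<^bsub>B\<^esub> b')) t') t),
     one := pure_tensor R A B \<one>\<^bsub>A\<^esub> \<one>\<^bsub>B\<^esub>\<rparr>"

text \<open>\<open>f \<otimes> g\<close>; the arguments \<open>M'\<close>, \<open>N'\<close> are the codomains of \<open>f\<close> and \<open>g\<close>.\<close>

definition tensor_map ::
    "('k, 'r) ring_scheme \<Rightarrow> ('k, 'c, 'm) module_scheme \<Rightarrow> ('k, 'd, 'n) module_scheme
      \<Rightarrow> ('a \<Rightarrow> 'c) \<Rightarrow> ('b \<Rightarrow> 'd) \<Rightarrow> ('a \<times> 'b \<Rightarrow> 'k) set \<Rightarrow> ('c \<times> 'd \<Rightarrow> 'k) set"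
  where "tensor_map R M' N' f g =
    tensor_lift R (tensor R M' N') (\<lambda>a b. pure_tensor R M' N' (f a) (g b))"

text \<open>
  The canonical isomorphism \<open>M \<otimes> (N \<otimes> P) \<rightarrow> (M \<otimes> N) \<otimes> P\<close>. Threefold tensor products are
  always taken to be \<open>(M \<otimes> N) \<otimes> P\<close> below.
\<close>

definition tensor_assoc ::
    "('k, 'r) ring_scheme \<Rightarrow> ('k, 'a, 'm) module_scheme \<Rightarrow> ('k, 'b, 'n) module_scheme
      \<Rightarrow> ('k, 'c, 'p) module_scheme
      \<Rightarrow> ('a \<times> ('b \<times> 'c \<Rightarrow> 'k) set \<Rightarrow> 'k) set \<Rightarrow> (('a \<times> 'b \<Rightarrow> 'k) set \<times> 'c \<Rightarrow> 'k) set"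
  where "tensor_assoc R M N P =
    tensor_lift R (tensor R (tensor R M N) P)
      (\<lambda>a. tensor_lift R (tensor R (tensor R M N) P)
        (\<lambda>b c. pure_tensor R (tensor R M N) P (pure_tensor R M N a b) c))"


section \<open>Dual Hopf categories\<close>

text \<open>
  The algebras \<open>C x y\<close> have carriers in a common type \<open>'a\<close>, but neither these carriers nor the
  operations of different \<open>C x y\<close> are assumed to be related.
\<close>

locale dual_hopf_category = cring R
  for R :: "('k, 'r) ring_scheme" (structure)
    and X :: "'x set"
    and C :: "'x \<Rightarrow> 'x \<Rightarrow> ('k, 'a, 'm) module_scheme"
    and \<Delta> :: "'x \<Rightarrow> 'x \<Rightarrow> 'x \<Rightarrow> 'a \<Rightarrow> ('a \<times> 'a \<Rightarrow> 'k) set"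
    and \<epsilon> :: "'x \<Rightarrow> 'a \<Rightarrow> 'k"
    and S :: "'x \<Rightarrow> 'x \<Rightarrow> 'a \<Rightarrow> 'a" +
  assumes algebras: "\<lbrakk>x \<in> X; y \<in> X\<rbrakk> \<Longrightarrow> assoc_algebra R (C x y)"
    and comult_hom: "\<lbrakk>x \<in> X; y \<in> X; z \<in> X\<rbrakk>
      \<Longrightarrow> \<Delta> x y z \<in> alg_hom R (C x z) (tensor R (C x y) (C y z))"
    and counit_hom: "x \<in> X \<Longrightarrow> \<epsilon> x \<in> alg_hom R (C x x) (base_algebra R)"
    and antipode_lin: "\<lbrakk>x \<in> X; y \<in> X\<rbrakk> \<Longrightarrow> S x y \<in> lin_hom R (C y x) (C x y)"
    and coassoc: "\<lbrakk>x \<in> X; u \<in> X; y \<in> X; z \<in> X; h \<in> carrier (C x z)\<rbrakk>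
      \<Longrightarrow> tensor_map R (tensor R (C x u) (C u y)) (C y z) (\<Delta> x u y) (\<lambda>b. b) (\<Delta> x y z h)
        = tensor_assoc R (C x u) (C u y) (C y z)
            (tensor_map R (C x u) (tensor R (C u y) (C y z)) (\<lambda>a. a) (\<Delta> u y z) (\<Delta> x u z h))"
    and counit_left: "\<lbrakk>x \<in> X; z \<in> X; h \<in> carrier (C x z)\<rbrakk>
      \<Longrightarrow> tensor_lift R (C x z) (\<lambda>a b. \<epsilon> x a \<odot>\<^bsub>C x z\<^esub> b) (\<Delta> x x z h) = h"
    and counit_right: "\<lbrakk>x \<in> X; z \<in> X; h \<in> carrier (C x z)\<rbrakk>
      \<Longrightarrow> tensor_lift R (C x z) (\<lambda>a b. \<epsilon> z b \<odot>\<^bsub>C x z\<^esub> a) (\<Delta> x z z h) = h"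
    and antipode_right: "\<lbrakk>x \<in> X; y \<in> X; l \<in> carrier (C x x)\<rbrakk>
      \<Longrightarrow> tensor_lift R (C x y) (\<lambda>a b. a \<otimes>\<^bsub>C x y\<^esub> S x y b) (\<Delta> x y x l)
        = \<epsilon> x l \<odot>\<^bsub>C x y\<^esub> \<one>\<^bsub>C x y\<^esub>"
    and antipode_left: "\<lbrakk>x \<in> X; y \<in> X; l \<in> carrier (C x x)\<rbrakk>
      \<Longrightarrow> tensor_lift R (C y x) (\<lambda>a b. S y x a \<otimes>\<^bsub>C y x\<^esub> b) (\<Delta> x y x l)
        = \<epsilon> x l \<odot>\<^bsub>C y x\<^esub> \<one>\<^bsub>C y x\<^esub>"


section \<open>Weak Hopf algebras\<close>

locale coalgebra = module R H for R and H (structure) +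
  fixes \<Delta> and \<epsilon>
  assumes comult_lin: "\<Delta> \<in> lin_hom R H (tensor R H H)"
    and counit_lin: "\<epsilon> \<in> lin_hom R H (base_algebra R)"
    and coassoc: "h \<in> carrier H
      \<Longrightarrow> tensor_map R (tensor R H H) H \<Delta> (\<lambda>b. b) (\<Delta> h)
        = tensor_assoc R H H H (tensor_map R H (tensor R H H) (\<lambda>a. a) \<Delta> (\<Delta> h))"
    and counit_left: "h \<in> carrier H \<Longrightarrow> tensor_lift R H (\<lambda>a b. \<epsilon> a \<odot> b) (\<Delta> h) = h"
    and counit_right: "h \<in> carrier H \<Longrightarrow> tensor_lift R H (\<lambda>a b. \<epsilon> b \<odot> a) (\<Delta> h) = h"

locale weak_hopf_algebra = assoc_algebra R H + coalgebra R H \<Delta> \<epsilon>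
  for R :: "('k, 'r) ring_scheme"
    and H :: "('k, 'a, 'm) module_scheme" (structure)
    and \<Delta> :: "'a \<Rightarrow> ('a \<times> 'a \<Rightarrow> 'k) set"
    and \<epsilon> :: "'a \<Rightarrow> 'k"
    and S :: "'a \<Rightarrow> 'a" +
  assumes comult_mult: "\<lbrakk>h \<in> carrier H; l \<in> carrier H\<rbrakk>
      \<Longrightarrow> \<Delta> (h \<otimes> l) = \<Delta> h \<otimes>\<^bsub>tensor R H H\<^esub> \<Delta> l"
    and counit_mult_12: "\<lbrakk>h \<in> carrier H; k \<in> carrier H; l \<in> carrier H\<rbrakk>
      \<Longrightarrow> \<epsilon> (h \<otimes> k \<otimes> l)
        = tensor_lift R (base_algebra R) (\<lambda>a b. \<epsilon> (h \<otimes> a) \<otimes>\<^bsub>R\<^esub> \<epsilon> (b \<otimes> l)) (\<Delta> k)"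
    and counit_mult_21: "\<lbrakk>h \<in> carrier H; k \<in> carrier H; l \<in> carrier H\<rbrakk>
      \<Longrightarrow> \<epsilon> (h \<otimes> k \<otimes> l)
        = tensor_lift R (base_algebra R) (\<lambda>a b. \<epsilon> (h \<otimes> b) \<otimes>\<^bsub>R\<^esub> \<epsilon> (a \<otimes> l)) (\<Delta> k)"
    and comult_one_12:
      "tensor_map R (tensor R H H) H \<Delta> (\<lambda>b. b) (\<Delta> \<one>)
        = pure_tensor R (tensor R H H) H (\<Delta> \<one>) \<one>
          \<otimes>\<^bsub>tensor R (tensor R H H) H\<^esub>
            tensor_assoc R H H H (pure_tensor R H (tensor R H H) \<one> (\<Delta> \<one>))"
    and comult_one_21:
      "tensor_map R (tensor R H H) H \<Delta> (\<lambda>b. b) (\<Delta> \<one>)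
        = tensor_assoc R H H H (pure_tensor R H (tensor R H H) \<one> (\<Delta> \<one>))
          \<otimes>\<^bsub>tensor R (tensor R H H) H\<^esub>
            pure_tensor R (tensor R H H) H (\<Delta> \<one>) \<one>"
    and antipode_lin: "S \<in> lin_hom R H H"
    and antipode_right: "h \<in> carrier H
      \<Longrightarrow> tensor_lift R H (\<lambda>a b. a \<otimes> S b) (\<Delta> h)
        = tensor_lift R H (\<lambda>a b. \<epsilon> (a \<otimes> h) \<odot> b) (\<Delta> \<one>)"
    and antipode_left: "h \<in> carrier H
      \<Longrightarrow> tensor_lift R H (\<lambda>a b. S a \<otimes> b) (\<Delta> h)
        = tensor_lift R H (\<lambda>a b. \<epsilon> (h \<otimes> b) \<odot> a) (\<Delta> \<one>)"
    and antipode_both: "h \<in> carrier H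
      \<Longrightarrow> tensor_lift R H (\<lambda>t c. tensor_lift R H (\<lambda>a b. S a \<otimes> b \<otimes> S c) t)
            (tensor_map R (tensor R H H) H \<Delta> (\<lambda>b. b) (\<Delta> h))
        = S h"


section \<open>The direct sum of a dual Hopf category with finitely many objects\<close>

text \<open>
  Over a finite index set the direct sum is the direct product. Its elements are extensional
  functions on the index set.
\<close>

definition direct_product ::
    "'i set \<Rightarrow> ('i \<Rightarrow> ('k, 'a, 'm) module_scheme) \<Rightarrow> ('k, 'i \<Rightarrow> 'a) module"
  where "direct_product I A =
    \<lparr>carrier = (\<Pi>\<^sub>E i\<in>I. carrier (A i)),
     mult = (\<lambda>f g. \<lambda>i\<in>I. f i \<otimes>\<^bsub>A i\<^esub> g i),
     one = (\<lambda>i\<in>I. \<one>\<^bsub>A i\<^esub>),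
     zero = (\<lambda>i\<in>I. \<zero>\<^bsub>A i\<^esub>),
     add = (\<lambda>f g. \<lambda>i\<in>I. f i \<oplus>\<^bsub>A i\<^esub> g i),
     smult = (\<lambda>r f. \<lambda>i\<in>I. r \<odot>\<^bsub>A i\<^esub> f i)\<rparr>"

definition direct_incl ::
    "'i set \<Rightarrow> ('i \<Rightarrow> ('k, 'a, 'm) module_scheme) \<Rightarrow> 'i \<Rightarrow> 'a \<Rightarrow> 'i \<Rightarrow> 'a"
  where "direct_incl I A i a = (\<lambda>j\<in>I. if j = i then a else \<zero>\<^bsub>A j\<^esub>)"

text \<open>Linear extension to the direct sum of a family of maps \<open>f i\<close> into \<open>P\<close>.\<close>

definition direct_lift ::
    "'i set \<Rightarrow> ('k, 'c, 'p) module_scheme \<Rightarrow> ('i \<Rightarrow> 'a \<Rightarrow> 'c) \<Rightarrow> ('i \<Rightarrow> 'a) \<Rightarrow> 'c"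
  where "direct_lift I P f h = (\<Oplus>\<^bsub>P\<^esub>i\<in>I. f i (h i))"

definition total_algebra ::
    "'x set \<Rightarrow> ('x \<Rightarrow> 'x \<Rightarrow> ('k, 'a, 'm) module_scheme) \<Rightarrow> ('k, 'x \<times> 'x \<Rightarrow> 'a) module"
  where "total_algebra X C = direct_product (X \<times> X) (\<lambda>(x, y). C x y)"

definition total_incl ::
    "'x set \<Rightarrow> ('x \<Rightarrow> 'x \<Rightarrow> ('k, 'a, 'm) module_scheme) \<Rightarrow> 'x \<Rightarrow> 'x \<Rightarrow> 'a \<Rightarrow> 'x \<times> 'x \<Rightarrow> 'a"
  where "total_incl X C x y = direct_incl (X \<times> X) (\<lambda>(x, y). C x y) (x, y)"

definition total_comult ::
    "('k, 'r) ring_scheme \<Rightarrow> 'x set \<Rightarrow> ('x \<Rightarrow> 'x \<Rightarrow> ('k, 'a, 'm) module_scheme)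
      \<Rightarrow> ('x \<Rightarrow> 'x \<Rightarrow> 'x \<Rightarrow> 'a \<Rightarrow> ('a \<times> 'a \<Rightarrow> 'k) set)
      \<Rightarrow> ('x \<times> 'x \<Rightarrow> 'a) \<Rightarrow> (('x \<times> 'x \<Rightarrow> 'a) \<times> ('x \<times> 'x \<Rightarrow> 'a) \<Rightarrow> 'k) set"
  where "total_comult R X C \<Delta> =
    (let H = total_algebra X C in
      direct_lift (X \<times> X) (tensor R H H)
        (\<lambda>(x, z) h. \<Oplus>\<^bsub>tensor R H H\<^esub>y\<in>X.
          tensor_map R H H (total_incl X C x y) (total_incl X C y z) (\<Delta> x y z h)))"

definition total_counit ::
    "('k, 'r) ring_scheme \<Rightarrow> 'x set \<Rightarrow> ('x \<Rightarrow> 'a \<Rightarrow> 'k) \<Rightarrow> ('x \<times> 'x \<Rightarrow> 'a) \<Rightarrow> 'k"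
  where "total_counit R X \<epsilon> =
    direct_lift (X \<times> X) (base_algebra R) (\<lambda>(x, y) h. if x = y then \<epsilon> x h else \<zero>\<^bsub>R\<^esub>)"

definition total_antipode ::
    "'x set \<Rightarrow> ('x \<Rightarrow> 'x \<Rightarrow> ('k, 'a, 'm) module_scheme) \<Rightarrow> ('x \<Rightarrow> 'x \<Rightarrow> 'a \<Rightarrow> 'a)
      \<Rightarrow> ('x \<times> 'x \<Rightarrow> 'a) \<Rightarrow> 'x \<times> 'x \<Rightarrow> 'a"
  where "total_antipode X C S =
    direct_lift (X \<times> X) (total_algebra X C) (\<lambda>(x, y) h. total_incl X C y x (S y x h))"

end

theory Submission
  imports Defs
begin

text \<open>
  Every axiom compares two maps that are linear in each argument, so it can be tested on elements
  \<open>\<iota> x z a\<close> of a single summand. There \<open>\<Delta>\<close> becomes the sum over \<open>y\<close> of the maps \<open>\<Delta> x y z\<close> followed by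
  the inclusion of \<open>C x y \<otimes> C y z\<close>. Products of elements of different summands vanish and \<open>\<epsilon>\<close> is
  supported on the diagonal, so at most the matching indices survive in the resulting sums, and
  what remains is the corresponding axiom of the dual Hopf category. In \<open>S(h\<^sub>1) h\<^sub>2 S(h\<^sub>3)\<close>, for
  instance, only \<open>h\<^sub>1 \<in> C x z\<close>, \<open>h\<^sub>2 \<in> C z x\<close>, \<open>h\<^sub>3 \<in> C x z\<close> contribute.
\<close>

section \<open>Linear and bilinear maps\<close>

text \<open>Tensors are cosets and \<open>tensor_lift\<close> evaluates a representative picked by
  \<open>SOME\<close>, so a Sweedler formula is hardly usable before the map under it is known to be
  bilinear. Hence the closure rules for \<open>lin_hom\<close> and \<open>bilin_hom\<close>, and
  three facts about lifts: independence of the representative (\<open>tensor_lift_coset\<close>),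
  determination of a linear map by its values on pure tensors (\<open>lin_hom_tensor_eqI\<close>),
  and indifference to values outside the carriers (\<open>tensor_lift_cong\<close>). The last is
  needed because all algebraic laws hold on carriers only. The weak axioms are forced by the unit.
  \<open>\<Delta>(1)\<close> is the sum of \<open>e x y \<otimes> e y z\<close>, where
  \<open>e x y\<close> is the unit of \<open>C x y\<close>, whereas \<open>1 \<otimes> 1\<close>
  also contains the terms with unequal middle objects. The unit does not in general lie in a single
  summand, so testing on summands does not reach it; it is expanded separately into the orthogonal
  idempotents \<open>e x y\<close>, using that every \<open>\<Delta> x y z\<close> preserves
  units.\<close>

lemma lin_homI:
  assumes "\<And>a. a \<in> carrier M \<Longrightarrow> f a \<in> carrier N"
    and "\<And>a b. \<lbrakk>a \<in> carrier M; b \<in> carrier M\<rbrakk> \<Longrightarrow> f (a \<oplus>\<^bsub>M\<^esub> b) = f a \<oplus>\<^bsub>N\<^esub> f b"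
    and "\<And>r a. \<lbrakk>r \<in> carrier R; a \<in> carrier M\<rbrakk> \<Longrightarrow> f (r \<odot>\<^bsub>M\<^esub> a) = r \<odot>\<^bsub>N\<^esub> f a"
  shows "f \<in> lin_hom R M N"
  using assms by (auto simp: lin_hom_def)

lemma lin_hom_closed: "\<lbrakk>f \<in> lin_hom R M N; a \<in> carrier M\<rbrakk> \<Longrightarrow> f a \<in> carrier N"
  by (auto simp: lin_hom_def)

lemma lin_hom_add:
  "\<lbrakk>f \<in> lin_hom R M N; a \<in> carrier M; b \<in> carrier M\<rbrakk> \<Longrightarrow> f (a \<oplus>\<^bsub>M\<^esub> b) = f a \<oplus>\<^bsub>N\<^esub> f b"
  by (auto simp: lin_hom_def)

lemma lin_hom_smult:
  "\<lbrakk>f \<in> lin_hom R M N; r \<in> carrier R; a \<in> carrier M\<rbrakk> \<Longrightarrow> f (r \<odot>\<^bsub>M\<^esub> a) = r \<odot>\<^bsub>N\<^esub> f a"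
  by (auto simp: lin_hom_def)

text \<open>\<open>lin_hom\<close> contains no clause about zero; the claim comes from homogeneity
  with the scalar zero.\<close>

lemma lin_hom_zero:
  assumes "module R M" "module R N" "f \<in> lin_hom R M N"
  shows "f \<zero>\<^bsub>M\<^esub> = \<zero>\<^bsub>N\<^esub>"
proof -
  interpret M: module R M by fact
  interpret N: module R N by fact
  have "f \<zero>\<^bsub>M\<^esub> = f (\<zero>\<^bsub>R\<^esub> \<odot>\<^bsub>M\<^esub> \<zero>\<^bsub>M\<^esub>)" by simp
  also have "\<dots> = \<zero>\<^bsub>R\<^esub> \<odot>\<^bsub>N\<^esub> f \<zero>\<^bsub>M\<^esub>"
    using assms(3) by (intro lin_hom_smult) auto
  also have "\<dots> = \<zero>\<^bsub>N\<^esub>" using lin_hom_closed[OF assms(3)] by simp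
  finally show ?thesis .
qed

text \<open>The bilinearity relations are differences, and lifts have to be evaluated on them.
  Negation is handled as the multiple by minus one.\<close>

lemma lin_hom_minus:
  assumes "module R M" "module R N" "f \<in> lin_hom R M N" "a \<in> carrier M" "b \<in> carrier M"
  shows "f (a \<ominus>\<^bsub>M\<^esub> b) = f a \<ominus>\<^bsub>N\<^esub> f b"
proof -
  interpret M: module R M by fact
  interpret N: module R N by fact
  have "f b \<in> carrier N" using assms by (simp add: lin_hom_closed[OF assms(3)])
  moreover have "\<ominus>\<^bsub>M\<^esub> b = (\<ominus>\<^bsub>R\<^esub> \<one>\<^bsub>R\<^esub>) \<odot>\<^bsub>M\<^esub> b" using assms by (simp add: M.smult_l_minus)
  ultimately have "f (\<ominus>\<^bsub>M\<^esub> b) = \<ominus>\<^bsub>N\<^esub> f b"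
    using assms by (simp add: lin_hom_smult[OF assms(3)] N.smult_l_minus)
  then show ?thesis
    using assms by (simp add: a_minus_def lin_hom_add[OF assms(3)])
qed

text \<open>For infinite \<open>A\<close> both sums are zero by the convention for
  \<open>finsum\<close>, and a linear map preserves zero; the rest is induction on the index
  set.\<close>

lemma lin_hom_finsum:
  assumes "module R M" "module R N" "f \<in> lin_hom R M N" "g \<in> A \<rightarrow> carrier M"
  shows "f (\<Oplus>\<^bsub>M\<^esub>i\<in>A. g i) = (\<Oplus>\<^bsub>N\<^esub>i\<in>A. f (g i))"
proof -
  interpret M: module R M by fact
  interpret N: module R N by fact
  show ?thesis
    using assms(4)
  proof (induction A rule: infinite_finite_induct)
    case (insert i A)
    then have "g i \<in> carrier M" "g \<in> A \<rightarrow> carrier M" by auto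
    with insert show ?case
      using lin_hom_closed[OF assms(3)]
      by (simp add: lin_hom_add[OF assms(3)] Pi_def)
  qed (simp_all add: lin_hom_zero[OF assms(1-3)])
qed

lemma lin_hom_id: "(\<lambda>a. a) \<in> lin_hom R M M"
  by (rule lin_homI) auto

lemma lin_hom_comp:
  "\<lbrakk>f \<in> lin_hom R M N; g \<in> lin_hom R N P\<rbrakk> \<Longrightarrow> (\<lambda>a. g (f a)) \<in> lin_hom R M P"
  by (simp add: lin_hom_def Pi_iff)

lemma lin_hom_const_zero:
  assumes "module R N"
  shows "(\<lambda>_. \<zero>\<^bsub>N\<^esub>) \<in> lin_hom R M N"
proof -
  interpret N: module R N by fact
  show ?thesis by (rule lin_homI) auto
qed

lemma lin_hom_sum:
  assumes "module R M" "module R N" "\<And>i. i \<in> A \<Longrightarrow> f i \<in> lin_hom R M N"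
  shows "(\<lambda>a. \<Oplus>\<^bsub>N\<^esub>i\<in>A. f i a) \<in> lin_hom R M N"
proof -
  interpret M: module R M by fact
  interpret N: module R N by fact
  show ?thesis
    using assms(3)
  proof (induction A rule: infinite_finite_induct)
    case (insert i A)
    then have fi: "f i \<in> lin_hom R M N"
      and IH: "(\<lambda>a. \<Oplus>\<^bsub>N\<^esub>i\<in>A. f i a) \<in> lin_hom R M N"
      and fj: "\<And>a j. \<lbrakk>a \<in> carrier M; j \<in> A\<rbrakk> \<Longrightarrow> f j a \<in> carrier N"
      by (auto intro: lin_hom_closed)
    have cl: "f i a \<in> carrier N" "(\<Oplus>\<^bsub>N\<^esub>j\<in>A. f j a) \<in> carrier N" if "a \<in> carrier M" for a
      using lin_hom_closed[OF fi that] lin_hom_closed[OF IH that] by auto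
    have eq: "(\<Oplus>\<^bsub>N\<^esub>j\<in>insert i A. f j a) = f i a \<oplus>\<^bsub>N\<^esub> (\<Oplus>\<^bsub>N\<^esub>j\<in>A. f j a)"
      if "a \<in> carrier M" for a
      using insert.hyps fj[OF that] cl[OF that] by (simp add: Pi_def)
    show ?case
      by (rule lin_homI) (simp_all add: eq cl lin_hom_add[OF fi] lin_hom_add[OF IH] N.M.a_ac
          lin_hom_smult[OF fi] lin_hom_smult[OF IH] N.smult_r_distr)
  qed (simp_all add: lin_hom_const_zero[OF assms(2)])
qed

text \<open>Commutativity of \<open>R\<close> enters here: the two scalars \<open>r\<close> and
  \<open>s\<close> have to be exchanged.\<close>

lemma lin_hom_smult_map:
  assumes "module R N" "f \<in> lin_hom R M N" "r \<in> carrier R"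
  shows "(\<lambda>a. r \<odot>\<^bsub>N\<^esub> f a) \<in> lin_hom R M N"
proof -
  interpret N: module R N by fact
  show ?thesis
  proof (rule lin_homI)
    fix s a assume sa: "s \<in> carrier R" "a \<in> carrier M"
    then have "f a \<in> carrier N" by (simp add: lin_hom_closed[OF assms(2)])
    with sa assms(3) show "r \<odot>\<^bsub>N\<^esub> f (s \<odot>\<^bsub>M\<^esub> a) = s \<odot>\<^bsub>N\<^esub> (r \<odot>\<^bsub>N\<^esub> f a)"
      by (simp add: lin_hom_smult[OF assms(2)] N.smult_assoc1[symmetric] N.R.m_comm)
  qed (use assms(3) lin_hom_closed[OF assms(2)] in \<open>simp_all add: lin_hom_add[OF assms(2)] N.smult_r_distr\<close>)
qed

text \<open>Phrased through \<open>lin_hom\<close> in each variable, so that freezing one argument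
  makes every lemma on linear maps applicable.\<close>

definition bilin_hom ::
    "('k, 'r) ring_scheme \<Rightarrow> ('k, 'a, 'm) module_scheme \<Rightarrow> ('k, 'b, 'n) module_scheme
      \<Rightarrow> ('k, 'c, 'p) module_scheme \<Rightarrow> ('a \<Rightarrow> 'b \<Rightarrow> 'c) set"
  where "bilin_hom R M N P =
    {\<phi>. (\<forall>a\<in>carrier M. (\<lambda>b. \<phi> a b) \<in> lin_hom R N P) \<and> (\<forall>b\<in>carrier N. (\<lambda>a. \<phi> a b) \<in> lin_hom R M P)}"

lemma bilin_homI:
  assumes "\<And>a. a \<in> carrier M \<Longrightarrow> (\<lambda>b. \<phi> a b) \<in> lin_hom R N P"
    and "\<And>b. b \<in> carrier N \<Longrightarrow> (\<lambda>a. \<phi> a b) \<in> lin_hom R M P"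
  shows "\<phi> \<in> bilin_hom R M N P"
  using assms by (simp add: bilin_hom_def)

lemma bilin_hom_right: "\<lbrakk>\<phi> \<in> bilin_hom R M N P; a \<in> carrier M\<rbrakk> \<Longrightarrow> (\<lambda>b. \<phi> a b) \<in> lin_hom R N P"
  by (simp add: bilin_hom_def)

lemma bilin_hom_left: "\<lbrakk>\<phi> \<in> bilin_hom R M N P; b \<in> carrier N\<rbrakk> \<Longrightarrow> (\<lambda>a. \<phi> a b) \<in> lin_hom R M P"
  by (simp add: bilin_hom_def)

lemma bilin_hom_closed:
  "\<lbrakk>\<phi> \<in> bilin_hom R M N P; a \<in> carrier M; b \<in> carrier N\<rbrakk> \<Longrightarrow> \<phi> a b \<in> carrier P"
  by (rule lin_hom_closed[OF bilin_hom_right])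

lemma bilin_hom_comp:
  "\<lbrakk>\<phi> \<in> bilin_hom R M N P; f \<in> lin_hom R P Q\<rbrakk> \<Longrightarrow> (\<lambda>a b. f (\<phi> a b)) \<in> bilin_hom R M N Q"
  by (auto simp: bilin_hom_def intro: lin_hom_comp)

lemma bilin_hom_comp2:
  assumes "\<phi> \<in> bilin_hom R M N P" "f \<in> lin_hom R M' M" "g \<in> lin_hom R N' N"
  shows "(\<lambda>a b. \<phi> (f a) (g b)) \<in> bilin_hom R M' N' P"
proof (rule bilin_homI)
  fix a assume "a \<in> carrier M'"
  then show "(\<lambda>b. \<phi> (f a) (g b)) \<in> lin_hom R N' P"
    using lin_hom_closed[OF assms(2)] by (intro lin_hom_comp[OF assms(3)] bilin_hom_right[OF assms(1)])
next
  fix b assume "b \<in> carrier N'"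
  then show "(\<lambda>a. \<phi> (f a) (g b)) \<in> lin_hom R M' P"
    using lin_hom_closed[OF assms(3)]
    by (intro lin_hom_comp[OF assms(2), where g = "\<lambda>c. \<phi> c (g b)"] bilin_hom_left[OF assms(1)])
qed


lemma bilin_hom_const_zero:
  assumes "module R P"
  shows "(\<lambda>_ _. \<zero>\<^bsub>P\<^esub>) \<in> bilin_hom R M N P"
  by (simp add: bilin_hom_def lin_hom_const_zero[OF assms])

lemma bilin_hom_sum:
  assumes "module R M" "module R N" "module R P" "\<And>i. i \<in> A \<Longrightarrow> \<phi> i \<in> bilin_hom R M N P"
  shows "(\<lambda>a b. \<Oplus>\<^bsub>P\<^esub>i\<in>A. \<phi> i a b) \<in> bilin_hom R M N P"
proof (rule bilin_homI)
  fix a assume a: "a \<in> carrier M"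
  show "(\<lambda>b. \<Oplus>\<^bsub>P\<^esub>i\<in>A. \<phi> i a b) \<in> lin_hom R N P"
    by (rule lin_hom_sum[OF assms(2,3)]) (rule bilin_hom_right[OF assms(4) a])
next
  fix b assume b: "b \<in> carrier N"
  show "(\<lambda>a. \<Oplus>\<^bsub>P\<^esub>i\<in>A. \<phi> i a b) \<in> lin_hom R M P"
    by (rule lin_hom_sum[OF assms(1,3)]) (rule bilin_hom_left[OF assms(4) b])
qed

text \<open>Serves the mirrored axioms: the opposite multiplication in the second weak unit axiom,
  and exchanged Sweedler legs in the counit and antipode axioms.\<close>

lemma bilin_hom_flip: "\<phi> \<in> bilin_hom R M N P \<Longrightarrow> (\<lambda>b a. \<phi> a b) \<in> bilin_hom R N M P"
  by (simp add: bilin_hom_def)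

text \<open>Expands the product of two comultiplications, each of which is a sum over middle
  objects.\<close>

lemma bilin_hom_finsum:
  assumes M: "module R M" and N: "module R N" and P: "module R P" and \<phi>: "\<phi> \<in> bilin_hom R M N P"
    and f: "f \<in> A \<rightarrow> carrier M" and g: "g \<in> B \<rightarrow> carrier N"
  shows "\<phi> (\<Oplus>\<^bsub>M\<^esub>i\<in>A. f i) (\<Oplus>\<^bsub>N\<^esub>j\<in>B. g j) = (\<Oplus>\<^bsub>P\<^esub>i\<in>A. \<Oplus>\<^bsub>P\<^esub>j\<in>B. \<phi> (f i) (g j))"
proof -
  interpret M: module R M by (rule M)
  interpret N: module R N by (rule N)
  interpret P: module R P by (rule P)
  have gs: "(\<Oplus>\<^bsub>N\<^esub>j\<in>B. g j) \<in> carrier N" using g by simp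
  have "\<phi> (\<Oplus>\<^bsub>M\<^esub>i\<in>A. f i) (\<Oplus>\<^bsub>N\<^esub>j\<in>B. g j) = (\<Oplus>\<^bsub>P\<^esub>i\<in>A. \<phi> (f i) (\<Oplus>\<^bsub>N\<^esub>j\<in>B. g j))"
    by (rule lin_hom_finsum[OF M P bilin_hom_left[OF \<phi> gs] f])
  also have "\<dots> = (\<Oplus>\<^bsub>P\<^esub>i\<in>A. \<Oplus>\<^bsub>P\<^esub>j\<in>B. \<phi> (f i) (g j))"
    by (rule P.M.finsum_cong')
      (use f g in \<open>auto intro!: P.M.finsum_closed bilin_hom_closed[OF \<phi>]
        lin_hom_finsum[OF N P bilin_hom_right[OF \<phi>]]\<close>)
  finally show ?thesis .
qed

lemma module_base_algebra:
  fixes R (structure)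
  assumes "cring R"
  shows "module R (base_algebra R)"
proof -
  interpret cring R by fact
  show ?thesis
  proof (rule moduleI)
    show "abelian_group (base_algebra R)"
      by (rule abelian_groupI) (auto simp: base_algebra_def a_ac intro: bexI[of _ "\<ominus> x" for x] l_neg)
  qed (auto simp: base_algebra_def l_distr r_distr m_assoc assms)
qed

lemma base_algebra_simps [simp]:
  "carrier (base_algebra R) = carrier R" "mult (base_algebra R) = mult R" "one (base_algebra R) = one R"
  "zero (base_algebra R) = zero R" "add (base_algebra R) = add R" "smult (base_algebra R) = mult R"
  by (simp_all add: base_algebra_def)

lemma smult_bilin:
  assumes "module R M"
  shows "smult M \<in> bilin_hom R (base_algebra R) M M"
proof -
  interpret M: module R M by fact
  show ?thesis
    by (intro bilin_homI lin_homI)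
      (simp_all add: M.smult_l_distr M.smult_r_distr M.smult_assoc1[symmetric] M.R.m_comm)
qed

lemma (in assoc_algebra) mult_bilin: "mult A \<in> bilin_hom R A A A"
  by (intro bilin_homI lin_homI)
    (simp_all add: l_distr r_distr smult_mult_left smult_mult_right)

section \<open>Free and quotient modules\<close>

lemma module_free_module:
  fixes R (structure)
  assumes "cring R"
  shows "module R (free_module R A)"
proof -
  interpret cring R by fact
  have fin: "finite {s. f s \<oplus> g s \<noteq> \<zero>}"
    if "finite {s. f s \<noteq> \<zero>}" "finite {s. g s \<noteq> \<zero>}" for f g :: "'c \<Rightarrow> 'a"
    by (rule finite_subset[OF _ finite_UnI[OF that]]) auto
  have fin': "finite {s. r \<otimes> f s \<noteq> \<zero>}"
    if "finite {s. f s \<noteq> \<zero>}" "r \<in> carrier R" for f :: "'c \<Rightarrow> 'a" and r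
    by (rule finite_subset[OF _ that(1)]) (use that in auto)
  \<comment> \<open>This includes arguments outside \<open>A\<close>, where the value is
    zero.\<close>
  have mem: "f s \<in> carrier R" if "f \<in> carrier (free_module R A)" for f s
    using that by (cases "s \<in> A") (auto simp: free_module_def)
  show ?thesis
  proof (rule moduleI)
    show "abelian_group (free_module R A)"
    proof (rule abelian_groupI)
      fix f assume f: "f \<in> carrier (free_module R A)"
      show "\<exists>g\<in>carrier (free_module R A). g \<oplus>\<^bsub>free_module R A\<^esub> f = \<zero>\<^bsub>free_module R A\<^esub>"
      proof (rule bexI)
        \<comment> \<open>The additive inverse is taken as the multiple by minus one, because
          \<open>fin'\<close> already bounds the support of multiples.\<close>
        show "(\<lambda>s. (\<ominus> \<one>) \<otimes> f s) \<in> carrier (free_module R A)"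
          using f fin'[of f "\<ominus> \<one>"] by (auto simp: free_module_def)
        show "(\<lambda>s. (\<ominus> \<one>) \<otimes> f s) \<oplus>\<^bsub>free_module R A\<^esub> f = \<zero>\<^bsub>free_module R A\<^esub>"
          using mem[OF f] by (auto simp: free_module_def l_minus l_neg)
      qed
    next
      fix f g h
      assume "f \<in> carrier (free_module R A)" "g \<in> carrier (free_module R A)"
        "h \<in> carrier (free_module R A)"
      then have m: "f s \<in> carrier R" "g s \<in> carrier R" "h s \<in> carrier R" for s
        by (simp_all add: mem)
      show "f \<oplus>\<^bsub>free_module R A\<^esub> g \<oplus>\<^bsub>free_module R A\<^esub> h = f \<oplus>\<^bsub>free_module R A\<^esub> (g \<oplus>\<^bsub>free_module R A\<^esub> h)"
        using m by (auto simp: free_module_def a_assoc)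
    next
      fix f g
      assume "f \<in> carrier (free_module R A)" "g \<in> carrier (free_module R A)"
      then have m: "f s \<in> carrier R" "g s \<in> carrier R" for s
        by (simp_all add: mem)
      show "f \<oplus>\<^bsub>free_module R A\<^esub> g = g \<oplus>\<^bsub>free_module R A\<^esub> f"
        using m by (auto simp: free_module_def a_comm)
    next
      fix f assume "f \<in> carrier (free_module R A)"
      then show "\<zero>\<^bsub>free_module R A\<^esub> \<oplus>\<^bsub>free_module R A\<^esub> f = f"
        using mem[of f] by (auto simp: free_module_def)
    qed (simp_all add: free_module_def fin)
    show "cring R" by fact
  qed (simp_all add: free_module_def fin' l_distr r_distr m_assoc mem[simplified free_module_def, simplified] fun_eq_iff)
qed

lemma free_gen_closed:
  assumes "cring R" "s \<in> A"
  shows "free_gen R s \<in> carrier (free_module R A)"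
proof -
  interpret cring R by fact
  show ?thesis
    using assms(2) by (auto simp: free_module_def free_gen_def intro: finite_subset[of _ "{s}"])
qed

context
  fixes R :: "('k, 'r) ring_scheme" and F :: "('k, 'a, 'm) module_scheme" and H
  assumes F: "module R F" and H: "submodule H R F"
begin

interpretation F: module R F by (rule F)

interpretation H: abelian_subgroup H F
  by (rule abelian_subgroupI3) (use H in \<open>auto simp: additive_subgroup_def submodule_def F.abelian_group_axioms\<close>)

lemma quotient_carrier: "carrier (quotient_module F H) = (\<lambda>a. H +>\<^bsub>F\<^esub> a) ` carrier F"
  by (auto simp: quotient_module_def A_RCOSETS_def' a_r_coset_def')

lemma quotient_add:
  "\<lbrakk>a \<in> carrier F; b \<in> carrier F\<rbrakk>
    \<Longrightarrow> (H +>\<^bsub>F\<^esub> a) \<oplus>\<^bsub>quotient_module F H\<^esub> (H +>\<^bsub>F\<^esub> b) = H +>\<^bsub>F\<^esub> (a \<oplus>\<^bsub>F\<^esub> b)"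
  by (simp add: quotient_module_def H.a_rcos_sum)

text \<open>The union in the definition of scalar multiplication ranges over equal sets: two members
  of a coset differ by some \<open>n\<close> in \<open>H\<close>, and \<open>r\<close> times
  \<open>n\<close> is again in \<open>H\<close>.\<close>

lemma quotient_smult:
  assumes "r \<in> carrier R" "a \<in> carrier F"
  shows "r \<odot>\<^bsub>quotient_module F H\<^esub> (H +>\<^bsub>F\<^esub> a) = H +>\<^bsub>F\<^esub> (r \<odot>\<^bsub>F\<^esub> a)"
proof -
  have "H +>\<^bsub>F\<^esub> (r \<odot>\<^bsub>F\<^esub> b) = H +>\<^bsub>F\<^esub> (r \<odot>\<^bsub>F\<^esub> a)" if b: "b \<in> H +>\<^bsub>F\<^esub> a" for b
  proof -
    obtain n where n: "n \<in> H" "b = n \<oplus>\<^bsub>F\<^esub> a"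
      using b by (auto simp: a_r_coset_def')
    have nF: "n \<in> carrier F" using n H.a_subset by auto
    have "r \<odot>\<^bsub>F\<^esub> n \<in> H" using H n assms(1) by (simp add: submodule.smult_closed)
    then have "r \<odot>\<^bsub>F\<^esub> b \<in> H +>\<^bsub>F\<^esub> (r \<odot>\<^bsub>F\<^esub> a)"
      using n nF assms by (auto simp: a_r_coset_def' F.smult_r_distr)
    then show ?thesis
      using assms F.a_repr_independence H.a_subgroup by (metis F.smult_closed)
  qed
  moreover have "a \<in> H +>\<^bsub>F\<^esub> a" using assms by (simp add: H.a_rcos_self)
  ultimately have "(\<Union>b\<in>H +>\<^bsub>F\<^esub> a. H +>\<^bsub>F\<^esub> (r \<odot>\<^bsub>F\<^esub> b)) = H +>\<^bsub>F\<^esub> (r \<odot>\<^bsub>F\<^esub> a)"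
    by (intro UN_constant_eq) blast+
  then show ?thesis by (simp add: quotient_module_def)
qed

lemma quotient_zero: "\<zero>\<^bsub>quotient_module F H\<^esub> = H +>\<^bsub>F\<^esub> \<zero>\<^bsub>F\<^esub>"
  using H.a_subset by (simp add: quotient_module_def)

lemma module_quotient: "module R (quotient_module F H)"
proof (rule moduleI)
  show "cring R" by (rule F.R.is_cring)
  show "abelian_group (quotient_module F H)"
  proof (rule abelian_groupI)
    fix t assume "t \<in> carrier (quotient_module F H)"
    then obtain a where a: "a \<in> carrier F" "t = H +>\<^bsub>F\<^esub> a" by (auto simp: quotient_carrier)
    show "\<exists>s\<in>carrier (quotient_module F H). s \<oplus>\<^bsub>quotient_module F H\<^esub> t = \<zero>\<^bsub>quotient_module F H\<^esub>"
      by (rule bexI[of _ "H +>\<^bsub>F\<^esub> (\<ominus>\<^bsub>F\<^esub> a)"])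
        (use a in \<open>auto simp: quotient_add quotient_zero quotient_carrier F.M.l_neg\<close>)
  qed (auto simp: quotient_carrier quotient_add quotient_zero F.M.a_ac)
qed (auto simp: quotient_carrier quotient_add quotient_smult F.smult_l_distr F.smult_r_distr
    F.smult_assoc1)

lemma quotient_map_lin: "(\<lambda>a. H +>\<^bsub>F\<^esub> a) \<in> lin_hom R F (quotient_module F H)"
  by (rule lin_homI) (auto simp: quotient_carrier quotient_add quotient_smult)

end

lemma submodule_generated:
  assumes "module R M" "G \<subseteq> carrier M"
  shows "submodule (generated_submodule R M G) R M" 
proof -
  interpret M: module R M by fact
  show ?thesis
  proof (rule M.submoduleI)
    show "generated_submodule R M G \<subseteq> carrier M"
      using M.carrier_is_submodule assms(2) by (auto simp: generated_submodule_def)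
    show "\<zero>\<^bsub>M\<^esub> \<in> generated_submodule R M G"
      by (auto simp: generated_submodule_def submodule_def dest: subgroup.one_closed)
  next
    fix a assume "a \<in> generated_submodule R M G"
    then show "\<ominus>\<^bsub>M\<^esub> a \<in> generated_submodule R M G"
      using M.submoduleE(3) by (simp add: generated_submodule_def)
  next
    fix a b assume "a \<in> generated_submodule R M G" "b \<in> generated_submodule R M G"
    then show "a \<oplus>\<^bsub>M\<^esub> b \<in> generated_submodule R M G"
      using M.submoduleE(5) by (simp add: generated_submodule_def)
  next
    fix r a assume "r \<in> carrier R" "a \<in> generated_submodule R M G"
    then show "r \<odot>\<^bsub>M\<^esub> a \<in> generated_submodule R M G"
      using M.submoduleE(4) by (simp add: generated_submodule_def)
  qed
qed

lemma generated_submodule_incl: "G \<subseteq> generated_submodule R M G"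
  by (auto simp: generated_submodule_def)

lemma generated_submodule_least:
  "\<lbrakk>submodule H R M; G \<subseteq> H\<rbrakk> \<Longrightarrow> generated_submodule R M G \<subseteq> H"
  by (auto simp: generated_submodule_def)

text \<open>This is how a linear map is shown to vanish on a generated submodule: its kernel is a
  submodule, so containing the generators suffices.\<close>

lemma submodule_kernel:
  assumes "module R M" "module R N" "f \<in> lin_hom R M N"
  shows "submodule {a \<in> carrier M. f a = \<zero>\<^bsub>N\<^esub>} R M"
proof -
  interpret M: module R M by fact
  interpret N: module R N by fact
  show ?thesis
  proof (rule M.submoduleI)
    fix a assume a: "a \<in> {a \<in> carrier M. f a = \<zero>\<^bsub>N\<^esub>}"
    have "\<ominus>\<^bsub>M\<^esub> a = (\<ominus>\<^bsub>R\<^esub> \<one>\<^bsub>R\<^esub>) \<odot>\<^bsub>M\<^esub> a" using a by (simp add: M.smult_l_minus)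
    then show "\<ominus>\<^bsub>M\<^esub> a \<in> {a \<in> carrier M. f a = \<zero>\<^bsub>N\<^esub>}"
      using a by (simp add: lin_hom_smult[OF assms(3)])
  qed (auto simp: lin_hom_zero[OF assms] lin_hom_add[OF assms(3)] lin_hom_smult[OF assms(3)])
qed

text \<open>The universal map out of the free module. \<open>tensor_lift\<close> is this map at a
  chosen representative; separating it allows linearity to be proved before any choice is
  involved.\<close>

definition free_lift ::
    "('k, 'r) ring_scheme \<Rightarrow> ('k, 'c, 'p) module_scheme \<Rightarrow> ('s \<Rightarrow> 'c) \<Rightarrow> ('s \<Rightarrow> 'k) \<Rightarrow> 'c"
  where "free_lift R P \<phi> f = (\<Oplus>\<^bsub>P\<^esub>s\<in>{s. f s \<noteq> \<zero>\<^bsub>R\<^esub>}. f s \<odot>\<^bsub>P\<^esub> \<phi> s)"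

context
  fixes R :: "('k, 'r) ring_scheme" and P :: "('k, 'c, 'p) module_scheme" and A :: "'s set"
    and \<phi> :: "'s \<Rightarrow> 'c"
  assumes P: "module R P" and \<phi>: "\<phi> \<in> A \<rightarrow> carrier P"
begin

interpretation P: module R P by (rule P)

text \<open>The support of a sum or of a multiple can be smaller than the supports of the functions
  it is formed from. Comparing lifts therefore needs a common finite index set.\<close>

lemma free_lift_superset:
  assumes "f \<in> carrier (free_module R A)" "finite B" "{s. f s \<noteq> \<zero>\<^bsub>R\<^esub>} \<subseteq> B" "B \<subseteq> A"
  shows "free_lift R P \<phi> f = (\<Oplus>\<^bsub>P\<^esub>s\<in>B. f s \<odot>\<^bsub>P\<^esub> \<phi> s)"
  unfolding free_lift_def
proof (rule P.M.add.finprod_mono_neutral_cong_left[OF assms(2,3)])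
  show "(\<lambda>s. f s \<odot>\<^bsub>P\<^esub> \<phi> s) \<in> B \<rightarrow> carrier P"
    using assms(1,4) \<phi> by (auto simp: free_module_def)
qed (use assms(4) \<phi> in \<open>auto simp: Pi_iff subset_iff\<close>)

lemma free_lift_lin: "free_lift R P \<phi> \<in> lin_hom R (free_module R A) P"
proof (rule lin_homI)
  fix f assume f: "f \<in> carrier (free_module R A)"
  then show "free_lift R P \<phi> f \<in> carrier P"
    unfolding free_lift_def using \<phi> by (intro P.M.finsum_closed) (auto simp: free_module_def)
next
  fix f g assume f: "f \<in> carrier (free_module R A)" and g: "g \<in> carrier (free_module R A)"
  interpret F: module R "free_module R A" by (rule module_free_module[OF P.R.is_cring])
  let ?B = "{s. f s \<noteq> \<zero>\<^bsub>R\<^esub>} \<union> {s. g s \<noteq> \<zero>\<^bsub>R\<^esub>}"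
  have fg: "f \<oplus>\<^bsub>free_module R A\<^esub> g = (\<lambda>s. f s \<oplus>\<^bsub>R\<^esub> g s)" by (simp add: free_module_def)
  have B: "finite ?B" "?B \<subseteq> A" using f g by (auto simp: free_module_def)
  have cl: "f s \<in> carrier R" "g s \<in> carrier R" "\<phi> s \<in> carrier P" if "s \<in> ?B" for s
    using that f g B(2) \<phi> by (auto simp: free_module_def)
  have "free_lift R P \<phi> (f \<oplus>\<^bsub>free_module R A\<^esub> g) = (\<Oplus>\<^bsub>P\<^esub>s\<in>?B. (f s \<oplus>\<^bsub>R\<^esub> g s) \<odot>\<^bsub>P\<^esub> \<phi> s)"
    by (subst free_lift_superset[of _ ?B]) (use B F.M.a_closed[OF f g] in \<open>auto simp: fg\<close>)
  also have "\<dots> = (\<Oplus>\<^bsub>P\<^esub>s\<in>?B. f s \<odot>\<^bsub>P\<^esub> \<phi> s \<oplus>\<^bsub>P\<^esub> g s \<odot>\<^bsub>P\<^esub> \<phi> s)"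
    by (rule P.M.finsum_cong') (use cl in \<open>auto simp: P.smult_l_distr\<close>)
  also have "\<dots> = (\<Oplus>\<^bsub>P\<^esub>s\<in>?B. f s \<odot>\<^bsub>P\<^esub> \<phi> s) \<oplus>\<^bsub>P\<^esub> (\<Oplus>\<^bsub>P\<^esub>s\<in>?B. g s \<odot>\<^bsub>P\<^esub> \<phi> s)"
    using cl by (intro P.M.finsum_addf) auto
  also have "\<dots> = free_lift R P \<phi> f \<oplus>\<^bsub>P\<^esub> free_lift R P \<phi> g"
    using f g B by (simp add: free_lift_superset[of _ ?B])
  finally show "free_lift R P \<phi> (f \<oplus>\<^bsub>free_module R A\<^esub> g) = free_lift R P \<phi> f \<oplus>\<^bsub>P\<^esub> free_lift R P \<phi> g" .
next
  fix r f assume r: "r \<in> carrier R" and f: "f \<in> carrier (free_module R A)"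
  interpret F: module R "free_module R A" by (rule module_free_module[OF P.R.is_cring])
  let ?B = "{s. f s \<noteq> \<zero>\<^bsub>R\<^esub>}"
  have rf: "r \<odot>\<^bsub>free_module R A\<^esub> f = (\<lambda>s. r \<otimes>\<^bsub>R\<^esub> f s)" by (simp add: free_module_def)
  have B: "finite ?B" "?B \<subseteq> A" using f by (auto simp: free_module_def)
  have cl: "f s \<in> carrier R" "\<phi> s \<in> carrier P" if "s \<in> ?B" for s
    using that f B(2) \<phi> by (auto simp: free_module_def)
  have "free_lift R P \<phi> (r \<odot>\<^bsub>free_module R A\<^esub> f) = (\<Oplus>\<^bsub>P\<^esub>s\<in>?B. (r \<otimes>\<^bsub>R\<^esub> f s) \<odot>\<^bsub>P\<^esub> \<phi> s)"
    by (subst free_lift_superset[of _ ?B]) (use r B F.smult_closed[OF r f] in \<open>auto simp: rf\<close>)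
  also have "\<dots> = (\<Oplus>\<^bsub>P\<^esub>s\<in>?B. r \<odot>\<^bsub>P\<^esub> (f s \<odot>\<^bsub>P\<^esub> \<phi> s))"
    by (rule P.M.finsum_cong') (use r cl in \<open>auto simp: P.smult_assoc1\<close>)
  also have "\<dots> = r \<odot>\<^bsub>P\<^esub> free_lift R P \<phi> f"
    unfolding free_lift_def using r cl B by (intro P.finsum_smult_ldistr[symmetric]) auto
  finally show "free_lift R P \<phi> (r \<odot>\<^bsub>free_module R A\<^esub> f) = r \<odot>\<^bsub>P\<^esub> free_lift R P \<phi> f" .
qed

lemma free_lift_gen:
  assumes "s \<in> A"
  shows "free_lift R P \<phi> (free_gen R s) = \<phi> s"
proof -
  have "free_lift R P \<phi> (free_gen R s) = (\<Oplus>\<^bsub>P\<^esub>t\<in>{s}. free_gen R s t \<odot>\<^bsub>P\<^esub> \<phi> t)"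
    using assms free_gen_closed[OF P.R.is_cring assms]
    by (intro free_lift_superset) (auto simp: free_gen_def)
  also have "\<dots> = \<phi> s"
    using \<phi> assms by (auto simp: free_gen_def Pi_iff)
  finally show ?thesis .
qed

end

text \<open>The expansion of an element in the basis of generators, from which it follows later that
  pure tensors span. At a point \<open>t\<close> only the generator at \<open>t\<close>
  contributes.\<close>

lemma free_lift_free_gen:
  assumes "cring R" "f \<in> carrier (free_module R A)"
  shows "free_lift R (free_module R A) (free_gen R) f = f"
proof -
  interpret R: cring R by fact
  interpret F: module R "free_module R A" by (rule module_free_module[OF assms(1)])
  have B: "finite {s. f s \<noteq> \<zero>\<^bsub>R\<^esub>}" "\<And>s. f s \<noteq> \<zero>\<^bsub>R\<^esub> \<Longrightarrow> s \<in> A" "\<And>s. f s \<in> carrier R"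
    using assms(2) R.zero_closed by (auto simp: free_module_def)
  \<comment> \<open>Finite sums in the free module are pointwise, since addition is.\<close>
  have ev: "(\<Oplus>\<^bsub>free_module R A\<^esub>s\<in>B. g s) t = (\<Oplus>\<^bsub>R\<^esub>s\<in>B. g s t)"
    if "finite B" "g \<in> B \<rightarrow> carrier (free_module R A)" for g B t
    using that
  proof (induction B rule: finite_induct)
    case (insert s B)
    then have "g s t \<in> carrier R" "(\<lambda>s. g s t) \<in> B \<rightarrow> carrier R"
      by (auto simp: free_module_def Pi_def) (metis R.zero_closed)+
    with insert show ?case
      by (simp add: Pi_def) (simp add: free_module_def)
  qed (simp, simp add: free_module_def)
  show ?thesis
  proof
    fix t
    have "free_lift R (free_module R A) (free_gen R) f t
        = (\<Oplus>\<^bsub>R\<^esub>s\<in>{s. f s \<noteq> \<zero>\<^bsub>R\<^esub>}. (f s \<odot>\<^bsub>free_module R A\<^esub> free_gen R s) t)"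
      unfolding free_lift_def using B by (intro ev) (auto intro!: free_gen_closed[OF assms(1)])
    also have "\<dots> = (\<Oplus>\<^bsub>R\<^esub>s\<in>{s. f s \<noteq> \<zero>\<^bsub>R\<^esub>}. if s = t then f s else \<zero>\<^bsub>R\<^esub>)"
      by (rule R.finsum_cong') (use B in \<open>auto simp: free_module_def free_gen_def\<close>)
    also have "\<dots> = f t"
    \<comment> \<open>If \<open>f t\<close> is zero, then \<open>t\<close> is not in the index set
      and every summand is zero; otherwise exactly the summand at \<open>t\<close> remains.\<close>
    proof (cases "f t = \<zero>\<^bsub>R\<^esub>")
      case True
      then have "(\<Oplus>\<^bsub>R\<^esub>s\<in>{s. f s \<noteq> \<zero>\<^bsub>R\<^esub>}. if s = t then f s else \<zero>\<^bsub>R\<^esub>)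
          = (\<Oplus>\<^bsub>R\<^esub>s\<in>{s. f s \<noteq> \<zero>\<^bsub>R\<^esub>}. \<zero>\<^bsub>R\<^esub>)"
        by (intro R.finsum_cong') auto
      then show ?thesis using True by simp
    qed (use B in \<open>auto intro!: R.add.finprod_singleton_swap\<close>)
    finally show "free_lift R (free_module R A) (free_gen R) f t = f t" .
  qed
qed

lemma quotient_eqI:
  assumes "module R F" "submodule H R F" "a \<in> carrier F" "b \<in> carrier F" "a \<ominus>\<^bsub>F\<^esub> b \<in> H"
  shows "H +>\<^bsub>F\<^esub> a = H +>\<^bsub>F\<^esub> b"
proof -
  interpret F: module R F by fact
  have "a = (a \<ominus>\<^bsub>F\<^esub> b) \<oplus>\<^bsub>F\<^esub> b"
    using assms by (simp add: a_minus_def F.M.a_assoc F.M.l_neg)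
  then have "a \<in> H +>\<^bsub>F\<^esub> b"
    using assms(5) unfolding a_r_coset_def' by blast
  then show ?thesis
    using assms F.a_repr_independence by (metis submodule_def)
qed

lemma free_module_support:
  assumes "f \<in> carrier (free_module R A)" "f s \<noteq> \<zero>\<^bsub>R\<^esub>"
  shows "f s \<in> carrier R" "s \<in> A"
  using assms by (auto simp: free_module_def)

section \<open>Tensor products\<close>

text \<open>\<open>tensor\<close> overwrites only the product and the unit of
  \<open>tensor_module\<close>, so facts about the module structure pass between the two records
  field by field.\<close>

lemma tensor_simps:
  "carrier (tensor R M N) = carrier (tensor_module R M N)"
  "\<zero>\<^bsub>tensor R M N\<^esub> = \<zero>\<^bsub>tensor_module R M N\<^esub>"
  "add (tensor R M N) = add (tensor_module R M N)"
  "smult (tensor R M N) = smult (tensor_module R M N)"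
  by (simp_all add: tensor_def)

lemma finsum_tensor: "finsum (tensor R M N) = finsum (tensor_module R M N)"
  by (simp add: finsum_def tensor_simps)

lemma tensor_lift_tensor: "tensor_lift R (tensor R M N) = tensor_lift R (tensor_module R M N)"
  by (simp add: tensor_lift_def fun_eq_iff finsum_tensor tensor_simps)

lemma tensor_lift_free_lift: "tensor_lift R P \<phi> t = free_lift R P (\<lambda>(a, b). \<phi> a b) (SOME f. f \<in> t)"
  by (simp add: tensor_lift_def free_lift_def Let_def case_prod_beta)

context
  fixes R :: "('k, 'r) ring_scheme" and M :: "('k, 'a, 'm) module_scheme"
    and N :: "('k, 'b, 'n) module_scheme"
  assumes M: "module R M" and N: "module R N"
begin

interpretation M: module R M by (rule M)
interpretation N: module R N by (rule N)

private abbreviation (input) "F \<equiv> free_module R (carrier M \<times> carrier N)"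

interpretation F: module R F by (rule module_free_module[OF M.R.is_cring])

lemma free_gen_pair_closed:
  "\<lbrakk>a \<in> carrier M; b \<in> carrier N\<rbrakk> \<Longrightarrow> free_gen R (a, b) \<in> carrier F"
  by (simp add: free_gen_closed M.R.is_cring)

lemma bilinear_relations_closed: "bilinear_relations R M N \<subseteq> carrier F"
proof -
  have eq: "x \<in> carrier F" if "x = y \<ominus>\<^bsub>F\<^esub> z" "y \<in> carrier F" "z \<in> carrier F" for x y z
    using that by (simp add: a_minus_def)
  show ?thesis
    unfolding bilinear_relations_def Let_def
    by (auto intro!: eq[OF refl] F.M.a_closed F.smult_closed free_gen_pair_closed)
qed

lemma submodule_tensor_null: "submodule (tensor_null R M N) R F"
  unfolding tensor_null_def by (rule submodule_generated[OF F.module_axioms bilinear_relations_closed])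

lemma module_tensor_module: "module R (tensor_module R M N)"
  unfolding tensor_module_def by (rule module_quotient[OF F.module_axioms submodule_tensor_null])

lemma module_tensor: "module R (tensor R M N)"
proof -
  interpret T: module R "tensor_module R M N" by (rule module_tensor_module)
  show ?thesis
  proof (rule moduleI)
    show "abelian_group (tensor R M N)"
      using T.abelian_group_axioms
      by (simp add: abelian_group_def abelian_monoid_def abelian_group_axioms_def tensor_simps)
  qed (simp_all add: tensor_simps M.R.is_cring T.smult_l_distr T.smult_r_distr T.smult_assoc1)
qed

lemma tensor_carrier: "carrier (tensor R M N) = (\<lambda>f. tensor_null R M N +>\<^bsub>F\<^esub> f) ` carrier F"
  unfolding tensor_simps tensor_module_def by (rule quotient_carrier[OF F.module_axioms submodule_tensor_null])

lemma tensor_proj_lin: "(\<lambda>f. tensor_null R M N +>\<^bsub>F\<^esub> f) \<in> lin_hom R F (tensor R M N)"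
  using quotient_map_lin[OF F.module_axioms submodule_tensor_null]
  by (simp add: lin_hom_def tensor_simps tensor_module_def)

text \<open>Each of the four laws corresponds to one family in \<open>bilinear_relations\<close>:
  the difference of its two sides lies in \<open>tensor_null\<close>, so the cosets agree.\<close>

lemma pure_tensor_bilin: "pure_tensor R M N \<in> bilin_hom R M N (tensor R M N)"
proof -
  note e = free_gen_pair_closed
  have null: "x \<in> tensor_null R M N" if "x \<in> bilinear_relations R M N" for x
    using that generated_submodule_incl unfolding tensor_null_def by (rule rev_subsetD)
  have closed: "pure_tensor R M N a b \<in> carrier (tensor R M N)"
    if "a \<in> carrier M" "b \<in> carrier N" for a b
    unfolding pure_tensor_def by (rule lin_hom_closed[OF tensor_proj_lin]) (use that e in simp)
  note eqI = quotient_eqI[OF F.module_axioms submodule_tensor_null]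
  note add = lin_hom_add[OF tensor_proj_lin, symmetric]
  note smult = lin_hom_smult[OF tensor_proj_lin, symmetric]
  show ?thesis
  proof (rule bilin_homI; rule lin_homI)
    fix a b b' assume ab: "a \<in> carrier M" "b \<in> carrier N" "b' \<in> carrier N"
    have "free_gen R (a, b \<oplus>\<^bsub>N\<^esub> b') \<ominus>\<^bsub>F\<^esub> (free_gen R (a, b) \<oplus>\<^bsub>F\<^esub> free_gen R (a, b'))
        \<in> bilinear_relations R M N"
      unfolding bilinear_relations_def Let_def using ab by blast
    from eqI[OF _ _ null[OF this]] ab
    show "pure_tensor R M N a (b \<oplus>\<^bsub>N\<^esub> b') = pure_tensor R M N a b \<oplus>\<^bsub>tensor R M N\<^esub> pure_tensor R M N a b'"
      by (simp add: pure_tensor_def add e)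
  next
    fix a r b assume ab: "a \<in> carrier M" "r \<in> carrier R" "b \<in> carrier N"
    have "free_gen R (a, r \<odot>\<^bsub>N\<^esub> b) \<ominus>\<^bsub>F\<^esub> (r \<odot>\<^bsub>F\<^esub> free_gen R (a, b)) \<in> bilinear_relations R M N"
      unfolding bilinear_relations_def Let_def using ab by blast
    from eqI[OF _ _ null[OF this]] ab
    show "pure_tensor R M N a (r \<odot>\<^bsub>N\<^esub> b) = r \<odot>\<^bsub>tensor R M N\<^esub> pure_tensor R M N a b"
      by (simp add: pure_tensor_def smult e)
  next
    fix a a' b assume ab: "b \<in> carrier N" "a \<in> carrier M" "a' \<in> carrier M"
    have "free_gen R (a \<oplus>\<^bsub>M\<^esub> a', b) \<ominus>\<^bsub>F\<^esub> (free_gen R (a, b) \<oplus>\<^bsub>F\<^esub> free_gen R (a', b))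
        \<in> bilinear_relations R M N"
      unfolding bilinear_relations_def Let_def using ab by blast
    from eqI[OF _ _ null[OF this]] ab
    show "pure_tensor R M N (a \<oplus>\<^bsub>M\<^esub> a') b = pure_tensor R M N a b \<oplus>\<^bsub>tensor R M N\<^esub> pure_tensor R M N a' b"
      by (simp add: pure_tensor_def add e)
  next
    fix b r a assume ab: "b \<in> carrier N" "r \<in> carrier R" "a \<in> carrier M"
    have "free_gen R (r \<odot>\<^bsub>M\<^esub> a, b) \<ominus>\<^bsub>F\<^esub> (r \<odot>\<^bsub>F\<^esub> free_gen R (a, b)) \<in> bilinear_relations R M N"
      unfolding bilinear_relations_def Let_def using ab by blast
    from eqI[OF _ _ null[OF this]] ab
    show "pure_tensor R M N (r \<odot>\<^bsub>M\<^esub> a) b = r \<odot>\<^bsub>tensor R M N\<^esub> pure_tensor R M N a b"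
      by (simp add: pure_tensor_def smult e)
  qed (simp_all add: closed)
qed

lemma pure_tensor_closed:
  "\<lbrakk>a \<in> carrier M; b \<in> carrier N\<rbrakk> \<Longrightarrow> pure_tensor R M N a b \<in> carrier (tensor R M N)"
  by (rule bilin_hom_closed[OF pure_tensor_bilin])

text \<open>A coset contains the element it is formed from, so the choice is from a nonempty set,
  and any member of a coset represents it.\<close>

lemma tensor_rep:
  assumes "t \<in> carrier (tensor R M N)"
  shows "(SOME f. f \<in> t) \<in> carrier F" "t = tensor_null R M N +>\<^bsub>F\<^esub> (SOME f. f \<in> t)"
proof -
  let ?f = "SOME f. f \<in> t"
  obtain g where g: "g \<in> carrier F" "t = tensor_null R M N +>\<^bsub>F\<^esub> g"
    using assms by (auto simp: tensor_carrier)
  have sub: "subgroup (tensor_null R M N) (add_monoid F)"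
    using submodule_tensor_null by (simp add: submodule_def)
  have "g \<in> t"
    using g F.add.rcos_self[OF g(1) sub] by (simp add: a_r_coset_def)
  then have f: "?f \<in> t" by (rule someI[of "\<lambda>f. f \<in> t"])
  have "t \<subseteq> carrier F"
    unfolding g(2) using F.a_r_coset_subset_G[of "tensor_null R M N" g] subgroup.subset[OF sub] g(1)
    by simp
  with f show "?f \<in> carrier F" by (rule rev_subsetD)
  show "t = tensor_null R M N +>\<^bsub>F\<^esub> ?f"
    using F.a_repr_independence[OF f[unfolded g(2)] g(1) sub] by (simp only: g(2))
qed

context
  fixes P :: "('k, 'c, 'p) module_scheme"
  assumes P: "module R P"
begin

interpretation P: module R P by (rule P)

text \<open>Bilinearity makes the free lift vanish on the generating relations, hence on
  \<open>tensor_null\<close>, which is contained in the kernel. The chosen representative differs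
  from \<open>f\<close> by an element of \<open>tensor_null\<close> only.\<close>

lemma tensor_lift_coset:
  assumes \<phi>: "\<phi> \<in> bilin_hom R M N P" and f: "f \<in> carrier F"
  shows "tensor_lift R P \<phi> (tensor_null R M N +>\<^bsub>F\<^esub> f) = free_lift R P (\<lambda>(a, b). \<phi> a b) f"
proof -
  let ?L = "free_lift R P (\<lambda>(a, b). \<phi> a b)"
  have L: "?L \<in> lin_hom R F P"
    using bilin_hom_closed[OF \<phi>] by (intro free_lift_lin[OF P]) auto
  have gen: "?L (free_gen R (a, b)) = \<phi> a b" if "a \<in> carrier M" "b \<in> carrier N" for a b
    using bilin_hom_closed[OF \<phi>] that
    by (subst free_lift_gen[OF P, of _ "carrier M \<times> carrier N"]) auto
  note lin = lin_hom_minus[OF F.module_axioms P L] lin_hom_add[OF L] lin_hom_smult[OF L]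
  note \<phi>lin = lin_hom_add[OF bilin_hom_left[OF \<phi>]] lin_hom_add[OF bilin_hom_right[OF \<phi>]]
    lin_hom_smult[OF bilin_hom_left[OF \<phi>]] lin_hom_smult[OF bilin_hom_right[OF \<phi>]]
  have sub: "submodule {x \<in> carrier F. ?L x = \<zero>\<^bsub>P\<^esub>} R F"
    by (rule submodule_kernel[OF F.module_axioms P L])
  have ker: "x \<in> {x \<in> carrier F. ?L x = \<zero>\<^bsub>P\<^esub>}" if x: "x \<in> bilinear_relations R M N" for x
  proof
    have "?L x = \<zero>\<^bsub>P\<^esub>"
      using x unfolding bilinear_relations_def Let_def
      by (elim UnE CollectE exE conjE)
        (simp_all add: lin gen \<phi>lin free_gen_pair_closed bilin_hom_closed[OF \<phi>] P.M.r_neg a_minus_def[of P])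
    then show "x \<in> carrier F \<and> ?L x = \<zero>\<^bsub>P\<^esub>" using x bilinear_relations_closed by auto
  qed
  have null: "?L x = \<zero>\<^bsub>P\<^esub>" "x \<in> carrier F" if "x \<in> tensor_null R M N" for x
    using generated_submodule_least[OF sub, of "bilinear_relations R M N"] ker that
    unfolding tensor_null_def by blast+
  have t: "tensor_null R M N +>\<^bsub>F\<^esub> f \<in> carrier (tensor R M N)"
    using f by (simp add: tensor_carrier)
  let ?g = "SOME g. g \<in> tensor_null R M N +>\<^bsub>F\<^esub> f"
  note g = tensor_rep[OF t]
  have "?g \<in> tensor_null R M N +>\<^bsub>F\<^esub> ?g"
    using F.add.rcos_self[OF g(1)] submodule_tensor_null by (simp add: a_r_coset_def submodule_def)
  then have "?g \<in> tensor_null R M N +>\<^bsub>F\<^esub> f"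
    by (simp only: g(2)[symmetric])
  then obtain n where n: "n \<in> tensor_null R M N" "?g = n \<oplus>\<^bsub>F\<^esub> f"
    unfolding a_r_coset_def' by blast
  have "?L ?g = ?L f"
    using null[OF n(1)] f lin_hom_closed[OF L f] by (simp add: n(2) lin)
  then show ?thesis by (simp add: tensor_lift_free_lift)
qed

lemma tensor_lift_lin:
  assumes \<phi>: "\<phi> \<in> bilin_hom R M N P"
  shows "tensor_lift R P \<phi> \<in> lin_hom R (tensor R M N) P"
proof -
  have L: "free_lift R P (\<lambda>(a, b). \<phi> a b) \<in> lin_hom R F P"
    using bilin_hom_closed[OF \<phi>] by (intro free_lift_lin[OF P]) auto
  show ?thesis
    by (rule lin_homI)
      (auto simp: tensor_carrier tensor_lift_coset[OF \<phi>] lin_hom_closed[OF L]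
        lin_hom_add[OF tensor_proj_lin, symmetric] lin_hom_add[OF L]
        lin_hom_smult[OF tensor_proj_lin, symmetric] lin_hom_smult[OF L])
qed

lemma tensor_lift_pure:
  assumes \<phi>: "\<phi> \<in> bilin_hom R M N P" and "a \<in> carrier M" "b \<in> carrier N"
  shows "tensor_lift R P \<phi> (pure_tensor R M N a b) = \<phi> a b"
  unfolding pure_tensor_def using assms bilin_hom_closed[OF \<phi>]
  by (subst tensor_lift_coset[OF \<phi>])
    (auto simp: free_gen_pair_closed Pi_iff free_lift_gen[OF P, of _ "carrier M \<times> carrier N"])

text \<open>The support of a representative lies in \<open>carrier M \<times> carrier N\<close>, so
  only values there enter the sum. This is the rule for rewriting under a Sweedler sum.\<close>

lemma tensor_lift_cong:
  assumes "t \<in> carrier (tensor R M N)" "\<phi> \<in> bilin_hom R M N P"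
    "\<And>a b. \<lbrakk>a \<in> carrier M; b \<in> carrier N\<rbrakk> \<Longrightarrow> \<psi> a b = \<phi> a b"
  shows "tensor_lift R P \<psi> t = tensor_lift R P \<phi> t"
proof -
  note B = free_module_support[OF tensor_rep(1)[OF assms(1)]]
  show ?thesis
    unfolding tensor_lift_free_lift free_lift_def
    by (rule P.M.finsum_cong') (use B bilin_hom_closed[OF assms(2)] assms(3) in fastforce)+
qed

text \<open>Both lifts use the same chosen representative of \<open>t\<close>, so \<open>h\<close>
  only has to pass through one sum. It is used to pull inclusions, counits, antipodes and
  multiplications out of Sweedler sums.\<close>

lemma lin_hom_tensor_lift:
  assumes "module R Q" "h \<in> lin_hom R P Q" "t \<in> carrier (tensor R M N)"
    "\<And>a b. \<lbrakk>a \<in> carrier M; b \<in> carrier N\<rbrakk> \<Longrightarrow> \<phi> a b \<in> carrier P"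
  shows "h (tensor_lift R P \<phi> t) = tensor_lift R Q (\<lambda>a b. h (\<phi> a b)) t"
proof -
  interpret Q: module R Q by fact
  define f where "f = (SOME f. f \<in> t)"
  note B = free_module_support[OF tensor_rep(1)[OF assms(3), folded f_def]]
  have cl: "\<phi> (fst s) (snd s) \<in> carrier P" if "f s \<noteq> \<zero>\<^bsub>R\<^esub>" for s
    using B(2)[OF that] assms(4) by auto
  have "h (tensor_lift R P \<phi> t) = (\<Oplus>\<^bsub>Q\<^esub>s\<in>{s. f s \<noteq> \<zero>\<^bsub>R\<^esub>}. h (f s \<odot>\<^bsub>P\<^esub> \<phi> (fst s) (snd s)))"
    unfolding tensor_lift_def Let_def f_def[symmetric]
    using B cl by (intro lin_hom_finsum[OF P assms(1,2)]) auto
  also have "\<dots> = (\<Oplus>\<^bsub>Q\<^esub>s\<in>{s. f s \<noteq> \<zero>\<^bsub>R\<^esub>}. f s \<odot>\<^bsub>Q\<^esub> h (\<phi> (fst s) (snd s)))"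
    by (rule Q.M.finsum_cong')
      (use B cl lin_hom_closed[OF assms(2)] in \<open>auto simp: lin_hom_smult[OF assms(2)]\<close>)
  finally show ?thesis
    unfolding tensor_lift_def Let_def f_def[symmetric] .
qed

end

text \<open>Expresses that pure tensors span: projecting the expansion of the representative in
  generators writes \<open>t\<close> as a combination of pure tensors.\<close>

lemma tensor_lift_pure_tensor:
  assumes t: "t \<in> carrier (tensor R M N)"
  shows "tensor_lift R (tensor R M N) (pure_tensor R M N) t = t"
proof -
  define f where "f = (SOME f. f \<in> t)"
  note f = tensor_rep(1)[OF assms, folded f_def] and t = tensor_rep(2)[OF assms, folded f_def]
  interpret T: module R "tensor R M N" by (rule module_tensor)
  have B: "f s \<in> carrier R" "s \<in> carrier M \<times> carrier N" "free_gen R s \<in> carrier F" if "f s \<noteq> \<zero>\<^bsub>R\<^esub>" for s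
    using free_module_support[OF f that] by (auto intro!: free_gen_closed[OF M.R.is_cring])
  have "t = tensor_null R M N +>\<^bsub>F\<^esub> free_lift R F (free_gen R) f"
    using t by (simp add: free_lift_free_gen[OF M.R.is_cring f])
  also have "\<dots> = (\<Oplus>\<^bsub>tensor R M N\<^esub>s\<in>{s. f s \<noteq> \<zero>\<^bsub>R\<^esub>}. tensor_null R M N +>\<^bsub>F\<^esub> (f s \<odot>\<^bsub>F\<^esub> free_gen R s))"
    unfolding free_lift_def
    using B by (intro lin_hom_finsum[OF F.module_axioms module_tensor tensor_proj_lin]) auto
  also have "\<dots> = (\<Oplus>\<^bsub>tensor R M N\<^esub>s\<in>{s. f s \<noteq> \<zero>\<^bsub>R\<^esub>}. f s \<odot>\<^bsub>tensor R M N\<^esub> (\<lambda>(a, b). pure_tensor R M N a b) s)"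
  proof (rule T.M.finsum_cong', simp)
    show "(\<lambda>s. f s \<odot>\<^bsub>tensor R M N\<^esub> (\<lambda>(a, b). pure_tensor R M N a b) s)
        \<in> {s. f s \<noteq> \<zero>\<^bsub>R\<^esub>} \<rightarrow> carrier (tensor R M N)"
      using B(1,2) by (intro Pi_I T.smult_closed) (auto simp: pure_tensor_closed)
    fix s assume "s \<in> {s. f s \<noteq> \<zero>\<^bsub>R\<^esub>}"
    then show "tensor_null R M N +>\<^bsub>F\<^esub> (f s \<odot>\<^bsub>F\<^esub> free_gen R s)
        = f s \<odot>\<^bsub>tensor R M N\<^esub> (\<lambda>(a, b). pure_tensor R M N a b) s"
      using B[of s] by (auto simp: pure_tensor_def lin_hom_smult[OF tensor_proj_lin])
  qed
  finally show ?thesis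
    by (simp add: tensor_lift_free_lift free_lift_def f_def)
qed

text \<open>The uniqueness half of the universal property: since \<open>t\<close> is a combination
  of pure tensors, a linear map is the lift of its own values on them.\<close>

lemma lin_hom_tensor_eqI:
  assumes P: "module R P" and f: "f \<in> lin_hom R (tensor R M N) P" and g: "g \<in> lin_hom R (tensor R M N) P"
    and eq: "\<And>a b. \<lbrakk>a \<in> carrier M; b \<in> carrier N\<rbrakk>
      \<Longrightarrow> f (pure_tensor R M N a b) = g (pure_tensor R M N a b)"
    and t: "t \<in> carrier (tensor R M N)"
  shows "f t = g t"
proof -
  have lift: "h t = tensor_lift R P (\<lambda>a b. h (pure_tensor R M N a b)) t"
    if "h \<in> lin_hom R (tensor R M N) P" for h
    using lin_hom_tensor_lift[OF module_tensor P that t, of "pure_tensor R M N"] pure_tensor_closed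
    by (simp add: tensor_lift_pure_tensor[OF t])
  show ?thesis
    unfolding lift[OF f] lift[OF g]
    by (rule tensor_lift_cong[OF P t bilin_hom_comp[OF pure_tensor_bilin g] eq])
qed

end

text \<open>For iterated comultiplications, where the sum over the inner middle object has to leave
  the lift over the outer one.\<close>

lemma tensor_lift_sum:
  assumes M: "module R M" and N: "module R N" and P: "module R P"
    and \<phi>: "\<And>i. i \<in> A \<Longrightarrow> \<phi> i \<in> bilin_hom R M N P" and t: "t \<in> carrier (tensor R M N)"
  shows "tensor_lift R P (\<lambda>a b. \<Oplus>\<^bsub>P\<^esub>i\<in>A. \<phi> i a b) t = (\<Oplus>\<^bsub>P\<^esub>i\<in>A. tensor_lift R P (\<phi> i) t)"
proof (rule lin_hom_tensor_eqI[OF M N P _ _ _ t])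
  interpret P: module R P by (rule P)
  show sum: "tensor_lift R P (\<lambda>a b. \<Oplus>\<^bsub>P\<^esub>i\<in>A. \<phi> i a b) \<in> lin_hom R (tensor R M N) P"
    by (rule tensor_lift_lin[OF M N P bilin_hom_sum[OF M N P \<phi>]])
  show "(\<lambda>t. \<Oplus>\<^bsub>P\<^esub>i\<in>A. tensor_lift R P (\<phi> i) t) \<in> lin_hom R (tensor R M N) P"
    by (rule lin_hom_sum[OF module_tensor[OF M N] P]) (rule tensor_lift_lin[OF M N P \<phi>])
  fix a b assume ab: "a \<in> carrier M" "b \<in> carrier N"
  have "(\<Oplus>\<^bsub>P\<^esub>i\<in>A. tensor_lift R P (\<phi> i) (pure_tensor R M N a b)) = (\<Oplus>\<^bsub>P\<^esub>i\<in>A. \<phi> i a b)"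
    by (rule P.M.finsum_cong')
      (use ab in \<open>auto intro: bilin_hom_closed[OF \<phi>] tensor_lift_pure[OF M N P \<phi>]\<close>)
  then show "tensor_lift R P (\<lambda>a b. \<Oplus>\<^bsub>P\<^esub>i\<in>A. \<phi> i a b) (pure_tensor R M N a b)
      = (\<Oplus>\<^bsub>P\<^esub>i\<in>A. tensor_lift R P (\<phi> i) (pure_tensor R M N a b))"
    using ab by (simp add: tensor_lift_pure[OF M N P bilin_hom_sum[OF M N P \<phi>]])
qed

text \<open>Discards summands whose indices do not match. The map is exchanged for the constant zero
  map, which is bilinear and so can be lifted.\<close>

lemma tensor_lift_eq_zero:
  assumes M: "module R M" and N: "module R N" and P: "module R P"
    and t: "t \<in> carrier (tensor R M N)"
    and "\<And>a b. \<lbrakk>a \<in> carrier M; b \<in> carrier N\<rbrakk> \<Longrightarrow> \<phi> a b = \<zero>\<^bsub>P\<^esub>"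
  shows "tensor_lift R P \<phi> t = \<zero>\<^bsub>P\<^esub>"
proof -
  note z = bilin_hom_const_zero[OF P, of M N]
  have "tensor_lift R P \<phi> t = tensor_lift R P (\<lambda>_ _. \<zero>\<^bsub>P\<^esub>) t"
    by (rule tensor_lift_cong[OF M N P t z assms(5)])
  also have "\<dots> = \<zero>\<^bsub>P\<^esub>"
    by (rule lin_hom_tensor_eqI[OF M N P _ _ _ t, where g = "\<lambda>_. \<zero>\<^bsub>P\<^esub>"])
      (simp_all add: tensor_lift_lin[OF M N P z] lin_hom_const_zero[OF P] tensor_lift_pure[OF M N P z])
  finally show ?thesis .
qed

text \<open>Nested lifts, as in the product of a tensor algebra or in \<open>tensor_assoc\<close>,
  require the inner lift to be linear in the outer variable. For fixed parameters both sides are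
  linear in \<open>t\<close>, so pure tensors decide.\<close>

lemma tensor_lift_param_lin:
  assumes L: "module R L" and M: "module R M" and N: "module R N" and P: "module R P"
    and \<phi>: "\<And>l. l \<in> carrier L \<Longrightarrow> \<phi> l \<in> bilin_hom R M N P"
    and lin: "\<And>a b. \<lbrakk>a \<in> carrier M; b \<in> carrier N\<rbrakk> \<Longrightarrow> (\<lambda>l. \<phi> l a b) \<in> lin_hom R L P"
    and t: "t \<in> carrier (tensor R M N)"
  shows "(\<lambda>l. tensor_lift R P (\<phi> l) t) \<in> lin_hom R L P"
proof -
  interpret L: module R L by (rule L)
  interpret P: module R P by (rule P)
  note lift = tensor_lift_lin[OF M N P \<phi>]
  note closed = bilin_hom_closed[OF \<phi>]
  show ?thesis
  proof (rule lin_homI)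
    fix l assume l: "l \<in> carrier L"
    show "tensor_lift R P (\<phi> l) t \<in> carrier P"
      using lin_hom_closed[OF lift[OF l], OF t] .
  next
    fix l l' assume l: "l \<in> carrier L" "l' \<in> carrier L"
    have ll: "l \<oplus>\<^bsub>L\<^esub> l' \<in> carrier L" using l by simp
    have lin2: "(\<lambda>t. tensor_lift R P (\<phi> l) t \<oplus>\<^bsub>P\<^esub> tensor_lift R P (\<phi> l') t) \<in> lin_hom R (tensor R M N) P"
      by (rule lin_homI)
        (use l in \<open>simp_all add: lin_hom_closed[OF lift] lin_hom_add[OF lift]
          lin_hom_smult[OF lift] P.smult_r_distr P.M.a_ac\<close>)
    show "tensor_lift R P (\<phi> (l \<oplus>\<^bsub>L\<^esub> l')) t = tensor_lift R P (\<phi> l) t \<oplus>\<^bsub>P\<^esub> tensor_lift R P (\<phi> l') t"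
      by (rule lin_hom_tensor_eqI[OF M N P lift[OF ll] lin2 _ t])
        (use l in \<open>simp add: tensor_lift_pure[OF M N P \<phi>] lin_hom_add[OF lin]\<close>)
  next
    fix r l assume l: "r \<in> carrier R" "l \<in> carrier L"
    have rl: "r \<odot>\<^bsub>L\<^esub> l \<in> carrier L" using l by simp
    show "tensor_lift R P (\<phi> (r \<odot>\<^bsub>L\<^esub> l)) t = r \<odot>\<^bsub>P\<^esub> tensor_lift R P (\<phi> l) t"
      by (rule lin_hom_tensor_eqI[OF M N P lift[OF rl] lin_hom_smult_map[OF P lift[OF l(2)] l(1)] _ t])
        (use l in \<open>simp add: tensor_lift_pure[OF M N P \<phi>] lin_hom_smult[OF lin]\<close>)
  qed
qed

lemma tensor_lift_param_bilin:
  assumes L: "module R L" and M: "module R M" and N: "module R N" and P: "module R P"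
    and \<phi>: "\<And>l. l \<in> carrier L \<Longrightarrow> \<phi> l \<in> bilin_hom R M N P"
    and lin: "\<And>a b. \<lbrakk>a \<in> carrier M; b \<in> carrier N\<rbrakk> \<Longrightarrow> (\<lambda>l. \<phi> l a b) \<in> lin_hom R L P"
  shows "(\<lambda>l. tensor_lift R P (\<phi> l)) \<in> bilin_hom R L (tensor R M N) P"
  by (rule bilin_homI)
    (simp_all add: tensor_lift_lin[OF M N P \<phi>] tensor_lift_param_lin[OF L M N P \<phi> lin])

text \<open>Two applications of \<open>lin_hom_tensor_eqI\<close>, the inner one with the first
  factor frozen. The bracketing is that of the source of the associator.\<close>

lemma lin_hom_tensor_eqI2:
  assumes L: "module R L" and M: "module R M" and N: "module R N" and P: "module R P"
    and f: "f \<in> lin_hom R (tensor R L (tensor R M N)) P"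
    and g: "g \<in> lin_hom R (tensor R L (tensor R M N)) P"
    and eq: "\<And>a b c. \<lbrakk>a \<in> carrier L; b \<in> carrier M; c \<in> carrier N\<rbrakk>
      \<Longrightarrow> f (pure_tensor R L (tensor R M N) a (pure_tensor R M N b c))
        = g (pure_tensor R L (tensor R M N) a (pure_tensor R M N b c))"
    and t: "t \<in> carrier (tensor R L (tensor R M N))"
  shows "f t = g t"
proof (rule lin_hom_tensor_eqI[OF L module_tensor[OF M N] P f g _ t])
  fix a s assume a: "a \<in> carrier L" and s: "s \<in> carrier (tensor R M N)"
  note pure = bilin_hom_right[OF pure_tensor_bilin[OF L module_tensor[OF M N]] a]
  show "f (pure_tensor R L (tensor R M N) a s) = g (pure_tensor R L (tensor R M N) a s)"
    by (rule lin_hom_tensor_eqI[OF M N P lin_hom_comp[OF pure f] lin_hom_comp[OF pure g]])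
      (use a s eq in simp_all)
qed

context
  fixes R :: "('k, 'r) ring_scheme"
    and M :: "('k, 'a, 'm) module_scheme" and N :: "('k, 'b, 'n) module_scheme"
    and M' :: "('k, 'c, 'p) module_scheme" and N' :: "('k, 'd, 'q) module_scheme"
  assumes M: "module R M" and N: "module R N" and M': "module R M'" and N': "module R N'"
begin

context
  fixes f g
  assumes f: "f \<in> lin_hom R M M'" and g: "g \<in> lin_hom R N N'"
begin

lemma tensor_map_bilin:
  "(\<lambda>a b. pure_tensor R M' N' (f a) (g b)) \<in> bilin_hom R M N (tensor R M' N')"
  by (rule bilin_hom_comp2[OF pure_tensor_bilin[OF M' N'] f g])

lemma tensor_map_lin: "tensor_map R M' N' f g \<in> lin_hom R (tensor R M N) (tensor R M' N')"
  unfolding tensor_map_def by (rule tensor_lift_lin[OF M N module_tensor[OF M' N'] tensor_map_bilin])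

lemma tensor_map_closed:
  "t \<in> carrier (tensor R M N) \<Longrightarrow> tensor_map R M' N' f g t \<in> carrier (tensor R M' N')"
  by (rule lin_hom_closed[OF tensor_map_lin])

lemma tensor_map_pure:
  "\<lbrakk>a \<in> carrier M; b \<in> carrier N\<rbrakk>
    \<Longrightarrow> tensor_map R M' N' f g (pure_tensor R M N a b) = pure_tensor R M' N' (f a) (g b)"
  unfolding tensor_map_def by (rule tensor_lift_pure[OF M N module_tensor[OF M' N'] tensor_map_bilin])

text \<open>Substitution in Sweedler notation: both sides are linear in \<open>t\<close> and agree
  on pure tensors.\<close>

lemma tensor_lift_map:
  assumes P: "module R P" and \<phi>: "\<phi> \<in> bilin_hom R M' N' P" and t: "t \<in> carrier (tensor R M N)"
  shows "tensor_lift R P \<phi> (tensor_map R M' N' f g t) = tensor_lift R P (\<lambda>a b. \<phi> (f a) (g b)) t"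
  by (rule lin_hom_tensor_eqI[OF M N P lin_hom_comp[OF tensor_map_lin tensor_lift_lin[OF M' N' P \<phi>]]
        tensor_lift_lin[OF M N P bilin_hom_comp2[OF \<phi> f g]] _ t])
    (simp add: tensor_map_pure tensor_lift_pure[OF M N P bilin_hom_comp2[OF \<phi> f g]]
      tensor_lift_pure[OF M' N' P \<phi>] lin_hom_closed[OF f] lin_hom_closed[OF g])

end

end

lemma tensor_assoc_bilin:
  assumes M: "module R M" and N: "module R N" and P: "module R P"
  shows "(\<lambda>a. tensor_lift R (tensor R (tensor R M N) P)
      (\<lambda>b c. pure_tensor R (tensor R M N) P (pure_tensor R M N a b) c))
    \<in> bilin_hom R M (tensor R N P) (tensor R (tensor R M N) P)"
    and "a \<in> carrier M \<Longrightarrow> (\<lambda>b c. pure_tensor R (tensor R M N) P (pure_tensor R M N a b) c)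
    \<in> bilin_hom R N P (tensor R (tensor R M N) P)"
proof -
  note MN = module_tensor[OF M N]
  note T = module_tensor[OF MN P]
  show *: "(\<lambda>b c. pure_tensor R (tensor R M N) P (pure_tensor R M N a b) c)
    \<in> bilin_hom R N P (tensor R (tensor R M N) P)" if "a \<in> carrier M" for a
    by (rule bilin_hom_comp2[OF pure_tensor_bilin[OF MN P]
          bilin_hom_right[OF pure_tensor_bilin[OF M N] that] lin_hom_id])
  show "(\<lambda>a. tensor_lift R (tensor R (tensor R M N) P)
      (\<lambda>b c. pure_tensor R (tensor R M N) P (pure_tensor R M N a b) c))
    \<in> bilin_hom R M (tensor R N P) (tensor R (tensor R M N) P)"
  proof (rule tensor_lift_param_bilin[OF M N P T *])
    fix b c assume b: "b \<in> carrier N" and c: "c \<in> carrier P"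
    show "(\<lambda>a. pure_tensor R (tensor R M N) P (pure_tensor R M N a b) c)
        \<in> lin_hom R M (tensor R (tensor R M N) P)"
      by (rule lin_hom_comp[OF bilin_hom_left[OF pure_tensor_bilin[OF M N] b]
            bilin_hom_left[OF pure_tensor_bilin[OF MN P] c]])
  qed
qed

lemma tensor_assoc_lin:
  assumes M: "module R M" and N: "module R N" and P: "module R P"
  shows "tensor_assoc R M N P \<in> lin_hom R (tensor R M (tensor R N P)) (tensor R (tensor R M N) P)"
  unfolding tensor_assoc_def
  by (rule tensor_lift_lin[OF M module_tensor[OF N P] module_tensor[OF module_tensor[OF M N] P]
        tensor_assoc_bilin(1)[OF M N P]])

lemma tensor_assoc_pure:
  assumes M: "module R M" and N: "module R N" and P: "module R P"
    and "a \<in> carrier M" "b \<in> carrier N" "c \<in> carrier P"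
  shows "tensor_assoc R M N P (pure_tensor R M (tensor R N P) a (pure_tensor R N P b c))
    = pure_tensor R (tensor R M N) P (pure_tensor R M N a b) c"
  unfolding tensor_assoc_def using assms(4-6)
  by (simp add: tensor_lift_pure[OF M module_tensor[OF N P] module_tensor[OF module_tensor[OF M N] P]
        tensor_assoc_bilin(1)[OF M N P]] pure_tensor_closed[OF N P]
      tensor_lift_pure[OF N P module_tensor[OF module_tensor[OF M N] P] tensor_assoc_bilin(2)[OF M N P]])

text \<open>On pure tensors both sides give the images of \<open>a\<close>, \<open>b\<close>,
  \<open>c\<close> bracketed to the left. With inclusions of summands for \<open>f\<close>,
  \<open>g\<close>, \<open>h\<close> this transports coassociativity from \<open>C\<close> to the
  total algebra.\<close>

lemma tensor_assoc_natural:
  assumes M: "module R M" and N: "module R N" and P: "module R P"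
    and M': "module R M'" and N': "module R N'" and P': "module R P'"
    and f: "f \<in> lin_hom R M M'" and g: "g \<in> lin_hom R N N'" and h: "h \<in> lin_hom R P P'"
    and t: "t \<in> carrier (tensor R M (tensor R N P))"
  shows "tensor_assoc R M' N' P' (tensor_map R M' (tensor R N' P') f (tensor_map R N' P' g h) t)
    = tensor_map R (tensor R M' N') P' (tensor_map R M' N' f g) h (tensor_assoc R M N P t)"
proof -
  note mods = module_tensor[OF M N] module_tensor[OF N P] module_tensor[OF M' N'] module_tensor[OF N' P']
  note fg = tensor_map_lin[OF M N M' N' f g] and gh = tensor_map_lin[OF N P N' P' g h]
  note closed = lin_hom_closed[OF f] lin_hom_closed[OF g] lin_hom_closed[OF h]
    pure_tensor_closed[OF M N] pure_tensor_closed[OF N P]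
  show ?thesis
    by (rule lin_hom_tensor_eqI2[OF M N P module_tensor[OF mods(3) P']
          lin_hom_comp[OF tensor_map_lin[OF M mods(2) M' mods(4) f gh] tensor_assoc_lin[OF M' N' P']]
          lin_hom_comp[OF tensor_assoc_lin[OF M N P] tensor_map_lin[OF mods(1) P mods(3) P' fg h]] _ t])
      (simp add: closed tensor_map_pure[OF M mods(2) M' mods(4) f gh] tensor_map_pure[OF N P N' P' g h]
        tensor_map_pure[OF mods(1) P mods(3) P' fg h] tensor_map_pure[OF M N M' N' f g]
        tensor_assoc_pure[OF M N P] tensor_assoc_pure[OF M' N' P'])
qed

lemma tensor_mult:
  "t \<otimes>\<^bsub>tensor R A B\<^esub> t' = tensor_lift R (tensor R A B)
      (\<lambda>a b. tensor_lift R (tensor R A B)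
        (\<lambda>a' b'. pure_tensor R A B (a \<otimes>\<^bsub>A\<^esub> a') (b \<otimes>\<^bsub>B\<^esub> b')) t') t"
  unfolding tensor_lift_tensor by (simp add: tensor_def)

context
  fixes R :: "('k, 'r) ring_scheme"
    and A :: "('k, 'a, 'm) module_scheme" and B :: "('k, 'b, 'n) module_scheme"
  assumes A: "module R A" and B: "module R B"
    and mult_A: "mult A \<in> bilin_hom R A A A" and mult_B: "mult B \<in> bilin_hom R B B B"
begin

lemma tensor_mult_right_bilin:
  assumes "a \<in> carrier A" "b \<in> carrier B"
  shows "(\<lambda>a' b'. pure_tensor R A B (a \<otimes>\<^bsub>A\<^esub> a') (b \<otimes>\<^bsub>B\<^esub> b')) \<in> bilin_hom R A B (tensor R A B)"
  by (rule bilin_hom_comp2[OF pure_tensor_bilin[OF A B]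
        bilin_hom_right[OF mult_A assms(1)] bilin_hom_right[OF mult_B assms(2)]])

lemma tensor_mult_left_bilin:
  assumes t: "t \<in> carrier (tensor R A B)"
  shows "(\<lambda>a b. tensor_lift R (tensor R A B)
      (\<lambda>a' b'. pure_tensor R A B (a \<otimes>\<^bsub>A\<^esub> a') (b \<otimes>\<^bsub>B\<^esub> b')) t) \<in> bilin_hom R A B (tensor R A B)"
proof (rule bilin_homI)
  fix a assume a: "a \<in> carrier A"
  show "(\<lambda>b. tensor_lift R (tensor R A B)
      (\<lambda>a' b'. pure_tensor R A B (a \<otimes>\<^bsub>A\<^esub> a') (b \<otimes>\<^bsub>B\<^esub> b')) t) \<in> lin_hom R B (tensor R A B)"
  proof (rule tensor_lift_param_lin[OF B A B module_tensor[OF A B] tensor_mult_right_bilin[OF a] _ t])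
    fix a' b' assume a': "a' \<in> carrier A" and b': "b' \<in> carrier B"
    have aa': "a \<otimes>\<^bsub>A\<^esub> a' \<in> carrier A" by (rule bilin_hom_closed[OF mult_A a a'])
    show "(\<lambda>b. pure_tensor R A B (a \<otimes>\<^bsub>A\<^esub> a') (b \<otimes>\<^bsub>B\<^esub> b')) \<in> lin_hom R B (tensor R A B)"
      by (rule lin_hom_comp[OF bilin_hom_left[OF mult_B b'] bilin_hom_right[OF pure_tensor_bilin[OF A B] aa']])
  qed
next
  fix b assume b: "b \<in> carrier B"
  show "(\<lambda>a. tensor_lift R (tensor R A B)
      (\<lambda>a' b'. pure_tensor R A B (a \<otimes>\<^bsub>A\<^esub> a') (b \<otimes>\<^bsub>B\<^esub> b')) t) \<in> lin_hom R A (tensor R A B)"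
  proof (rule tensor_lift_param_lin[OF A A B module_tensor[OF A B] tensor_mult_right_bilin[OF _ b] _ t])
    fix a' b' assume a': "a' \<in> carrier A" and b': "b' \<in> carrier B"
    have bb': "b \<otimes>\<^bsub>B\<^esub> b' \<in> carrier B" by (rule bilin_hom_closed[OF mult_B b b'])
    show "(\<lambda>a. pure_tensor R A B (a \<otimes>\<^bsub>A\<^esub> a') (b \<otimes>\<^bsub>B\<^esub> b')) \<in> lin_hom R A (tensor R A B)"
      by (rule lin_hom_comp[OF bilin_hom_left[OF mult_A a'] bilin_hom_left[OF pure_tensor_bilin[OF A B] bb']])
  qed
qed

text \<open>Hypotheses and conclusion have the same form, bilinearity of the product, so the lemma
  can be iterated to threefold tensor products without first making the twofold one an
  algebra.\<close>

lemma tensor_mult_bilin: "mult (tensor R A B) \<in> bilin_hom R (tensor R A B) (tensor R A B) (tensor R A B)"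
proof (rule bilin_homI; unfold tensor_mult)
  fix t assume t: "t \<in> carrier (tensor R A B)"
  show "(\<lambda>t'. tensor_lift R (tensor R A B) (\<lambda>a b. tensor_lift R (tensor R A B)
        (\<lambda>a' b'. pure_tensor R A B (a \<otimes>\<^bsub>A\<^esub> a') (b \<otimes>\<^bsub>B\<^esub> b')) t') t)
      \<in> lin_hom R (tensor R A B) (tensor R A B)"
    using t by (intro tensor_lift_param_lin[OF module_tensor[OF A B] A B module_tensor[OF A B]]
        tensor_mult_left_bilin tensor_lift_lin[OF A B module_tensor[OF A B]] tensor_mult_right_bilin) simp_all
next
  fix t' assume t': "t' \<in> carrier (tensor R A B)"
  show "tensor_lift R (tensor R A B) (\<lambda>a b. tensor_lift R (tensor R A B)
        (\<lambda>a' b'. pure_tensor R A B (a \<otimes>\<^bsub>A\<^esub> a') (b \<otimes>\<^bsub>B\<^esub> b')) t')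
      \<in> lin_hom R (tensor R A B) (tensor R A B)"
    using t' by (intro tensor_lift_lin[OF A B module_tensor[OF A B]] tensor_mult_left_bilin) simp
qed

lemma tensor_mult_pure:
  assumes "a \<in> carrier A" "b \<in> carrier B" "a' \<in> carrier A" "b' \<in> carrier B"
  shows "pure_tensor R A B a b \<otimes>\<^bsub>tensor R A B\<^esub> pure_tensor R A B a' b'
    = pure_tensor R A B (a \<otimes>\<^bsub>A\<^esub> a') (b \<otimes>\<^bsub>B\<^esub> b')"
  using assms
  by (simp add: tensor_mult tensor_lift_pure[OF A B module_tensor[OF A B]] tensor_mult_right_bilin tensor_mult_left_bilin
      pure_tensor_closed[OF A B])

end

lemma tensor_one: "\<one>\<^bsub>tensor R A B\<^esub> = pure_tensor R A B \<one>\<^bsub>A\<^esub> \<one>\<^bsub>B\<^esub>"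
  by (simp add: tensor_def)

lemma pure_tensor_zero:
  assumes M: "module R M" and N: "module R N"
  shows "a \<in> carrier M \<Longrightarrow> pure_tensor R M N a \<zero>\<^bsub>N\<^esub> = \<zero>\<^bsub>tensor R M N\<^esub>"
    and "b \<in> carrier N \<Longrightarrow> pure_tensor R M N \<zero>\<^bsub>M\<^esub> b = \<zero>\<^bsub>tensor R M N\<^esub>"
  using lin_hom_zero[OF N module_tensor[OF M N] bilin_hom_right[OF pure_tensor_bilin[OF M N]]]
    lin_hom_zero[OF M module_tensor[OF M N] bilin_hom_left[OF pure_tensor_bilin[OF M N]]] by simp_all

text \<open>\<open>lin_hom_tensor_eqI\<close> once per argument; it reduces identities between
  products of tensors to products of pure tensors.\<close>

lemma bilin_hom_tensor_eqI:
  assumes M: "module R M" and N: "module R N" and M': "module R M'" and N': "module R N'" and P: "module R P"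
    and \<phi>: "\<phi> \<in> bilin_hom R (tensor R M N) (tensor R M' N') P"
    and \<psi>: "\<psi> \<in> bilin_hom R (tensor R M N) (tensor R M' N') P"
    and eq: "\<And>a b a' b'. \<lbrakk>a \<in> carrier M; b \<in> carrier N; a' \<in> carrier M'; b' \<in> carrier N'\<rbrakk>
      \<Longrightarrow> \<phi> (pure_tensor R M N a b) (pure_tensor R M' N' a' b')
        = \<psi> (pure_tensor R M N a b) (pure_tensor R M' N' a' b')"
    and s: "s \<in> carrier (tensor R M N)" and t: "t \<in> carrier (tensor R M' N')"
  shows "\<phi> s t = \<psi> s t"
proof -
  have s': "s \<in> carrier (tensor R M N)" using s by simp
  show ?thesis
  proof (rule lin_hom_tensor_eqI[OF M' N' P bilin_hom_right[OF \<phi> s'] bilin_hom_right[OF \<psi> s'] _ t])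
    fix a' b' assume a'b': "a' \<in> carrier M'" "b' \<in> carrier N'"
    then have p: "pure_tensor R M' N' a' b' \<in> carrier (tensor R M' N')"
      by (simp add: pure_tensor_closed[OF M' N'])
    show "\<phi> s (pure_tensor R M' N' a' b') = \<psi> s (pure_tensor R M' N' a' b')"
      by (rule lin_hom_tensor_eqI[OF M N P bilin_hom_left[OF \<phi> p] bilin_hom_left[OF \<psi> p] eq s])
        (use a'b' in auto)
  qed
qed

section \<open>Finite direct sums\<close>

lemma direct_product_simps:
  "carrier (direct_product I A) = (\<Pi>\<^sub>E i\<in>I. carrier (A i))"
  "f \<otimes>\<^bsub>direct_product I A\<^esub> g = (\<lambda>i\<in>I. f i \<otimes>\<^bsub>A i\<^esub> g i)"
  "\<one>\<^bsub>direct_product I A\<^esub> = (\<lambda>i\<in>I. \<one>\<^bsub>A i\<^esub>)"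
  "\<zero>\<^bsub>direct_product I A\<^esub> = (\<lambda>i\<in>I. \<zero>\<^bsub>A i\<^esub>)"
  "f \<oplus>\<^bsub>direct_product I A\<^esub> g = (\<lambda>i\<in>I. f i \<oplus>\<^bsub>A i\<^esub> g i)"
  "r \<odot>\<^bsub>direct_product I A\<^esub> f = (\<lambda>i\<in>I. r \<odot>\<^bsub>A i\<^esub> f i)"
  by (simp_all add: direct_product_def)

text \<open>Membership in the carrier fixes the values outside \<open>I\<close>. This matters in
  laws such as the neutrality of zero and one, where one side is not written as a
  restriction.\<close>

lemma direct_product_eqI:
  assumes "f \<in> carrier (direct_product I A)" "g \<in> carrier (direct_product I A)" "\<And>i. i \<in> I \<Longrightarrow> f i = g i"
  shows "f = g"
  using assms by (auto simp: direct_product_simps intro: PiE_ext)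

lemma direct_product_apply:
  "\<lbrakk>f \<in> carrier (direct_product I A); i \<in> I\<rbrakk> \<Longrightarrow> f i \<in> carrier (A i)"
  by (auto simp: direct_product_simps)

lemma direct_product_mem:
  assumes "\<And>i. i \<in> I \<Longrightarrow> f i \<in> carrier (A i)"
  shows "(\<lambda>i\<in>I. f i) \<in> carrier (direct_product I A)"
  using assms by (auto simp: direct_product_simps)

lemma module_direct_product:
  assumes R: "cring R" and A: "\<And>i. i \<in> I \<Longrightarrow> module R (A i)"
  shows "module R (direct_product I A)"
proof -
  note ag = module.axioms(2)[OF A]
  note am = abelian_group.axioms(1)[OF ag]
  note app = direct_product_apply
  show ?thesis
  proof (rule moduleI[OF R])
    show "abelian_group (direct_product I A)"
    proof (rule abelian_groupI)
      fix f assume f: "f \<in> carrier (direct_product I A)"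
      show "\<exists>g\<in>carrier (direct_product I A). g \<oplus>\<^bsub>direct_product I A\<^esub> f = \<zero>\<^bsub>direct_product I A\<^esub>"
      proof (rule bexI)
        show "(\<lambda>i\<in>I. \<ominus>\<^bsub>A i\<^esub> f i) \<in> carrier (direct_product I A)"
          by (rule direct_product_mem) (simp add: abelian_group.a_inv_closed[OF ag] app[OF f])
        show "(\<lambda>i\<in>I. \<ominus>\<^bsub>A i\<^esub> f i) \<oplus>\<^bsub>direct_product I A\<^esub> f = \<zero>\<^bsub>direct_product I A\<^esub>"
          by (auto simp: direct_product_simps abelian_group.l_neg[OF ag] app[OF f] intro!: restrict_ext)
      qed
    next
      fix f assume f: "f \<in> carrier (direct_product I A)"
      show "\<zero>\<^bsub>direct_product I A\<^esub> \<oplus>\<^bsub>direct_product I A\<^esub> f = f"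
        by (rule direct_product_eqI[OF _ f])
          (auto simp: direct_product_simps abelian_monoid.l_zero[OF am] app[OF f])
    next
      fix f g assume f: "f \<in> carrier (direct_product I A)" and g: "g \<in> carrier (direct_product I A)"
      show "f \<oplus>\<^bsub>direct_product I A\<^esub> g \<in> carrier (direct_product I A)"
        by (auto simp: direct_product_simps abelian_monoid.a_closed[OF am] app[OF f] app[OF g])
      show "f \<oplus>\<^bsub>direct_product I A\<^esub> g = g \<oplus>\<^bsub>direct_product I A\<^esub> f"
        by (auto simp: direct_product_simps abelian_monoid.a_comm[OF am] app[OF f] app[OF g]
            intro!: restrict_ext)
    next
      fix f g h assume f: "f \<in> carrier (direct_product I A)" and g: "g \<in> carrier (direct_product I A)"
        and h: "h \<in> carrier (direct_product I A)"
      show "f \<oplus>\<^bsub>direct_product I A\<^esub> g \<oplus>\<^bsub>direct_product I A\<^esub> h = f \<oplus>\<^bsub>direct_product I A\<^esub> (g \<oplus>\<^bsub>direct_product I A\<^esub> h)"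
        by (auto simp: direct_product_simps abelian_monoid.a_assoc[OF am] app[OF f] app[OF g] app[OF h]
            intro!: restrict_ext)
    qed (auto simp: direct_product_simps abelian_monoid.zero_closed[OF am])
  next
    fix f assume f: "f \<in> carrier (direct_product I A)"
    show "\<one>\<^bsub>R\<^esub> \<odot>\<^bsub>direct_product I A\<^esub> f = f"
      by (rule direct_product_eqI[OF _ f])
        (auto simp: direct_product_simps module.smult_one[OF A] app[OF f])
  next
    fix r f g assume r: "r \<in> carrier R"
      and f: "f \<in> carrier (direct_product I A)" and g: "g \<in> carrier (direct_product I A)"
    show "r \<odot>\<^bsub>direct_product I A\<^esub> (f \<oplus>\<^bsub>direct_product I A\<^esub> g)
        = r \<odot>\<^bsub>direct_product I A\<^esub> f \<oplus>\<^bsub>direct_product I A\<^esub> r \<odot>\<^bsub>direct_product I A\<^esub> g"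
      by (auto simp: direct_product_simps module.smult_r_distr[OF A] r app[OF f] app[OF g]
            intro!: restrict_ext)
  next
    fix r s f assume r: "r \<in> carrier R" and s: "s \<in> carrier R" and f: "f \<in> carrier (direct_product I A)"
    show "(r \<oplus>\<^bsub>R\<^esub> s) \<odot>\<^bsub>direct_product I A\<^esub> f
        = r \<odot>\<^bsub>direct_product I A\<^esub> f \<oplus>\<^bsub>direct_product I A\<^esub> s \<odot>\<^bsub>direct_product I A\<^esub> f"
      "(r \<otimes>\<^bsub>R\<^esub> s) \<odot>\<^bsub>direct_product I A\<^esub> f = r \<odot>\<^bsub>direct_product I A\<^esub> (s \<odot>\<^bsub>direct_product I A\<^esub> f)"
      by (auto simp: direct_product_simps module.smult_l_distr[OF A] module.smult_assoc1[OF A] r s app[OF f]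
            intro!: restrict_ext)
  next
    fix r f assume r: "r \<in> carrier R" and f: "f \<in> carrier (direct_product I A)"
    show "r \<odot>\<^bsub>direct_product I A\<^esub> f \<in> carrier (direct_product I A)"
      by (auto simp: direct_product_simps module.smult_closed[OF A] r app[OF f])
  qed
qed

lemma assoc_algebra_direct_product:
  assumes R: "cring R" and A: "\<And>i. i \<in> I \<Longrightarrow> assoc_algebra R (A i)"
  shows "assoc_algebra R (direct_product I A)"
proof -
  note ring = assoc_algebra.axioms(2)[OF A]
  note mon = ring.is_monoid[OF ring]
  note app = direct_product_apply
  have mod: "module R (direct_product I A)"
    by (rule module_direct_product[OF R assoc_algebra.axioms(1)[OF A]])
  have "monoid (direct_product I A)"
  proof (rule monoidI)
    fix f g h assume f: "f \<in> carrier (direct_product I A)" and g: "g \<in> carrier (direct_product I A)"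
      and h: "h \<in> carrier (direct_product I A)"
    show "f \<otimes>\<^bsub>direct_product I A\<^esub> g \<otimes>\<^bsub>direct_product I A\<^esub> h = f \<otimes>\<^bsub>direct_product I A\<^esub> (g \<otimes>\<^bsub>direct_product I A\<^esub> h)"
      by (auto simp: direct_product_simps monoid.m_assoc[OF mon] app[OF f] app[OF g] app[OF h]
            intro!: restrict_ext)
  next
    fix f assume f: "f \<in> carrier (direct_product I A)"
    show "\<one>\<^bsub>direct_product I A\<^esub> \<otimes>\<^bsub>direct_product I A\<^esub> f = f"
      by (rule direct_product_eqI[OF _ f])
        (auto simp: direct_product_simps monoid.l_one[OF mon] app[OF f])
    show "f \<otimes>\<^bsub>direct_product I A\<^esub> \<one>\<^bsub>direct_product I A\<^esub> = f"
      by (rule direct_product_eqI[OF _ f])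
        (auto simp: direct_product_simps monoid.r_one[OF mon] app[OF f])
  next
    fix f g assume f: "f \<in> carrier (direct_product I A)" and g: "g \<in> carrier (direct_product I A)"
    show "f \<otimes>\<^bsub>direct_product I A\<^esub> g \<in> carrier (direct_product I A)"
      by (auto simp: direct_product_simps monoid.m_closed[OF mon] app[OF f] app[OF g])
  qed (auto simp: direct_product_simps monoid.one_closed[OF mon])
  then have "ring (direct_product I A)"
  proof (intro ringI module.axioms(2)[OF mod])
    fix f g h assume f: "f \<in> carrier (direct_product I A)" and g: "g \<in> carrier (direct_product I A)"
      and h: "h \<in> carrier (direct_product I A)"
    show "(f \<oplus>\<^bsub>direct_product I A\<^esub> g) \<otimes>\<^bsub>direct_product I A\<^esub> h
        = f \<otimes>\<^bsub>direct_product I A\<^esub> h \<oplus>\<^bsub>direct_product I A\<^esub> g \<otimes>\<^bsub>direct_product I A\<^esub> h"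
      by (auto simp: direct_product_simps ring.ring_simprules(13)[OF ring] app[OF f] app[OF g] app[OF h]
            intro!: restrict_ext)
    show "h \<otimes>\<^bsub>direct_product I A\<^esub> (f \<oplus>\<^bsub>direct_product I A\<^esub> g)
        = h \<otimes>\<^bsub>direct_product I A\<^esub> f \<oplus>\<^bsub>direct_product I A\<^esub> h \<otimes>\<^bsub>direct_product I A\<^esub> g"
      by (auto simp: direct_product_simps ring.ring_simprules(23)[OF ring] app[OF f] app[OF g] app[OF h]
            intro!: restrict_ext)
  qed
  then show ?thesis
  proof (rule assoc_algebra.intro[OF mod])
    show "assoc_algebra_axioms R (direct_product I A)"
    proof
      fix r f g assume r: "r \<in> carrier R" and f: "f \<in> carrier (direct_product I A)"
        and g: "g \<in> carrier (direct_product I A)"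
      show "(r \<odot>\<^bsub>direct_product I A\<^esub> f) \<otimes>\<^bsub>direct_product I A\<^esub> g = r \<odot>\<^bsub>direct_product I A\<^esub> (f \<otimes>\<^bsub>direct_product I A\<^esub> g)"
        "f \<otimes>\<^bsub>direct_product I A\<^esub> (r \<odot>\<^bsub>direct_product I A\<^esub> g) = r \<odot>\<^bsub>direct_product I A\<^esub> (f \<otimes>\<^bsub>direct_product I A\<^esub> g)"
        by (auto simp: direct_product_simps assoc_algebra.smult_mult_left[OF A]
            assoc_algebra.smult_mult_right[OF A] r app[OF f] app[OF g] intro!: restrict_ext)
    qed
  qed
qed

context
  fixes R :: "('k, 'r) ring_scheme" and I :: "'i set" and A :: "'i \<Rightarrow> ('k, 'a, 'm) module_scheme"
  assumes R: "cring R" and fin: "finite I" and A: "\<And>i. i \<in> I \<Longrightarrow> module R (A i)"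
begin

private abbreviation (input) "H \<equiv> direct_product I A"

interpretation H: module R H by (rule module_direct_product[OF R A])

lemma direct_proj_lin: "i \<in> I \<Longrightarrow> (\<lambda>f. f i) \<in> lin_hom R H (A i)"
  by (rule lin_homI) (auto simp: direct_product_simps)

lemma direct_incl_lin:
  assumes "i \<in> I"
  shows "direct_incl I A i \<in> lin_hom R (A i) H"
proof (rule lin_homI)
  note am = abelian_group.axioms(1)[OF module.axioms(2)[OF A]]
  fix a assume "a \<in> carrier (A i)"
  then show "direct_incl I A i a \<in> carrier H"
    by (auto simp: direct_incl_def direct_product_simps abelian_monoid.zero_closed[OF am])
next
  note am = abelian_group.axioms(1)[OF module.axioms(2)[OF A]]
  fix a b
  show "direct_incl I A i (a \<oplus>\<^bsub>A i\<^esub> b) = direct_incl I A i a \<oplus>\<^bsub>H\<^esub> direct_incl I A i b"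
    by (auto simp: direct_incl_def direct_product_simps abelian_monoid.l_zero[OF am]
        abelian_monoid.zero_closed[OF am] intro!: restrict_ext)
next
  fix r a assume "r \<in> carrier R"
  then show "direct_incl I A i (r \<odot>\<^bsub>A i\<^esub> a) = r \<odot>\<^bsub>H\<^esub> direct_incl I A i a"
    by (auto simp: direct_incl_def direct_product_simps module.smult_r_null[OF A] intro!: restrict_ext)
qed

text \<open>Finiteness of \<open>I\<close> turns the product into a sum: in the component
  \<open>j\<close> only the summand with index \<open>j\<close> contributes.\<close>

lemma direct_sum_incl:
  assumes f: "f \<in> carrier H"
  shows "(\<Oplus>\<^bsub>H\<^esub>i\<in>I. direct_incl I A i (f i)) = f"
proof (rule direct_product_eqI[OF _ f])
  have cl: "(\<lambda>i. direct_incl I A i (f i)) \<in> I \<rightarrow> carrier H"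
    using lin_hom_closed[OF direct_incl_lin] direct_product_apply[OF f] by blast
  then show "(\<Oplus>\<^bsub>H\<^esub>i\<in>I. direct_incl I A i (f i)) \<in> carrier H" by (rule H.M.finsum_closed)
  fix j assume j: "j \<in> I"
  interpret Aj: module R "A j" by (rule A[OF j])
  have "(\<Oplus>\<^bsub>H\<^esub>i\<in>I. direct_incl I A i (f i)) j = (\<Oplus>\<^bsub>A j\<^esub>i\<in>I. direct_incl I A i (f i) j)"
    by (rule lin_hom_finsum[OF H.module_axioms A[OF j] direct_proj_lin[OF j] cl])
  also have "\<dots> = (\<Oplus>\<^bsub>A j\<^esub>i\<in>I. if j = i then f j else \<zero>\<^bsub>A j\<^esub>)"
    by (rule Aj.M.finsum_cong') (auto simp: direct_incl_def j direct_product_apply[OF f])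
  also have "\<dots> = f j"
    using j fin direct_product_apply[OF f j] by (intro Aj.M.finsum_singleton) auto
  finally show "(\<Oplus>\<^bsub>H\<^esub>i\<in>I. direct_incl I A i (f i)) j = f j" .
qed

lemma lin_hom_direct_eqI:
  assumes P: "module R P" and f: "f \<in> lin_hom R H P" and g: "g \<in> lin_hom R H P"
    and eq: "\<And>i a. \<lbrakk>i \<in> I; a \<in> carrier (A i)\<rbrakk> \<Longrightarrow> f (direct_incl I A i a) = g (direct_incl I A i a)"
    and h: "h \<in> carrier H"
  shows "f h = g h"
proof -
  interpret P: module R P by (rule P)
  have cl: "(\<lambda>i. direct_incl I A i (h i)) \<in> I \<rightarrow> carrier H"
    using lin_hom_closed[OF direct_incl_lin] direct_product_apply[OF h] by blast
  have "f (\<Oplus>\<^bsub>H\<^esub>i\<in>I. direct_incl I A i (h i)) = g (\<Oplus>\<^bsub>H\<^esub>i\<in>I. direct_incl I A i (h i))"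
    unfolding lin_hom_finsum[OF H.module_axioms P f cl] lin_hom_finsum[OF H.module_axioms P g cl]
    by (rule P.M.finsum_cong') (use cl eq direct_product_apply[OF h] lin_hom_closed[OF g] in \<open>auto simp: Pi_iff\<close>)
  then show ?thesis by (simp add: direct_sum_incl[OF h])
qed

context
  fixes P :: "('k, 'c, 'p) module_scheme" and f :: "'i \<Rightarrow> 'a \<Rightarrow> 'c"
  assumes P: "module R P" and f: "\<And>i. i \<in> I \<Longrightarrow> f i \<in> lin_hom R (A i) P"
begin

interpretation P: module R P by (rule P)

lemma direct_lift_lin: "direct_lift I P f \<in> lin_hom R H P"
  unfolding direct_lift_def
  by (rule lin_hom_sum[OF H.module_axioms P]) (rule lin_hom_comp[OF direct_proj_lin f])

lemma direct_lift_incl: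
  assumes "i \<in> I" "a \<in> carrier (A i)"
  shows "direct_lift I P f (direct_incl I A i a) = f i a"
proof -
  have "direct_lift I P f (direct_incl I A i a) = (\<Oplus>\<^bsub>P\<^esub>j\<in>I. if i = j then f i a else \<zero>\<^bsub>P\<^esub>)"
    unfolding direct_lift_def
    by (rule P.M.finsum_cong')
      (use assms lin_hom_closed[OF f] in \<open>auto simp: direct_incl_def lin_hom_zero[OF A P f]\<close>)
  also have "\<dots> = f i a"
    using fin assms lin_hom_closed[OF f] by (intro P.M.finsum_singleton) auto
  finally show ?thesis .
qed

end

end

lemma (in abelian_monoid) finsum_single:
  assumes "finite A" "x \<in> A" "f x \<in> carrier G" "\<And>y. \<lbrakk>y \<in> A; y \<noteq> x\<rbrakk> \<Longrightarrow> f y = \<zero>"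
  shows "(\<Oplus>y\<in>A. f y) = f x"
proof -
  have "(\<Oplus>y\<in>A. f y) = (\<Oplus>y\<in>A. if x = y then f x else \<zero>)"
    by (rule finsum_cong') (use assms in auto)
  also have "\<dots> = f x"
    using assms by (intro finsum_singleton) auto
  finally show ?thesis .
qed

lemma (in abelian_monoid) finsum_all_zero: "(\<And>x. x \<in> A \<Longrightarrow> f x = \<zero>) \<Longrightarrow> (\<Oplus>x\<in>A. f x) = \<zero>"
  by (rule add.finprod_one_eqI)

lemma (in abelian_monoid) finsum_swap:
  assumes "finite A" "\<And>x y. \<lbrakk>x \<in> A; y \<in> B\<rbrakk> \<Longrightarrow> f x y \<in> carrier G"
  shows "(\<Oplus>x\<in>A. \<Oplus>y\<in>B. f x y) = (\<Oplus>y\<in>B. \<Oplus>x\<in>A. f x y)"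
  using assms
proof (induction A rule: finite_induct)
  case (insert a A)
  have "(\<Oplus>x\<in>insert a A. \<Oplus>y\<in>B. f x y) = (\<Oplus>y\<in>B. f a y) \<oplus> (\<Oplus>y\<in>B. \<Oplus>x\<in>A. f x y)"
    using insert by (simp add: Pi_def)
  also have "\<dots> = (\<Oplus>y\<in>B. f a y \<oplus> (\<Oplus>x\<in>A. f x y))"
    using insert.prems by (intro finsum_addf[symmetric]) (auto intro!: finsum_closed)
  also have "\<dots> = (\<Oplus>y\<in>B. \<Oplus>x\<in>insert a A. f x y)"
    by (rule finsum_cong') (use insert in \<open>auto intro!: finsum_closed\<close>)
  finally show ?case .
qed simp

lemma (in abelian_monoid) finsum_Times:
  assumes "finite A" "finite B" "\<And>x y. \<lbrakk>x \<in> A; y \<in> B\<rbrakk> \<Longrightarrow> f (x, y) \<in> carrier G"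
  shows "(\<Oplus>p\<in>A \<times> B. f p) = (\<Oplus>x\<in>A. \<Oplus>y\<in>B. f (x, y))"
  using assms(1,3)
proof (induction A rule: finite_induct)
  case (insert a A)
  have "(\<Oplus>p\<in>insert a A \<times> B. f p) = (\<Oplus>p\<in>Pair a ` B \<union> A \<times> B. f p)"
    by (rule arg_cong[where f = "finsum G f"]) auto
  also have "\<dots> = (\<Oplus>p\<in>Pair a ` B. f p) \<oplus> (\<Oplus>p\<in>A \<times> B. f p)"
    by (rule finsum_Un_disjoint) (use insert assms(2) in auto)
  also have "(\<Oplus>p\<in>Pair a ` B. f p) = (\<Oplus>y\<in>B. f (a, y))"
    by (rule finsum_reindex) (use insert in \<open>auto intro: inj_onI\<close>)
  also have "(\<Oplus>p\<in>A \<times> B. f p) = (\<Oplus>x\<in>A. \<Oplus>y\<in>B. f (x, y))"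
    using insert by simp
  also have "(\<Oplus>y\<in>B. f (a, y)) \<oplus> (\<Oplus>x\<in>A. \<Oplus>y\<in>B. f (x, y)) = (\<Oplus>x\<in>insert a A. \<Oplus>y\<in>B. f (x, y))"
    using insert by (subst finsum_insert) (auto intro!: finsum_closed)
  finally show ?case .
qed simp

section \<open>The total algebra of a finite dual Hopf category\<close>

locale finite_dual_hopf_category = dual_hopf_category +
  assumes finite_X: "finite X"
begin

abbreviation H where "H \<equiv> total_algebra X C"
abbreviation \<iota> where "\<iota> \<equiv> total_incl X C"
abbreviation HH where "HH \<equiv> tensor R H H"
abbreviation HHH where "HHH \<equiv> tensor R HH H"
abbreviation D where "D \<equiv> total_comult R X C \<Delta>"
abbreviation E where "E \<equiv> total_counit R X \<epsilon>"
abbreviation T where "T \<equiv> total_antipode X C S"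
text \<open>The units of the summands: orthogonal idempotents of \<open>H\<close>, in which the
  comultiplication of the unit is expressed.\<close>

abbreviation e where "e x y \<equiv> \<iota> x y \<one>\<^bsub>C x y\<^esub>"

section \<open>Inclusions of the summands and products of their elements\<close>

lemma mod_C: "\<lbrakk>x \<in> X; y \<in> X\<rbrakk> \<Longrightarrow> module R (C x y)"
  by (rule assoc_algebra.axioms(1)[OF algebras])

lemma ring_C: "\<lbrakk>x \<in> X; y \<in> X\<rbrakk> \<Longrightarrow> ring (C x y)"
  by (rule assoc_algebra.axioms(2)[OF algebras])

lemma one_C: "\<lbrakk>x \<in> X; y \<in> X\<rbrakk> \<Longrightarrow> \<one>\<^bsub>C x y\<^esub> \<in> carrier (C x y)"
  by (rule ring.ring_simprules(6)[OF ring_C])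

lemma mult_C: "\<lbrakk>x \<in> X; y \<in> X; a \<in> carrier (C x y); b \<in> carrier (C x y)\<rbrakk> \<Longrightarrow> a \<otimes>\<^bsub>C x y\<^esub> b \<in> carrier (C x y)"
  by (rule ring.ring_simprules(5)[OF ring_C])

lemma mult_C_bilin: "\<lbrakk>x \<in> X; y \<in> X\<rbrakk> \<Longrightarrow> mult (C x y) \<in> bilin_hom R (C x y) (C x y) (C x y)"
  by (rule assoc_algebra.mult_bilin[OF algebras])

lemma alg_H: "assoc_algebra R H"
  unfolding total_algebra_def by (rule assoc_algebra_direct_product[OF is_cring]) (auto intro: algebras)

sublocale H: assoc_algebra R H by (rule alg_H)

lemma mod_H: "module R H" by (rule H.module_axioms)
lemma mod_HH: "module R HH" by (rule module_tensor[OF mod_H mod_H])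
lemma mod_HHH: "module R HHH" by (rule module_tensor[OF mod_HH mod_H])
lemma mod_R: "module R (base_algebra R)" by (rule module_base_algebra[OF is_cring])

sublocale HH: module R HH by (rule mod_HH)
sublocale HHH: module R HHH by (rule mod_HHH)

lemma incl_lin: "\<lbrakk>x \<in> X; y \<in> X\<rbrakk> \<Longrightarrow> \<iota> x y \<in> lin_hom R (C x y) H"
  unfolding total_algebra_def total_incl_def
  using direct_incl_lin[OF is_cring _ _, of "X \<times> X" "\<lambda>(x, y). C x y" "(x, y)"] finite_X mod_C
  by auto

lemma incl_closed: "\<lbrakk>x \<in> X; y \<in> X; a \<in> carrier (C x y)\<rbrakk> \<Longrightarrow> \<iota> x y a \<in> carrier H"
  by (rule lin_hom_closed[OF incl_lin])

lemma e_closed: "\<lbrakk>x \<in> X; y \<in> X\<rbrakk> \<Longrightarrow> e x y \<in> carrier H"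
  by (rule incl_closed[OF _ _ one_C])

lemma lin_hom_total_eqI:
  assumes "module R P" "f \<in> lin_hom R H P" "g \<in> lin_hom R H P"
    and "\<And>x y a. \<lbrakk>x \<in> X; y \<in> X; a \<in> carrier (C x y)\<rbrakk> \<Longrightarrow> f (\<iota> x y a) = g (\<iota> x y a)"
    and "h \<in> carrier H"
  shows "f h = g h"
proof (rule lin_hom_direct_eqI[OF is_cring, where I = "X \<times> X" and A = "\<lambda>(x, y). C x y"])
  show "module R P" by (rule assms(1))
  show "f \<in> lin_hom R (direct_product (X \<times> X) (\<lambda>(x, y). C x y)) P"
    "g \<in> lin_hom R (direct_product (X \<times> X) (\<lambda>(x, y). C x y)) P"
    "h \<in> carrier (direct_product (X \<times> X) (\<lambda>(x, y). C x y))"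
    using assms(2,3,5) by (simp_all add: total_algebra_def)
  show "finite (X \<times> X)" using finite_X by simp
  fix i assume "i \<in> X \<times> X"
  then show "module R (case i of (x, y) \<Rightarrow> C x y)"
    by (auto intro: mod_C)
  fix a assume "a \<in> carrier (case i of (x, y) \<Rightarrow> C x y)"
  with \<open>i \<in> X \<times> X\<close> assms(4)[of "fst i" "snd i" a]
  show "f (direct_incl (X \<times> X) (\<lambda>(x, y). C x y) i a) = g (direct_incl (X \<times> X) (\<lambda>(x, y). C x y) i a)"
    by (simp add: total_incl_def case_prod_beta mem_Times_iff)
qed

lemma H_apply: "\<lbrakk>h \<in> carrier H; x \<in> X; y \<in> X\<rbrakk> \<Longrightarrow> h (x, y) \<in> carrier (C x y)"
  unfolding total_algebra_def by (drule direct_product_apply[where i = "(x, y)"]) auto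

lemma one_H_apply: "\<lbrakk>x \<in> X; y \<in> X\<rbrakk> \<Longrightarrow> \<one>\<^bsub>H\<^esub> (x, y) = \<one>\<^bsub>C x y\<^esub>"
  by (simp add: total_algebra_def direct_product_simps)

text \<open>The product is componentwise and the included element vanishes off
  \<open>(x, y)\<close>, so only that component of \<open>h\<close> is seen. Idempotence and
  orthogonality of the summands both follow from this.\<close>

lemma H_mult_incl:
  assumes "x \<in> X" "y \<in> X" "h \<in> carrier H" "a \<in> carrier (C x y)"
  shows "h \<otimes>\<^bsub>H\<^esub> \<iota> x y a = \<iota> x y (h (x, y) \<otimes>\<^bsub>C x y\<^esub> a)"
    and "\<iota> x y a \<otimes>\<^bsub>H\<^esub> h = \<iota> x y (a \<otimes>\<^bsub>C x y\<^esub> h (x, y))"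
  using H_apply[OF assms(3)]
  by (auto simp: total_algebra_def total_incl_def direct_product_simps direct_incl_def
      ring.ring_simprules(24)[OF ring_C] ring.ring_simprules(25)[OF ring_C] intro!: restrict_ext)

lemma incl_zero: "\<lbrakk>x \<in> X; y \<in> X\<rbrakk> \<Longrightarrow> \<iota> x y \<zero>\<^bsub>C x y\<^esub> = \<zero>\<^bsub>H\<^esub>"
  by (rule lin_hom_zero[OF mod_C mod_H incl_lin])

lemma incl_apply:
  "\<lbrakk>x \<in> X; y \<in> X; x' \<in> X; y' \<in> X\<rbrakk>
    \<Longrightarrow> \<iota> x y a (x', y') = (if x' = x \<and> y' = y then a else \<zero>\<^bsub>C x' y'\<^esub>)"
  by (auto simp: total_incl_def direct_incl_def)

lemma incl_mult:
  "\<lbrakk>x \<in> X; y \<in> X; a \<in> carrier (C x y); b \<in> carrier (C x y)\<rbrakk>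
    \<Longrightarrow> \<iota> x y a \<otimes>\<^bsub>H\<^esub> \<iota> x y b = \<iota> x y (a \<otimes>\<^bsub>C x y\<^esub> b)"
  by (simp add: H_mult_incl incl_closed incl_apply)

lemma incl_mult_zero:
  "\<lbrakk>x \<in> X; y \<in> X; a \<in> carrier (C x y); x' \<in> X; y' \<in> X; b \<in> carrier (C x' y'); x \<noteq> x' \<or> y \<noteq> y'\<rbrakk>
    \<Longrightarrow> \<iota> x y a \<otimes>\<^bsub>H\<^esub> \<iota> x' y' b = \<zero>\<^bsub>H\<^esub>"
  by (subst H_mult_incl)
    (auto simp: incl_closed incl_apply incl_zero ring.ring_simprules(24)[OF ring_C])

lemma e_mult_incl:
  "\<lbrakk>x \<in> X; y \<in> X; a \<in> carrier (C x y)\<rbrakk> \<Longrightarrow> e x y \<otimes>\<^bsub>H\<^esub> \<iota> x y a = \<iota> x y a"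
  "\<lbrakk>x \<in> X; y \<in> X; a \<in> carrier (C x y)\<rbrakk> \<Longrightarrow> \<iota> x y a \<otimes>\<^bsub>H\<^esub> e x y = \<iota> x y a"
  by (simp_all add: incl_mult one_C ring.ring_simprules(12)[OF ring_C] ring.is_monoid[OF ring_C] monoid.r_one)

section \<open>The structure maps on a single summand\<close>

lemma eps_lin: "x \<in> X \<Longrightarrow> \<epsilon> x \<in> lin_hom R (C x x) (base_algebra R)"
  using counit_hom by (simp add: alg_hom_def)

lemma eps_closed: "\<lbrakk>x \<in> X; a \<in> carrier (C x x)\<rbrakk> \<Longrightarrow> \<epsilon> x a \<in> carrier R"
  using lin_hom_closed[OF eps_lin] by simp

lemma eps_mult:
  "\<lbrakk>x \<in> X; a \<in> carrier (C x x); b \<in> carrier (C x x)\<rbrakk> \<Longrightarrow> \<epsilon> x (a \<otimes>\<^bsub>C x x\<^esub> b) = \<epsilon> x a \<otimes> \<epsilon> x b"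
  using counit_hom ring_hom_mult[of "\<epsilon> x" "C x x" "base_algebra R"] by (simp add: alg_hom_def)

lemma comult_lin:
  "\<lbrakk>x \<in> X; y \<in> X; z \<in> X\<rbrakk> \<Longrightarrow> \<Delta> x y z \<in> lin_hom R (C x z) (tensor R (C x y) (C y z))"
  using comult_hom by (simp add: alg_hom_def)

lemma comult_closed:
  "\<lbrakk>x \<in> X; y \<in> X; z \<in> X; a \<in> carrier (C x z)\<rbrakk> \<Longrightarrow> \<Delta> x y z a \<in> carrier (tensor R (C x y) (C y z))"
  by (rule lin_hom_closed[OF comult_lin])

lemma comult_mult:
  "\<lbrakk>x \<in> X; y \<in> X; z \<in> X; a \<in> carrier (C x z); b \<in> carrier (C x z)\<rbrakk>
    \<Longrightarrow> \<Delta> x y z (a \<otimes>\<^bsub>C x z\<^esub> b) = \<Delta> x y z a \<otimes>\<^bsub>tensor R (C x y) (C y z)\<^esub> \<Delta> x y z b"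
  using comult_hom[of x y z] by (simp add: alg_hom_def ring_hom_mult)

lemma comult_one:
  "\<lbrakk>x \<in> X; y \<in> X; z \<in> X\<rbrakk>
    \<Longrightarrow> \<Delta> x y z \<one>\<^bsub>C x z\<^esub> = pure_tensor R (C x y) (C y z) \<one>\<^bsub>C x y\<^esub> \<one>\<^bsub>C y z\<^esub>"
  using comult_hom[of x y z] by (simp add: alg_hom_def tensor_one[symmetric] ring_hom_one)

lemma counit_component_lin:
  "\<lbrakk>x \<in> X; y \<in> X\<rbrakk> \<Longrightarrow> (\<lambda>h. if x = y then \<epsilon> x h else \<zero>) \<in> lin_hom R (C x y) (base_algebra R)"
  using lin_hom_const_zero[OF mod_R] eps_lin by (cases "x = y") auto

lemma E_lin: "E \<in> lin_hom R H (base_algebra R)"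
  unfolding total_counit_def total_algebra_def
  by (rule direct_lift_lin[OF is_cring _ _ mod_R]) (auto simp: finite_X mod_C counit_component_lin)

lemma E_closed: "h \<in> carrier H \<Longrightarrow> E h \<in> carrier R"
  using lin_hom_closed[OF E_lin] by simp

lemma E_incl:
  "\<lbrakk>x \<in> X; y \<in> X; a \<in> carrier (C x y)\<rbrakk> \<Longrightarrow> E (\<iota> x y a) = (if x = y then \<epsilon> x a else \<zero>)"
  unfolding total_counit_def total_incl_def
  by (subst direct_lift_incl[OF is_cring _ _ mod_R]) (auto simp: finite_X mod_C counit_component_lin)

lemma T_component_lin: "\<lbrakk>x \<in> X; y \<in> X\<rbrakk> \<Longrightarrow> (\<lambda>h. \<iota> y x (S y x h)) \<in> lin_hom R (C x y) H"
  by (rule lin_hom_comp[OF antipode_lin incl_lin])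

lemma S_closed: "\<lbrakk>x \<in> X; y \<in> X; a \<in> carrier (C y x)\<rbrakk> \<Longrightarrow> S x y a \<in> carrier (C x y)"
  by (rule lin_hom_closed[OF antipode_lin])

lemma T_lin: "T \<in> lin_hom R H H"
proof -
  have "direct_lift (X \<times> X) H (\<lambda>(x, y) h. \<iota> y x (S y x h)) \<in> lin_hom R (direct_product (X \<times> X) (\<lambda>(x, y). C x y)) H"
    by (rule direct_lift_lin[OF is_cring _ _ mod_H]) (auto simp: finite_X mod_C T_component_lin)
  then show ?thesis by (simp add: total_antipode_def total_algebra_def)
qed

lemma T_incl:
  assumes "x \<in> X" "y \<in> X" "a \<in> carrier (C x y)"
  shows "T (\<iota> x y a) = \<iota> y x (S y x a)"
proof -
  have "direct_lift (X \<times> X) H (\<lambda>(x, y) h. \<iota> y x (S y x h)) (direct_incl (X \<times> X) (\<lambda>(x, y). C x y) (x, y) a)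
      = (\<lambda>(x, y) h. \<iota> y x (S y x h)) (x, y) a"
    by (rule direct_lift_incl[OF is_cring _ _ mod_H]) (use assms in \<open>auto simp: finite_X mod_C T_component_lin\<close>)
  then show ?thesis by (simp add: total_antipode_def total_incl_def)
qed

text \<open>The map from \<open>C x y \<otimes> C y z\<close> to \<open>H \<otimes> H\<close>
  induced by the inclusions. Naming it makes \<open>D\<close> on a summand a plain sum over middle
  objects, so that each middle object can be treated alone.\<close>

definition J where "J x y z = tensor_map R H H (\<iota> x y) (\<iota> y z)"

lemma J_lin: "\<lbrakk>x \<in> X; y \<in> X; z \<in> X\<rbrakk> \<Longrightarrow> J x y z \<in> lin_hom R (tensor R (C x y) (C y z)) HH"
  unfolding J_def by (rule tensor_map_lin[OF mod_C mod_C mod_H mod_H incl_lin incl_lin])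

lemma J_pure:
  "\<lbrakk>x \<in> X; y \<in> X; z \<in> X; a \<in> carrier (C x y); b \<in> carrier (C y z)\<rbrakk>
    \<Longrightarrow> J x y z (pure_tensor R (C x y) (C y z) a b) = pure_tensor R H H (\<iota> x y a) (\<iota> y z b)"
  unfolding J_def by (rule tensor_map_pure[OF mod_C mod_C mod_H mod_H incl_lin incl_lin])

lemma J_comult_closed: "\<lbrakk>x \<in> X; y \<in> X; z \<in> X; a \<in> carrier (C x z)\<rbrakk> \<Longrightarrow> J x y z (\<Delta> x y z a) \<in> carrier HH"
  by (rule lin_hom_closed[OF J_lin comult_closed])

lemma D_component_lin: "\<lbrakk>x \<in> X; z \<in> X\<rbrakk> \<Longrightarrow> (\<lambda>h. \<Oplus>\<^bsub>HH\<^esub>y\<in>X. J x y z (\<Delta> x y z h)) \<in> lin_hom R (C x z) HH"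
  by (rule lin_hom_sum[OF mod_C mod_HH]) (auto intro: lin_hom_comp[OF comult_lin J_lin])

lemma D_eq_direct_lift: "D = direct_lift (X \<times> X) HH (\<lambda>(x, z) h. \<Oplus>\<^bsub>HH\<^esub>y\<in>X. J x y z (\<Delta> x y z h))"
  by (simp add: total_comult_def J_def Let_def)

lemma D_lin: "D \<in> lin_hom R H HH"
proof -
  have "D \<in> lin_hom R (direct_product (X \<times> X) (\<lambda>(x, y). C x y)) HH"
    unfolding D_eq_direct_lift by (rule direct_lift_lin[OF is_cring _ _ mod_HH]) (auto simp: finite_X mod_C D_component_lin)
  then show ?thesis by (simp add: total_algebra_def)
qed

lemma D_closed: "h \<in> carrier H \<Longrightarrow> D h \<in> carrier HH"
  by (rule lin_hom_closed[OF D_lin])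

lemma D_incl:
  assumes "x \<in> X" "z \<in> X" "a \<in> carrier (C x z)"
  shows "D (\<iota> x z a) = (\<Oplus>\<^bsub>HH\<^esub>y\<in>X. J x y z (\<Delta> x y z a))"
proof -
  have "direct_lift (X \<times> X) HH (\<lambda>(x, z) h. \<Oplus>\<^bsub>HH\<^esub>y\<in>X. J x y z (\<Delta> x y z h))
      (direct_incl (X \<times> X) (\<lambda>(x, y). C x y) (x, z) a) = (\<lambda>(x, z) h. \<Oplus>\<^bsub>HH\<^esub>y\<in>X. J x y z (\<Delta> x y z h)) (x, z) a"
    by (rule direct_lift_incl[OF is_cring _ _ mod_HH]) (use assms in \<open>auto simp: finite_X mod_C D_component_lin\<close>)
  then show ?thesis by (simp add: D_eq_direct_lift total_incl_def)
qed

text \<open>Evaluates a Sweedler expression on a summand as a sum over the middle object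
  \<open>y\<close>. The counit and antipode laws start from this sum and then determine which
  \<open>y\<close> contribute.\<close>

lemma tensor_lift_D_incl:
  assumes P: "module R P" and \<phi>: "\<phi> \<in> bilin_hom R H H P"
    and a: "x \<in> X" "z \<in> X" "a \<in> carrier (C x z)"
  shows "tensor_lift R P \<phi> (D (\<iota> x z a))
    = (\<Oplus>\<^bsub>P\<^esub>y\<in>X. tensor_lift R P (\<lambda>b c. \<phi> (\<iota> x y b) (\<iota> y z c)) (\<Delta> x y z a))"
proof -
  interpret P: module R P by (rule P)
  have "tensor_lift R P \<phi> (D (\<iota> x z a)) = (\<Oplus>\<^bsub>P\<^esub>y\<in>X. tensor_lift R P \<phi> (J x y z (\<Delta> x y z a)))"
    unfolding D_incl[OF a] using a J_comult_closed
    by (intro lin_hom_finsum[OF mod_HH P tensor_lift_lin[OF mod_H mod_H P \<phi>]]) auto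
  also have "\<dots> = (\<Oplus>\<^bsub>P\<^esub>y\<in>X. tensor_lift R P (\<lambda>b c. \<phi> (\<iota> x y b) (\<iota> y z c)) (\<Delta> x y z a))"
  proof (rule P.M.finsum_cong', simp)
    fix y assume y: "y \<in> X"
    show "tensor_lift R P \<phi> (J x y z (\<Delta> x y z a))
        = tensor_lift R P (\<lambda>b c. \<phi> (\<iota> x y b) (\<iota> y z c)) (\<Delta> x y z a)"
      unfolding J_def using a y
      by (intro tensor_lift_map[OF mod_C mod_C mod_H mod_H incl_lin incl_lin P \<phi> comult_closed]) auto
  next
    show "(\<lambda>y. tensor_lift R P (\<lambda>b c. \<phi> (\<iota> x y b) (\<iota> y z c)) (\<Delta> x y z a)) \<in> X \<rightarrow> carrier P"
      using a by (intro Pi_I lin_hom_closed[OF tensor_lift_lin[OF mod_C mod_C P bilin_hom_comp2[OF \<phi> incl_lin incl_lin]] comult_closed]) auto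
  qed
  finally show ?thesis .
qed

text \<open>The components of the unit are the units of the \<open>C x z\<close>, and
  \<open>comult_one\<close> splits them. Stating the result behind a linear \<open>f\<close> makes
  it applicable to lifts, to tensor maps, and to products with one factor frozen.\<close>

lemma lin_hom_D_one:
  assumes P: "module R P" and f: "f \<in> lin_hom R HH P"
  shows "f (D \<one>\<^bsub>H\<^esub>) = (\<Oplus>\<^bsub>P\<^esub>x\<in>X. \<Oplus>\<^bsub>P\<^esub>y\<in>X. \<Oplus>\<^bsub>P\<^esub>z\<in>X. f (pure_tensor R H H (e x y) (e y z)))"
proof -
  interpret P: module R P by (rule P)
  let ?p = "\<lambda>x y z. pure_tensor R H H (e x y) (e y z)"
  have cl: "?p x y z \<in> carrier HH" "f (?p x y z) \<in> carrier P" if "x \<in> X" "y \<in> X" "z \<in> X" for x y z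
    using that by (auto intro!: pure_tensor_closed[OF mod_H mod_H] lin_hom_closed[OF f] e_closed)
  have "D \<one>\<^bsub>H\<^esub> = (\<Oplus>\<^bsub>HH\<^esub>p\<in>X \<times> X. case p of (x, z) \<Rightarrow> \<Oplus>\<^bsub>HH\<^esub>y\<in>X. ?p x y z)"
    unfolding D_eq_direct_lift direct_lift_def
  proof (rule HH.M.finsum_cong', simp)
    show "(\<lambda>p. case p of (x, z) \<Rightarrow> \<Oplus>\<^bsub>HH\<^esub>y\<in>X. ?p x y z) \<in> X \<times> X \<rightarrow> carrier HH"
      by (auto intro!: HH.M.finsum_closed cl)
    fix p assume "p \<in> X \<times> X"
    then obtain x z where p: "p = (x, z)" "x \<in> X" "z \<in> X" by blast
    have "(\<Oplus>\<^bsub>HH\<^esub>y\<in>X. J x y z (\<Delta> x y z (\<one>\<^bsub>H\<^esub> p))) = (\<Oplus>\<^bsub>HH\<^esub>y\<in>X. ?p x y z)"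
      by (rule HH.M.finsum_cong')
        (use p cl in \<open>simp_all add: one_H_apply comult_one J_pure one_C\<close>)
    then show "(case p of (x, z) \<Rightarrow> \<lambda>h. \<Oplus>\<^bsub>HH\<^esub>y\<in>X. J x y z (\<Delta> x y z h)) (\<one>\<^bsub>H\<^esub> p)
        = (case p of (x, z) \<Rightarrow> \<Oplus>\<^bsub>HH\<^esub>y\<in>X. ?p x y z)"
      by (simp add: p(1))
  qed
  also have "\<dots> = (\<Oplus>\<^bsub>HH\<^esub>x\<in>X. \<Oplus>\<^bsub>HH\<^esub>z\<in>X. \<Oplus>\<^bsub>HH\<^esub>y\<in>X. ?p x y z)"
    by (subst HH.M.finsum_Times) (auto intro!: HH.M.finsum_closed cl finite_X)
  \<comment> \<open>The definition of \<open>D\<close> sums over source and target first; the swap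
    brings the middle object into its place along the path.\<close>
  also have "\<dots> = (\<Oplus>\<^bsub>HH\<^esub>x\<in>X. \<Oplus>\<^bsub>HH\<^esub>y\<in>X. \<Oplus>\<^bsub>HH\<^esub>z\<in>X. ?p x y z)"
    by (rule HH.M.finsum_cong') (auto intro!: HH.M.finsum_closed HH.M.finsum_swap cl finite_X)
  finally have D1: "D \<one>\<^bsub>H\<^esub> = (\<Oplus>\<^bsub>HH\<^esub>x\<in>X. \<Oplus>\<^bsub>HH\<^esub>y\<in>X. \<Oplus>\<^bsub>HH\<^esub>z\<in>X. ?p x y z)" .
  note fs = lin_hom_finsum[OF mod_HH P f]
  have z: "f (\<Oplus>\<^bsub>HH\<^esub>z\<in>X. ?p x y z) = (\<Oplus>\<^bsub>P\<^esub>z\<in>X. f (?p x y z))" if "x \<in> X" "y \<in> X" for x y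
    using that by (intro fs) (auto intro!: cl)
  have y: "f (\<Oplus>\<^bsub>HH\<^esub>y\<in>X. \<Oplus>\<^bsub>HH\<^esub>z\<in>X. ?p x y z) = (\<Oplus>\<^bsub>P\<^esub>y\<in>X. \<Oplus>\<^bsub>P\<^esub>z\<in>X. f (?p x y z))" if "x \<in> X" for x
    using that by (subst fs) (auto intro!: HH.M.finsum_closed P.M.finsum_closed P.M.finsum_cong' cl simp: z)
  show ?thesis
    unfolding D1
    by (subst fs) (auto intro!: HH.M.finsum_closed P.M.finsum_closed P.M.finsum_cong' cl simp: y)
qed

lemma tensor_lift_D_one:
  assumes P: "module R P" and \<phi>: "\<phi> \<in> bilin_hom R H H P"
  shows "tensor_lift R P \<phi> (D \<one>\<^bsub>H\<^esub>) = (\<Oplus>\<^bsub>P\<^esub>x\<in>X. \<Oplus>\<^bsub>P\<^esub>y\<in>X. \<Oplus>\<^bsub>P\<^esub>z\<in>X. \<phi> (e x y) (e y z))"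
proof -
  interpret P: module R P by (rule P)
  show ?thesis
    unfolding lin_hom_D_one[OF P tensor_lift_lin[OF mod_H mod_H P \<phi>]]
    by (auto intro!: P.M.finsum_closed P.M.finsum_cong' bilin_hom_closed[OF \<phi>] e_closed
        simp: tensor_lift_pure[OF mod_H mod_H P \<phi>] e_closed)
qed

section \<open>Coassociativity and the counit laws\<close>

lemma coassoc_left_incl:
  assumes "x \<in> X" "z \<in> X" "a \<in> carrier (C x z)"
  shows "tensor_map R HH H D (\<lambda>b. b) (D (\<iota> x z a))
    = (\<Oplus>\<^bsub>HHH\<^esub>y\<in>X. \<Oplus>\<^bsub>HHH\<^esub>u\<in>X. tensor_map R HH H (J x u y) (\<iota> y z)
        (tensor_map R (tensor R (C x u) (C u y)) (C y z) (\<Delta> x u y) (\<lambda>b. b) (\<Delta> x y z a)))"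
proof -
  let ?L = "\<lambda>y u. tensor_lift R HHH (\<lambda>b c. pure_tensor R HH H (J x u y (\<Delta> x u y b)) (\<iota> y z c)) (\<Delta> x y z a)"
  note p = pure_tensor_bilin[OF mod_HH mod_H]
  have bil: "(\<lambda>b c. pure_tensor R HH H (J x u y (\<Delta> x u y b)) (\<iota> y z c)) \<in> bilin_hom R (C x y) (C y z) HHH"
    if "y \<in> X" "u \<in> X" for y u
    using assms that by (intro bilin_hom_comp2[OF p] lin_hom_comp[OF comult_lin J_lin] incl_lin)
  \<comment> \<open>Factoring through \<open>\<Delta> x u y\<close> exposes one side of the
    coassociativity law of \<open>C\<close> inside an inclusion.\<close>
  have L: "?L y u = tensor_map R HH H (J x u y) (\<iota> y z)
        (tensor_map R (tensor R (C x u) (C u y)) (C y z) (\<Delta> x u y) (\<lambda>b. b) (\<Delta> x y z a))"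
    if "y \<in> X" "u \<in> X" for y u
    unfolding tensor_map_def[of R HH H] using assms that
    by (intro tensor_lift_map[where M = "C x y" and N = "C y z", symmetric] tensor_map_bilin mod_C mod_H mod_HH mod_HHH module_tensor
        comult_lin lin_hom_id comult_closed J_lin incl_lin)
  have closed: "?L y u \<in> carrier HHH" if "y \<in> X" "u \<in> X" for y u
    using assms that
    by (intro lin_hom_closed[OF tensor_lift_lin[OF mod_C mod_C mod_HHH bil]] comult_closed)
  have "tensor_map R HH H D (\<lambda>b. b) (D (\<iota> x z a))
      = (\<Oplus>\<^bsub>HHH\<^esub>y\<in>X. tensor_lift R HHH (\<lambda>b c. pure_tensor R HH H (D (\<iota> x y b)) (\<iota> y z c)) (\<Delta> x y z a))"
    unfolding tensor_map_def
    by (rule tensor_lift_D_incl[OF mod_HHH tensor_map_bilin[OF mod_H mod_H mod_HH mod_H D_lin lin_hom_id] assms])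
  also have "\<dots> = (\<Oplus>\<^bsub>HHH\<^esub>y\<in>X. \<Oplus>\<^bsub>HHH\<^esub>u\<in>X. ?L y u)"
  proof (rule HHH.M.finsum_cong'[OF refl])
    show "(\<lambda>y. \<Oplus>\<^bsub>HHH\<^esub>u\<in>X. ?L y u) \<in> X \<rightarrow> carrier HHH"
      by (intro Pi_I HHH.M.finsum_closed closed)
    fix y assume y: "y \<in> X"
    \<comment> \<open>The comultiplication of the first leg is itself a sum, over a new object
      \<open>u\<close>. It passes through the pure tensor here and through the lift in the next
      step.\<close>
    have "tensor_lift R HHH (\<lambda>b c. pure_tensor R HH H (D (\<iota> x y b)) (\<iota> y z c)) (\<Delta> x y z a)
      = tensor_lift R HHH (\<lambda>b c. \<Oplus>\<^bsub>HHH\<^esub>u\<in>X. pure_tensor R HH H (J x u y (\<Delta> x u y b)) (\<iota> y z c)) (\<Delta> x y z a)"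
    proof (rule tensor_lift_cong)
      fix b c assume b: "b \<in> carrier (C x y)" and c: "c \<in> carrier (C y z)"
      have c': "\<iota> y z c \<in> carrier H" using assms y c by (intro incl_closed)
      have "(\<lambda>u. J x u y (\<Delta> x u y b)) \<in> X \<rightarrow> carrier HH"
        using assms y b by (intro Pi_I J_comult_closed)
      from lin_hom_finsum[OF mod_HH mod_HHH bilin_hom_left[OF p c'] this]
      show "pure_tensor R HH H (D (\<iota> x y b)) (\<iota> y z c)
          = (\<Oplus>\<^bsub>HHH\<^esub>u\<in>X. pure_tensor R HH H (J x u y (\<Delta> x u y b)) (\<iota> y z c))"
        using assms y b by (simp add: D_incl)
    qed (use assms y in \<open>auto intro!: mod_C mod_HHH comult_closed bilin_hom_sum bil\<close>)
    also have "\<dots> = (\<Oplus>\<^bsub>HHH\<^esub>u\<in>X. ?L y u)"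
      using assms y by (intro tensor_lift_sum[where M = "C x y" and N = "C y z"] mod_C mod_HHH bil comult_closed)
    finally show "tensor_lift R HHH (\<lambda>b c. pure_tensor R HH H (D (\<iota> x y b)) (\<iota> y z c)) (\<Delta> x y z a)
      = (\<Oplus>\<^bsub>HHH\<^esub>u\<in>X. ?L y u)" .
  qed
  also have "\<dots> = (\<Oplus>\<^bsub>HHH\<^esub>y\<in>X. \<Oplus>\<^bsub>HHH\<^esub>u\<in>X. tensor_map R HH H (J x u y) (\<iota> y z)
        (tensor_map R (tensor R (C x u) (C u y)) (C y z) (\<Delta> x u y) (\<lambda>b. b) (\<Delta> x y z a)))"
    using closed by (intro HHH.M.finsum_cong') (simp_all add: L)
  finally show ?thesis .
qed

text \<open>The right bracketing, in which the second side of coassociativity is computed before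
  \<open>tensor_assoc\<close> is applied.\<close>

abbreviation "HHH' \<equiv> tensor R H HH"

lemma mod_HHH': "module R HHH'" by (rule module_tensor[OF mod_H mod_HH])

sublocale HHH': module R HHH' by (rule mod_HHH')

text \<open>Here the path from \<open>x\<close> to \<open>z\<close> is cut first at \<open>u\<close>
  and then at \<open>y\<close>, while \<open>coassoc_left_incl\<close> cuts at \<open>y\<close>
  first. The letters are chosen so that equal pairs name the same instance of coassociativity in
  \<open>C\<close>; only the order of summation differs.\<close>

lemma coassoc_right_incl:
  assumes "x \<in> X" "z \<in> X" "a \<in> carrier (C x z)"
  shows "tensor_map R H HH (\<lambda>b. b) D (D (\<iota> x z a))
    = (\<Oplus>\<^bsub>HHH'\<^esub>u\<in>X. \<Oplus>\<^bsub>HHH'\<^esub>y\<in>X. tensor_map R H HH (\<iota> x u) (J u y z)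
        (tensor_map R (C x u) (tensor R (C u y) (C y z)) (\<lambda>b. b) (\<Delta> u y z) (\<Delta> x u z a)))"
proof -
  let ?L = "\<lambda>u y. tensor_lift R HHH' (\<lambda>b c. pure_tensor R H HH (\<iota> x u b) (J u y z (\<Delta> u y z c))) (\<Delta> x u z a)"
  note p = pure_tensor_bilin[OF mod_H mod_HH]
  have bil: "(\<lambda>b c. pure_tensor R H HH (\<iota> x u b) (J u y z (\<Delta> u y z c))) \<in> bilin_hom R (C x u) (C u z) HHH'"
    if "u \<in> X" "y \<in> X" for y u
    using assms that by (intro bilin_hom_comp2[OF p] lin_hom_comp[OF comult_lin J_lin] incl_lin)
  have L: "?L u y = tensor_map R H HH (\<iota> x u) (J u y z)
        (tensor_map R (C x u) (tensor R (C u y) (C y z)) (\<lambda>b. b) (\<Delta> u y z) (\<Delta> x u z a))"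
    if "u \<in> X" "y \<in> X" for y u
    unfolding tensor_map_def[of R H HH] using assms that
    by (intro tensor_lift_map[where M = "C x u" and N = "C u z", symmetric] tensor_map_bilin mod_C mod_H mod_HH mod_HHH' module_tensor
        comult_lin lin_hom_id comult_closed J_lin incl_lin)
  have closed: "?L u y \<in> carrier HHH'" if "u \<in> X" "y \<in> X" for y u
    using assms that
    by (intro lin_hom_closed[OF tensor_lift_lin[OF mod_C mod_C mod_HHH' bil]] comult_closed)
  have "tensor_map R H HH (\<lambda>b. b) D (D (\<iota> x z a))
      = (\<Oplus>\<^bsub>HHH'\<^esub>u\<in>X. tensor_lift R HHH' (\<lambda>b c. pure_tensor R H HH (\<iota> x u b) (D (\<iota> u z c))) (\<Delta> x u z a))"
    unfolding tensor_map_def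
    by (rule tensor_lift_D_incl[OF mod_HHH' tensor_map_bilin[OF mod_H mod_H mod_H mod_HH lin_hom_id D_lin] assms])
  also have "\<dots> = (\<Oplus>\<^bsub>HHH'\<^esub>u\<in>X. \<Oplus>\<^bsub>HHH'\<^esub>y\<in>X. ?L u y)"
  proof (rule HHH'.M.finsum_cong'[OF refl])
    show "(\<lambda>u. \<Oplus>\<^bsub>HHH'\<^esub>y\<in>X. ?L u y) \<in> X \<rightarrow> carrier HHH'"
      by (intro Pi_I HHH'.M.finsum_closed closed)
    fix u assume u: "u \<in> X"
    have "tensor_lift R HHH' (\<lambda>b c. pure_tensor R H HH (\<iota> x u b) (D (\<iota> u z c))) (\<Delta> x u z a)
      = tensor_lift R HHH' (\<lambda>b c. \<Oplus>\<^bsub>HHH'\<^esub>y\<in>X. pure_tensor R H HH (\<iota> x u b) (J u y z (\<Delta> u y z c))) (\<Delta> x u z a)"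
    proof (rule tensor_lift_cong)
      fix b c assume b: "b \<in> carrier (C x u)" and c: "c \<in> carrier (C u z)"
      have b': "\<iota> x u b \<in> carrier H" using assms u b by (intro incl_closed)
      have "(\<lambda>y. J u y z (\<Delta> u y z c)) \<in> X \<rightarrow> carrier HH"
        using assms u c by (intro Pi_I J_comult_closed)
      from lin_hom_finsum[OF mod_HH mod_HHH' bilin_hom_right[OF p b'] this]
      show "pure_tensor R H HH (\<iota> x u b) (D (\<iota> u z c))
          = (\<Oplus>\<^bsub>HHH'\<^esub>y\<in>X. pure_tensor R H HH (\<iota> x u b) (J u y z (\<Delta> u y z c)))"
        using assms u c by (simp add: D_incl)
    qed (use assms u in \<open>auto intro!: mod_C mod_HHH' comult_closed bilin_hom_sum bil\<close>)
    also have "\<dots> = (\<Oplus>\<^bsub>HHH'\<^esub>y\<in>X. ?L u y)"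
      using assms u by (intro tensor_lift_sum[where M = "C x u" and N = "C u z"] mod_C mod_HHH' bil comult_closed)
    finally show "tensor_lift R HHH' (\<lambda>b c. pure_tensor R H HH (\<iota> x u b) (D (\<iota> u z c))) (\<Delta> x u z a)
      = (\<Oplus>\<^bsub>HHH'\<^esub>y\<in>X. ?L u y)" .
  qed
  also have "\<dots> = (\<Oplus>\<^bsub>HHH'\<^esub>u\<in>X. \<Oplus>\<^bsub>HHH'\<^esub>y\<in>X. tensor_map R H HH (\<iota> x u) (J u y z)
        (tensor_map R (C x u) (tensor R (C u y) (C y z)) (\<lambda>b. b) (\<Delta> u y z) (\<Delta> x u z a)))"
    using closed by (intro HHH'.M.finsum_cong') (simp_all add: L)
  finally show ?thesis .
qed

text \<open>For each path through \<open>x\<close>, \<open>u\<close>, \<open>y\<close>,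
  \<open>z\<close> the two summands agree by the coassociativity of \<open>C\<close>, carried along
  the inclusions by \<open>tensor_assoc_natural\<close>. Exchanging the two sums then
  finishes.\<close>

lemma total_coassoc:
  assumes h: "h \<in> carrier H"
  shows "tensor_map R HH H D (\<lambda>b. b) (D h) = tensor_assoc R H H H (tensor_map R H HH (\<lambda>a. a) D (D h))"
proof (rule lin_hom_total_eqI[OF mod_HHH _ _ _ h])
  note assoc = tensor_assoc_lin[OF mod_H mod_H mod_H]
  show "(\<lambda>h. tensor_map R HH H D (\<lambda>b. b) (D h)) \<in> lin_hom R H HHH"
    by (rule lin_hom_comp[OF D_lin tensor_map_lin[OF mod_H mod_H mod_HH mod_H D_lin lin_hom_id]])
  show "(\<lambda>h. tensor_assoc R H H H (tensor_map R H HH (\<lambda>a. a) D (D h))) \<in> lin_hom R H HHH"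
    by (rule lin_hom_comp[OF lin_hom_comp[OF D_lin
            tensor_map_lin[OF mod_H mod_H mod_H mod_HH lin_hom_id D_lin]] assoc])
  fix x z a assume a: "x \<in> X" "z \<in> X" "a \<in> carrier (C x z)"
  let ?r = "\<lambda>u y. tensor_map R (C x u) (tensor R (C u y) (C y z)) (\<lambda>b. b) (\<Delta> u y z) (\<Delta> x u z a)"
  let ?l = "\<lambda>u y. tensor_map R (tensor R (C x u) (C u y)) (C y z) (\<Delta> x u y) (\<lambda>b. b) (\<Delta> x y z a)"
  let ?R = "\<lambda>u y. tensor_map R H HH (\<iota> x u) (J u y z) (?r u y)"
  let ?L = "\<lambda>u y. tensor_map R HH H (J x u y) (\<iota> y z) (?l u y)"
  have r: "?r u y \<in> carrier (tensor R (C x u) (tensor R (C u y) (C y z)))" if "u \<in> X" "y \<in> X" for u y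
    using a that by (intro tensor_map_closed[where M = "C x u" and N = "C u z"] mod_C module_tensor lin_hom_id comult_lin comult_closed)
  have l: "?l u y \<in> carrier (tensor R (tensor R (C x u) (C u y)) (C y z))" if "u \<in> X" "y \<in> X" for u y
    using a that by (intro tensor_map_closed[where M = "C x y" and N = "C y z"] mod_C module_tensor lin_hom_id comult_lin comult_closed)
  have L: "?L u y \<in> carrier HHH" if "u \<in> X" "y \<in> X" for u y
    using a that by (intro tensor_map_closed[where M = "tensor R (C x u) (C u y)" and N = "C y z"] mod_C mod_H mod_HH module_tensor incl_lin J_lin l)
  have R: "?R u y \<in> carrier HHH'" if "u \<in> X" "y \<in> X" for u y
    using a that by (intro tensor_map_closed[where M = "C x u" and N = "tensor R (C u y) (C y z)"] mod_C mod_H mod_HH module_tensor incl_lin J_lin r)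
  have RL: "tensor_assoc R H H H (?R u y) = ?L u y" if "u \<in> X" "y \<in> X" for u y
  proof -
    have "tensor_assoc R H H H (?R u y)
        = tensor_map R HH H (J x u y) (\<iota> y z) (tensor_assoc R (C x u) (C u y) (C y z) (?r u y))"
      unfolding J_def using a that
      by (intro tensor_assoc_natural mod_C mod_H incl_lin r)
    also have "\<dots> = ?L u y"
      using a that by (simp add: coassoc)
    finally show ?thesis .
  qed
  have Rs: "(\<Oplus>\<^bsub>HHH'\<^esub>y\<in>X. ?R u y) \<in> carrier HHH'" if "u \<in> X" for u
    using that by (intro HHH'.M.finsum_closed Pi_I R)
  have "tensor_assoc R H H H (tensor_map R H HH (\<lambda>a. a) D (D (\<iota> x z a)))
      = (\<Oplus>\<^bsub>HHH\<^esub>u\<in>X. tensor_assoc R H H H (\<Oplus>\<^bsub>HHH'\<^esub>y\<in>X. ?R u y))"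
    unfolding coassoc_right_incl[OF a]
    using Rs by (intro lin_hom_finsum[OF mod_HHH' mod_HHH assoc]) auto
  also have "\<dots> = (\<Oplus>\<^bsub>HHH\<^esub>u\<in>X. \<Oplus>\<^bsub>HHH\<^esub>y\<in>X. ?L u y)"
  proof (rule HHH.M.finsum_cong'[OF refl])
    show "(\<lambda>u. \<Oplus>\<^bsub>HHH\<^esub>y\<in>X. ?L u y) \<in> X \<rightarrow> carrier HHH"
      by (intro Pi_I HHH.M.finsum_closed L)
    fix u assume u: "u \<in> X"
    have "tensor_assoc R H H H (\<Oplus>\<^bsub>HHH'\<^esub>y\<in>X. ?R u y) = (\<Oplus>\<^bsub>HHH\<^esub>y\<in>X. tensor_assoc R H H H (?R u y))"
      using u R by (intro lin_hom_finsum[OF mod_HHH' mod_HHH assoc]) auto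
    also have "\<dots> = (\<Oplus>\<^bsub>HHH\<^esub>y\<in>X. ?L u y)"
      using u L by (intro HHH.M.finsum_cong') (simp_all add: RL)
    finally show "tensor_assoc R H H H (\<Oplus>\<^bsub>HHH'\<^esub>y\<in>X. ?R u y) = (\<Oplus>\<^bsub>HHH\<^esub>y\<in>X. ?L u y)" .
  qed
  also have "\<dots> = (\<Oplus>\<^bsub>HHH\<^esub>y\<in>X. \<Oplus>\<^bsub>HHH\<^esub>u\<in>X. ?L u y)"
    by (rule HHH.M.finsum_swap[OF finite_X L])
  also have "\<dots> = tensor_map R HH H D (\<lambda>b. b) (D (\<iota> x z a))"
    by (rule coassoc_left_incl[OF a, symmetric])
  finally show "tensor_map R HH H D (\<lambda>b. b) (D (\<iota> x z a))
      = tensor_assoc R H H H (tensor_map R H HH (\<lambda>a. a) D (D (\<iota> x z a)))" by (rule sym)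
qed

text \<open>The surviving middle object is \<open>x\<close>. There \<open>\<iota> x z\<close> is
  pulled out of the lift and leaves the left counit law of \<open>C\<close>.\<close>

lemma total_counit_left:
  assumes h: "h \<in> carrier H"
  shows "tensor_lift R H (\<lambda>a b. E a \<odot>\<^bsub>H\<^esub> b) (D h) = h"
proof (rule lin_hom_total_eqI[OF mod_H _ lin_hom_id _ h])
  have bil: "(\<lambda>a b. E a \<odot>\<^bsub>H\<^esub> b) \<in> bilin_hom R H H H"
    by (rule bilin_hom_comp2[OF smult_bilin[OF mod_H] E_lin lin_hom_id])
  show "(\<lambda>h. tensor_lift R H (\<lambda>a b. E a \<odot>\<^bsub>H\<^esub> b) (D h)) \<in> lin_hom R H H"
    by (rule lin_hom_comp[OF D_lin tensor_lift_lin[OF mod_H mod_H mod_H bil]])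
  fix x z a assume a: "x \<in> X" "z \<in> X" "a \<in> carrier (C x z)"
  let ?f = "\<lambda>y. tensor_lift R H (\<lambda>b c. E (\<iota> x y b) \<odot>\<^bsub>H\<^esub> \<iota> y z c) (\<Delta> x y z a)"
  have bil': "(\<lambda>b c. \<epsilon> x b \<odot>\<^bsub>C x z\<^esub> c) \<in> bilin_hom R (C x x) (C x z) (C x z)"
    using a by (intro bilin_hom_comp2[OF smult_bilin] mod_C eps_lin lin_hom_id)
  have "?f x = tensor_lift R H (\<lambda>b c. \<iota> x z (\<epsilon> x b \<odot>\<^bsub>C x z\<^esub> c)) (\<Delta> x x z a)"
  proof (rule tensor_lift_cong)
    show "(\<lambda>b c. \<iota> x z (\<epsilon> x b \<odot>\<^bsub>C x z\<^esub> c)) \<in> bilin_hom R (C x x) (C x z) H"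
      using a by (intro bilin_hom_comp[OF bil'] incl_lin)
  qed (use a in \<open>simp_all add: mod_C mod_H comult_closed E_incl lin_hom_smult[OF incl_lin] eps_closed\<close>)
  also have "\<dots> = \<iota> x z (tensor_lift R (C x z) (\<lambda>b c. \<epsilon> x b \<odot>\<^bsub>C x z\<^esub> c) (\<Delta> x x z a))"
    using a by (intro lin_hom_tensor_lift[where M = "C x x" and N = "C x z", symmetric] mod_C mod_H incl_lin comult_closed bilin_hom_closed[OF bil'])
  also have "\<dots> = \<iota> x z a" using a by (simp add: counit_left)
  finally have fx: "?f x = \<iota> x z a" .
  have f0: "?f y = \<zero>\<^bsub>H\<^esub>" if "y \<in> X" "y \<noteq> x" for y
    using a that by (intro tensor_lift_eq_zero[where M = "C x y" and N = "C y z"] mod_C mod_H comult_closed) (simp_all add: E_incl incl_closed)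
  have "(\<Oplus>\<^bsub>H\<^esub>y\<in>X. ?f y) = \<iota> x z a"
    using a f0 by (subst H.M.finsum_single[OF finite_X a(1)]) (simp_all add: fx incl_closed)
  then show "tensor_lift R H (\<lambda>a b. E a \<odot>\<^bsub>H\<^esub> b) (D (\<iota> x z a)) = \<iota> x z a"
    using tensor_lift_D_incl[OF mod_H bil a] by simp
qed

text \<open>Mirror image of \<open>total_counit_left\<close>: the second leg must lie on the
  diagonal, so the surviving middle object is \<open>z\<close>.\<close>

lemma total_counit_right:
  assumes h: "h \<in> carrier H"
  shows "tensor_lift R H (\<lambda>a b. E b \<odot>\<^bsub>H\<^esub> a) (D h) = h"
proof (rule lin_hom_total_eqI[OF mod_H _ lin_hom_id _ h])
  have bil: "(\<lambda>a b. E b \<odot>\<^bsub>H\<^esub> a) \<in> bilin_hom R H H H"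
    by (rule bilin_hom_flip[OF bilin_hom_comp2[OF smult_bilin[OF mod_H] E_lin lin_hom_id]])
  show "(\<lambda>h. tensor_lift R H (\<lambda>a b. E b \<odot>\<^bsub>H\<^esub> a) (D h)) \<in> lin_hom R H H"
    by (rule lin_hom_comp[OF D_lin tensor_lift_lin[OF mod_H mod_H mod_H bil]])
  fix x z a assume a: "x \<in> X" "z \<in> X" "a \<in> carrier (C x z)"
  let ?f = "\<lambda>y. tensor_lift R H (\<lambda>b c. E (\<iota> y z c) \<odot>\<^bsub>H\<^esub> \<iota> x y b) (\<Delta> x y z a)"
  have bil': "(\<lambda>b c. \<epsilon> z c \<odot>\<^bsub>C x z\<^esub> b) \<in> bilin_hom R (C x z) (C z z) (C x z)"
    using a by (intro bilin_hom_flip[OF bilin_hom_comp2[OF smult_bilin]] mod_C eps_lin lin_hom_id)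
  have "?f z = tensor_lift R H (\<lambda>b c. \<iota> x z (\<epsilon> z c \<odot>\<^bsub>C x z\<^esub> b)) (\<Delta> x z z a)"
  proof (rule tensor_lift_cong)
    show "(\<lambda>b c. \<iota> x z (\<epsilon> z c \<odot>\<^bsub>C x z\<^esub> b)) \<in> bilin_hom R (C x z) (C z z) H"
      using a by (intro bilin_hom_comp[OF bil'] incl_lin)
  qed (use a in \<open>simp_all add: mod_C mod_H comult_closed E_incl lin_hom_smult[OF incl_lin] eps_closed\<close>)
  also have "\<dots> = \<iota> x z (tensor_lift R (C x z) (\<lambda>b c. \<epsilon> z c \<odot>\<^bsub>C x z\<^esub> b) (\<Delta> x z z a))"
    using a by (intro lin_hom_tensor_lift[where M = "C x z" and N = "C z z", symmetric] mod_C mod_H incl_lin comult_closed bilin_hom_closed[OF bil'])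
  also have "\<dots> = \<iota> x z a" using a by (simp add: counit_right)
  finally have fx: "?f z = \<iota> x z a" .
  have f0: "?f y = \<zero>\<^bsub>H\<^esub>" if "y \<in> X" "y \<noteq> z" for y
    using a that by (intro tensor_lift_eq_zero[where M = "C x y" and N = "C y z"] mod_C mod_H comult_closed) (simp_all add: E_incl incl_closed)
  have "(\<Oplus>\<^bsub>H\<^esub>y\<in>X. ?f y) = \<iota> x z a"
    using a f0 by (subst H.M.finsum_single[OF finite_X a(2)]) (simp_all add: fx incl_closed)
  then show "tensor_lift R H (\<lambda>a b. E b \<odot>\<^bsub>H\<^esub> a) (D (\<iota> x z a)) = \<iota> x z a"
    using tensor_lift_D_incl[OF mod_H bil a] by simp
qed

section \<open>Multiplicativity of the comultiplication\<close>

lemma mult_HH: "mult HH \<in> bilin_hom R HH HH HH"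
  by (rule tensor_mult_bilin[OF mod_H mod_H H.mult_bilin H.mult_bilin])

lemma mult_HHH: "mult HHH \<in> bilin_hom R HHH HHH HHH"
  by (rule tensor_mult_bilin[OF mod_HH mod_H mult_HH H.mult_bilin])

lemma J_mult_bilin:
  assumes "x \<in> X" "y \<in> X" "z \<in> X" "x' \<in> X" "y' \<in> X" "z' \<in> X"
  shows "(\<lambda>s t. J x y z s \<otimes>\<^bsub>HH\<^esub> J x' y' z' t)
    \<in> bilin_hom R (tensor R (C x y) (C y z)) (tensor R (C x' y') (C y' z')) HH"
  using assms by (intro bilin_hom_comp2[OF mult_HH] J_lin)

lemma J_mult:
  assumes "x \<in> X" "y \<in> X" "z \<in> X"
    and s: "s \<in> carrier (tensor R (C x y) (C y z))" and t: "t \<in> carrier (tensor R (C x y) (C y z))"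
  shows "J x y z s \<otimes>\<^bsub>HH\<^esub> J x y z t = J x y z (s \<otimes>\<^bsub>tensor R (C x y) (C y z)\<^esub> t)"
proof (rule bilin_hom_tensor_eqI[OF mod_C mod_C mod_C mod_C mod_HH J_mult_bilin _ _ s t])
  note tm = tensor_mult_bilin[OF mod_C[OF assms(1,2)] mod_C[OF assms(2,3)]
      mult_C_bilin[OF assms(1,2)] mult_C_bilin[OF assms(2,3)]]
  show "(\<lambda>s t. J x y z (s \<otimes>\<^bsub>tensor R (C x y) (C y z)\<^esub> t))
      \<in> bilin_hom R (tensor R (C x y) (C y z)) (tensor R (C x y) (C y z)) HH"
    using assms by (intro bilin_hom_comp[OF tm] J_lin)
qed (use assms in \<open>simp_all add: J_pure mult_C incl_mult incl_closed mod_C mult_C_bilin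
    tensor_mult_pure[OF mod_H mod_H H.mult_bilin H.mult_bilin] tensor_mult_pure\<close>)

text \<open>A mismatch in \<open>x\<close> or \<open>y\<close> kills the first tensor factor, one in
  \<open>y\<close> or \<open>z\<close> the second. That the middle object counts as well is what
  makes the double sum in \<open>total_comult_mult\<close> diagonal.\<close>

lemma J_mult_zero:
  assumes "x \<in> X" "y \<in> X" "z \<in> X" "x' \<in> X" "y' \<in> X" "z' \<in> X"
    and ne: "x \<noteq> x' \<or> y \<noteq> y' \<or> z \<noteq> z'"
    and s: "s \<in> carrier (tensor R (C x y) (C y z))" and t: "t \<in> carrier (tensor R (C x' y') (C y' z'))"
  shows "J x y z s \<otimes>\<^bsub>HH\<^esub> J x' y' z' t = \<zero>\<^bsub>HH\<^esub>"
proof (rule bilin_hom_tensor_eqI[OF mod_C mod_C mod_C mod_C mod_HH J_mult_bilin bilin_hom_const_zero[OF mod_HH] _ s t])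
  fix a b a' b' assume ab: "a \<in> carrier (C x y)" "b \<in> carrier (C y z)"
    "a' \<in> carrier (C x' y')" "b' \<in> carrier (C y' z')"
  have "\<iota> x y a \<otimes>\<^bsub>H\<^esub> \<iota> x' y' a' = \<zero>\<^bsub>H\<^esub> \<or> \<iota> y z b \<otimes>\<^bsub>H\<^esub> \<iota> y' z' b' = \<zero>\<^bsub>H\<^esub>"
    using ne assms ab incl_mult_zero by metis
  then have "pure_tensor R H H (\<iota> x y a \<otimes>\<^bsub>H\<^esub> \<iota> x' y' a') (\<iota> y z b \<otimes>\<^bsub>H\<^esub> \<iota> y' z' b') = \<zero>\<^bsub>HH\<^esub>"
    using assms ab by (auto simp only: pure_tensor_zero[OF mod_H mod_H] H.m_closed incl_closed)
  then show "J x y z (pure_tensor R (C x y) (C y z) a b) \<otimes>\<^bsub>HH\<^esub>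
      J x' y' z' (pure_tensor R (C x' y') (C y' z') a' b') = \<zero>\<^bsub>HH\<^esub>"
    using assms ab by (simp add: J_pure incl_closed tensor_mult_pure[OF mod_H mod_H H.mult_bilin H.mult_bilin])
qed (use assms in simp_all)

text \<open>Both arguments are reduced to summands. Cross terms with different middle objects
  vanish, and the term at a common \<open>y\<close> is the multiplicativity of
  \<open>\<Delta> x y z\<close>.\<close>

lemma total_comult_mult:
  assumes h: "h \<in> carrier H" and l: "l \<in> carrier H"
  shows "D (h \<otimes>\<^bsub>H\<^esub> l) = D h \<otimes>\<^bsub>HH\<^esub> D l"
proof (rule lin_hom_total_eqI[OF mod_HH _ _ _ h])
  have bil: "(\<lambda>h l. D h \<otimes>\<^bsub>HH\<^esub> D l) \<in> bilin_hom R H H HH"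
    by (rule bilin_hom_comp2[OF mult_HH D_lin D_lin])
  have bil': "(\<lambda>h l. D (h \<otimes>\<^bsub>H\<^esub> l)) \<in> bilin_hom R H H HH"
    by (rule bilin_hom_comp[OF H.mult_bilin D_lin])
  show "(\<lambda>h. D (h \<otimes>\<^bsub>H\<^esub> l)) \<in> lin_hom R H HH" "(\<lambda>h. D h \<otimes>\<^bsub>HH\<^esub> D l) \<in> lin_hom R H HH"
    using bilin_hom_left[OF bil l] bilin_hom_left[OF bil' l] by auto
  fix x z a assume a: "x \<in> X" "z \<in> X" "a \<in> carrier (C x z)"
  note ia = incl_closed[OF a]
  show "D (\<iota> x z a \<otimes>\<^bsub>H\<^esub> l) = D (\<iota> x z a) \<otimes>\<^bsub>HH\<^esub> D l"
  proof (rule lin_hom_total_eqI[OF mod_HH bilin_hom_right[OF bil' ia] bilin_hom_right[OF bil ia] _ l])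
    fix x' z' b assume b: "x' \<in> X" "z' \<in> X" "b \<in> carrier (C x' z')"
    let ?P = "\<lambda>y y'. J x y z (\<Delta> x y z a) \<otimes>\<^bsub>HH\<^esub> J x' y' z' (\<Delta> x' y' z' b)"
    have prod: "D (\<iota> x z a) \<otimes>\<^bsub>HH\<^esub> D (\<iota> x' z' b) = (\<Oplus>\<^bsub>HH\<^esub>y\<in>X. \<Oplus>\<^bsub>HH\<^esub>y'\<in>X. ?P y y')"
      unfolding D_incl[OF a] D_incl[OF b] using a b
      by (intro bilin_hom_finsum[OF mod_HH mod_HH mod_HH mult_HH] Pi_I J_comult_closed)
    have zero: "?P y y' = \<zero>\<^bsub>HH\<^esub>" if "y \<in> X" "y' \<in> X" "x \<noteq> x' \<or> y \<noteq> y' \<or> z \<noteq> z'" for y y'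
      using a b that by (intro J_mult_zero comult_closed)
    show "D (\<iota> x z a \<otimes>\<^bsub>H\<^esub> \<iota> x' z' b) = D (\<iota> x z a) \<otimes>\<^bsub>HH\<^esub> D (\<iota> x' z' b)"
    proof (cases "x = x' \<and> z = z'")
      case False
      then have "D (\<iota> x z a \<otimes>\<^bsub>H\<^esub> \<iota> x' z' b) = \<zero>\<^bsub>HH\<^esub>"
        using a b by (subst incl_mult_zero) (auto simp: lin_hom_zero[OF mod_H mod_HH D_lin])
      moreover have "(\<Oplus>\<^bsub>HH\<^esub>y\<in>X. \<Oplus>\<^bsub>HH\<^esub>y'\<in>X. ?P y y') = \<zero>\<^bsub>HH\<^esub>"
        by (intro HH.M.finsum_all_zero zero) (use False in auto)
      ultimately show ?thesis unfolding prod by simp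
    next
      case True
      have diag: "(\<Oplus>\<^bsub>HH\<^esub>y'\<in>X. ?P y y') = J x y z (\<Delta> x y z (a \<otimes>\<^bsub>C x z\<^esub> b))" if y: "y \<in> X" for y
      proof -
        have "?P y y = J x y z (\<Delta> x y z (a \<otimes>\<^bsub>C x z\<^esub> b))"
          using a b y True by (simp add: J_mult comult_closed comult_mult)
        moreover have "?P y y \<in> carrier HH"
          using a b y by (intro bilin_hom_closed[OF mult_HH] J_comult_closed)
        ultimately show ?thesis
          using zero[OF y] by (subst HH.M.finsum_single[OF finite_X y]) auto
      qed
      have ab: "a \<otimes>\<^bsub>C x z\<^esub> b \<in> carrier (C x z)" using a b True by (simp add: mult_C)
      have "(\<Oplus>\<^bsub>HH\<^esub>y\<in>X. \<Oplus>\<^bsub>HH\<^esub>y'\<in>X. ?P y y') = D (\<iota> x z (a \<otimes>\<^bsub>C x z\<^esub> b))"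
        unfolding D_incl[OF a(1,2) ab]
        by (rule HH.M.finsum_cong') (use diag a ab J_comult_closed in auto)
      then show ?thesis
        unfolding prod using a b True by (simp add: incl_mult)
    qed
  qed
qed

section \<open>The comultiplication of the unit\<close>

definition e3 where
  "e3 x u y z = pure_tensor R HH H (pure_tensor R H H (e x u) (e u y)) (e y z)"

lemma e3_closed: "\<lbrakk>x \<in> X; u \<in> X; y \<in> X; z \<in> X\<rbrakk> \<Longrightarrow> e3 x u y z \<in> carrier HHH"
  unfolding e3_def by (intro pure_tensor_closed mod_HH mod_H e_closed)

lemma D_e:
  assumes "x \<in> X" "y \<in> X"
  shows "D (e x y) = (\<Oplus>\<^bsub>HH\<^esub>u\<in>X. pure_tensor R H H (e x u) (e u y))"
  unfolding D_incl[OF assms one_C[OF assms]] using assms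
  by (intro HH.M.finsum_cong' refl Pi_I pure_tensor_closed mod_H e_closed)
    (simp_all add: comult_one J_pure one_C)

text \<open>Comultiplying the first leg of \<open>e x y \<otimes> e y z\<close> inserts an object
  \<open>u\<close> between \<open>x\<close> and \<open>y\<close>, so the result runs over composable
  triples. The sums are put in the order in which \<open>D_one_product\<close> delivers
  them.\<close>

lemma D_one_iterated:
  "tensor_map R HH H D (\<lambda>b. b) (D \<one>\<^bsub>H\<^esub>) = (\<Oplus>\<^bsub>HHH\<^esub>x\<in>X. \<Oplus>\<^bsub>HHH\<^esub>u\<in>X. \<Oplus>\<^bsub>HHH\<^esub>y\<in>X. \<Oplus>\<^bsub>HHH\<^esub>z\<in>X. e3 x u y z)"
proof -
  note tm = tensor_map_lin[OF mod_H mod_H mod_HH mod_H D_lin lin_hom_id]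
  note closed = e3_closed HHH.M.finsum_closed Pi_I
  have eq: "tensor_map R HH H D (\<lambda>b. b) (pure_tensor R H H (e x y) (e y z)) = (\<Oplus>\<^bsub>HHH\<^esub>u\<in>X. e3 x u y z)"
    if "x \<in> X" "y \<in> X" "z \<in> X" for x y z
  proof -
    have "tensor_map R HH H D (\<lambda>b. b) (pure_tensor R H H (e x y) (e y z))
        = pure_tensor R HH H (\<Oplus>\<^bsub>HH\<^esub>u\<in>X. pure_tensor R H H (e x u) (e u y)) (e y z)"
      using that by (simp add: tensor_map_pure[OF mod_H mod_H mod_HH mod_H D_lin lin_hom_id] e_closed D_e)
    also have "\<dots> = (\<Oplus>\<^bsub>HHH\<^esub>u\<in>X. e3 x u y z)"
      unfolding e3_def using that
      by (intro lin_hom_finsum[OF mod_HH mod_HHH bilin_hom_left[OF pure_tensor_bilin[OF mod_HH mod_H]]]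
          e_closed Pi_I pure_tensor_closed mod_H)
    finally show ?thesis .
  qed
  have "tensor_map R HH H D (\<lambda>b. b) (D \<one>\<^bsub>H\<^esub>) = (\<Oplus>\<^bsub>HHH\<^esub>x\<in>X. \<Oplus>\<^bsub>HHH\<^esub>y\<in>X. \<Oplus>\<^bsub>HHH\<^esub>z\<in>X. \<Oplus>\<^bsub>HHH\<^esub>u\<in>X. e3 x u y z)"
    unfolding lin_hom_D_one[OF mod_HHH tm]
    by (intro HHH.M.finsum_cong' refl closed) (simp_all add: eq)
  also have "\<dots> = (\<Oplus>\<^bsub>HHH\<^esub>x\<in>X. \<Oplus>\<^bsub>HHH\<^esub>u\<in>X. \<Oplus>\<^bsub>HHH\<^esub>y\<in>X. \<Oplus>\<^bsub>HHH\<^esub>z\<in>X. e3 x u y z)"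
  proof (rule HHH.M.finsum_cong'[OF refl])
    fix x assume x: "x \<in> X"
    have "(\<Oplus>\<^bsub>HHH\<^esub>y\<in>X. \<Oplus>\<^bsub>HHH\<^esub>z\<in>X. \<Oplus>\<^bsub>HHH\<^esub>u\<in>X. e3 x u y z) = (\<Oplus>\<^bsub>HHH\<^esub>y\<in>X. \<Oplus>\<^bsub>HHH\<^esub>u\<in>X. \<Oplus>\<^bsub>HHH\<^esub>z\<in>X. e3 x u y z)"
      using x by (intro HHH.M.finsum_cong' refl closed HHH.M.finsum_swap finite_X)
    also have "\<dots> = (\<Oplus>\<^bsub>HHH\<^esub>u\<in>X. \<Oplus>\<^bsub>HHH\<^esub>y\<in>X. \<Oplus>\<^bsub>HHH\<^esub>z\<in>X. e3 x u y z)"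
      using x by (intro HHH.M.finsum_swap finite_X closed)
    finally show "(\<Oplus>\<^bsub>HHH\<^esub>y\<in>X. \<Oplus>\<^bsub>HHH\<^esub>z\<in>X. \<Oplus>\<^bsub>HHH\<^esub>u\<in>X. e3 x u y z)
      = (\<Oplus>\<^bsub>HHH\<^esub>u\<in>X. \<Oplus>\<^bsub>HHH\<^esub>y\<in>X. \<Oplus>\<^bsub>HHH\<^esub>z\<in>X. e3 x u y z)" .
  qed (intro closed)
  finally show ?thesis .
qed

text \<open>The map \<open>m\<close> is the multiplication of \<open>H \<otimes> H \<otimes> H\<close> or its opposite, so that both weak unit
  axioms are instances.\<close>

lemma D_one_product:
  assumes m: "m \<in> bilin_hom R HHH HHH HHH"
    and ev: "\<And>x u y u' y' z. \<lbrakk>x \<in> X; u \<in> X; y \<in> X; u' \<in> X; y' \<in> X; z \<in> X\<rbrakk>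
      \<Longrightarrow> m (pure_tensor R HH H (pure_tensor R H H (e x u) (e u y)) \<one>\<^bsub>H\<^esub>)
          (pure_tensor R HH H (pure_tensor R H H \<one>\<^bsub>H\<^esub> (e u' y')) (e y' z))
        = (if u' = u \<and> y' = y then e3 x u y z else \<zero>\<^bsub>HHH\<^esub>)"
  shows "m (pure_tensor R HH H (D \<one>\<^bsub>H\<^esub>) \<one>\<^bsub>H\<^esub>)
      (tensor_assoc R H H H (pure_tensor R H HH \<one>\<^bsub>H\<^esub> (D \<one>\<^bsub>H\<^esub>)))
    = (\<Oplus>\<^bsub>HHH\<^esub>x\<in>X. \<Oplus>\<^bsub>HHH\<^esub>u\<in>X. \<Oplus>\<^bsub>HHH\<^esub>y\<in>X. \<Oplus>\<^bsub>HHH\<^esub>z\<in>X. e3 x u y z)"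
proof -
  note closed = e3_closed HHH.M.finsum_closed Pi_I
  let ?B = "tensor_assoc R H H H (pure_tensor R H HH \<one>\<^bsub>H\<^esub> (D \<one>\<^bsub>H\<^esub>))"
  note assoc = lin_hom_comp[OF bilin_hom_right[OF pure_tensor_bilin[OF mod_H mod_HH] H.one_closed]
      tensor_assoc_lin[OF mod_H mod_H mod_H]]
  have B: "?B \<in> carrier HHH"
    by (rule lin_hom_closed[OF assoc D_closed[OF H.one_closed]])
  have f: "(\<lambda>t. m (pure_tensor R HH H t \<one>\<^bsub>H\<^esub>) ?B) \<in> lin_hom R HH HHH"
    by (rule lin_hom_comp[OF bilin_hom_left[OF pure_tensor_bilin[OF mod_HH mod_H] H.one_closed]
          bilin_hom_left[OF m B]])
  \<comment> \<open>With the first factor frozen, the second copy of \<open>\<Delta>(1)\<close> is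
    expanded: the pair \<open>(u', y')\<close> collapses to \<open>(u, y)\<close> and only
    \<open>z\<close> stays free.\<close>
  have eq: "m (pure_tensor R HH H (pure_tensor R H H (e x u) (e u y)) \<one>\<^bsub>H\<^esub>) ?B = (\<Oplus>\<^bsub>HHH\<^esub>z\<in>X. e3 x u y z)"
    if xuy: "x \<in> X" "u \<in> X" "y \<in> X" for x u y
  proof -
    let ?A = "pure_tensor R HH H (pure_tensor R H H (e x u) (e u y)) \<one>\<^bsub>H\<^esub>"
    let ?t = "\<lambda>u' y' z. if u' = u \<and> y' = y then e3 x u y z else \<zero>\<^bsub>HHH\<^esub>"
    have t: "?t u' y' z \<in> carrier HHH" if "z \<in> X" for u' y' z
      using that xuy e3_closed by simp
    have "?A \<in> carrier HHH"
      using xuy by (intro pure_tensor_closed mod_HH mod_H e_closed H.one_closed)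
    from lin_hom_D_one[OF mod_HHH lin_hom_comp[OF assoc bilin_hom_right[OF m this]]]
    have "m ?A ?B = (\<Oplus>\<^bsub>HHH\<^esub>u'\<in>X. \<Oplus>\<^bsub>HHH\<^esub>y'\<in>X. \<Oplus>\<^bsub>HHH\<^esub>z\<in>X.
        m ?A (tensor_assoc R H H H (pure_tensor R H HH \<one>\<^bsub>H\<^esub> (pure_tensor R H H (e u' y') (e y' z)))))" .
    also have "\<dots> = (\<Oplus>\<^bsub>HHH\<^esub>u'\<in>X. \<Oplus>\<^bsub>HHH\<^esub>y'\<in>X. \<Oplus>\<^bsub>HHH\<^esub>z\<in>X. ?t u' y' z)"
      using xuy by (intro HHH.M.finsum_cong' refl HHH.M.finsum_closed Pi_I t)
        (simp_all only: tensor_assoc_pure[OF mod_H mod_H mod_H] H.one_closed e_closed ev)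
    also have "\<dots> = (\<Oplus>\<^bsub>HHH\<^esub>y'\<in>X. \<Oplus>\<^bsub>HHH\<^esub>z\<in>X. ?t u y' z)"
      using xuy by (intro HHH.M.finsum_single finite_X HHH.M.finsum_closed HHH.M.finsum_all_zero Pi_I t) auto
    also have "\<dots> = (\<Oplus>\<^bsub>HHH\<^esub>z\<in>X. ?t u y z)"
      using xuy by (intro HHH.M.finsum_single finite_X HHH.M.finsum_closed HHH.M.finsum_all_zero Pi_I t) auto
    finally show ?thesis by simp
  qed
  show ?thesis
    unfolding lin_hom_D_one[OF mod_HHH f]
    by (intro HHH.M.finsum_cong' refl closed) (simp_all add: eq)
qed

lemma e_mult: "\<lbrakk>x \<in> X; y \<in> X\<rbrakk> \<Longrightarrow> e x y \<otimes>\<^bsub>H\<^esub> e x y = e x y"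
  by (simp add: e_mult_incl one_C)

lemma e_mult_zero:
  "\<lbrakk>x \<in> X; y \<in> X; x' \<in> X; y' \<in> X; x \<noteq> x' \<or> y \<noteq> y'\<rbrakk> \<Longrightarrow> e x y \<otimes>\<^bsub>H\<^esub> e x' y' = \<zero>\<^bsub>H\<^esub>"
  by (rule incl_mult_zero) (simp_all add: one_C)

text \<open>The outer legs are multiplied by the unit; in the middle leg two orthogonal idempotents
  meet. The product, in either order, glues two composable pairs along a common middle arrow and is
  zero if these arrows differ.\<close>

lemma e3_mult:
  assumes "x \<in> X" "u \<in> X" "y \<in> X" "u' \<in> X" "y' \<in> X" "z \<in> X"
  shows "pure_tensor R HH H (pure_tensor R H H (e x u) (e u y)) \<one>\<^bsub>H\<^esub> \<otimes>\<^bsub>HHH\<^esub>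
      pure_tensor R HH H (pure_tensor R H H \<one>\<^bsub>H\<^esub> (e u' y')) (e y' z)
    = (if u' = u \<and> y' = y then e3 x u y z else \<zero>\<^bsub>HHH\<^esub>)"
    and "pure_tensor R HH H (pure_tensor R H H \<one>\<^bsub>H\<^esub> (e u' y')) (e y' z) \<otimes>\<^bsub>HHH\<^esub>
      pure_tensor R HH H (pure_tensor R H H (e x u) (e u y)) \<one>\<^bsub>H\<^esub>
    = (if u' = u \<and> y' = y then e3 x u y z else \<zero>\<^bsub>HHH\<^esub>)"
proof -
  note mult = tensor_mult_pure[OF mod_HH mod_H mult_HH H.mult_bilin]
    tensor_mult_pure[OF mod_H mod_H H.mult_bilin H.mult_bilin]
  note closed = e_closed pure_tensor_closed[OF mod_H mod_H]
  have ee: "e u y \<otimes>\<^bsub>H\<^esub> e u' y' = (if u' = u \<and> y' = y then e u y else \<zero>\<^bsub>H\<^esub>)"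
    "e u' y' \<otimes>\<^bsub>H\<^esub> e u y = (if u' = u \<and> y' = y then e u y else \<zero>\<^bsub>H\<^esub>)"
    using assms by (auto simp: e_mult intro: e_mult_zero)
  show "pure_tensor R HH H (pure_tensor R H H (e x u) (e u y)) \<one>\<^bsub>H\<^esub> \<otimes>\<^bsub>HHH\<^esub>
      pure_tensor R HH H (pure_tensor R H H \<one>\<^bsub>H\<^esub> (e u' y')) (e y' z)
    = (if u' = u \<and> y' = y then e3 x u y z else \<zero>\<^bsub>HHH\<^esub>)"
    "pure_tensor R HH H (pure_tensor R H H \<one>\<^bsub>H\<^esub> (e u' y')) (e y' z) \<otimes>\<^bsub>HHH\<^esub>
      pure_tensor R HH H (pure_tensor R H H (e x u) (e u y)) \<one>\<^bsub>H\<^esub>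
    = (if u' = u \<and> y' = y then e3 x u y z else \<zero>\<^bsub>HHH\<^esub>)"
    using assms by (simp_all add: mult closed ee e3_def pure_tensor_zero[OF mod_H mod_H] pure_tensor_zero[OF mod_HH mod_H])
qed

lemma total_comult_one:
  "tensor_map R HH H D (\<lambda>b. b) (D \<one>\<^bsub>H\<^esub>)
    = pure_tensor R HH H (D \<one>\<^bsub>H\<^esub>) \<one>\<^bsub>H\<^esub> \<otimes>\<^bsub>HHH\<^esub>
      tensor_assoc R H H H (pure_tensor R H HH \<one>\<^bsub>H\<^esub> (D \<one>\<^bsub>H\<^esub>))"
  "tensor_map R HH H D (\<lambda>b. b) (D \<one>\<^bsub>H\<^esub>)
    = tensor_assoc R H H H (pure_tensor R H HH \<one>\<^bsub>H\<^esub> (D \<one>\<^bsub>H\<^esub>)) \<otimes>\<^bsub>HHH\<^esub>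
      pure_tensor R HH H (D \<one>\<^bsub>H\<^esub>) \<one>\<^bsub>H\<^esub>"
  using D_one_product[OF mult_HHH e3_mult(1)] D_one_product[OF bilin_hom_flip[OF mult_HHH] e3_mult(2)]
  by (simp_all add: D_one_iterated)

section \<open>Weak multiplicativity of the counit\<close>

lemma E_mult_incl:
  assumes "x \<in> X" "y \<in> X" "h \<in> carrier H" "a \<in> carrier (C x y)"
  shows "E (h \<otimes>\<^bsub>H\<^esub> \<iota> x y a) = (if x = y then \<epsilon> x (h (x, x)) \<otimes> \<epsilon> x a else \<zero>)"
    and "E (\<iota> x y a \<otimes>\<^bsub>H\<^esub> h) = (if x = y then \<epsilon> x a \<otimes> \<epsilon> x (h (x, x)) else \<zero>)"
  using assms H_apply[OF assms(3,1,2)] by (auto simp: H_mult_incl E_incl mult_C eps_mult)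

text \<open>Obtained by applying \<open>\<epsilon> x\<close> to the left counit law and pulling it
  under the lift.\<close>

lemma tensor_lift_eps:
  assumes x: "x \<in> X" and a: "a \<in> carrier (C x x)"
  shows "tensor_lift R (base_algebra R) (\<lambda>b c. \<epsilon> x b \<otimes> \<epsilon> x c) (\<Delta> x x x a) = \<epsilon> x a"
proof -
  note mods = mod_C[OF x x]
  have bil: "(\<lambda>b c. \<epsilon> x b \<odot>\<^bsub>C x x\<^esub> c) \<in> bilin_hom R (C x x) (C x x) (C x x)"
    by (rule bilin_hom_comp2[OF smult_bilin[OF mods] eps_lin[OF x] lin_hom_id])
  have "\<epsilon> x a = \<epsilon> x (tensor_lift R (C x x) (\<lambda>b c. \<epsilon> x b \<odot>\<^bsub>C x x\<^esub> c) (\<Delta> x x x a))"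
    using x a by (simp add: counit_left)
  also have "\<dots> = tensor_lift R (base_algebra R) (\<lambda>b c. \<epsilon> x (\<epsilon> x b \<odot>\<^bsub>C x x\<^esub> c)) (\<Delta> x x x a)"
    by (rule lin_hom_tensor_lift[OF mods mods mods mod_R eps_lin[OF x] comult_closed[OF x x x a]
          bilin_hom_closed[OF bil]])
  also have "\<dots> = tensor_lift R (base_algebra R) (\<lambda>b c. \<epsilon> x b \<otimes> \<epsilon> x c) (\<Delta> x x x a)"
    by (rule tensor_lift_cong[OF mods mods mod_R comult_closed[OF x x x a], symmetric])
      (use bilin_hom_comp[OF bil eps_lin[OF x]] x in \<open>auto simp: lin_hom_smult[OF eps_lin] eps_closed\<close>)
  finally show ?thesis by simp
qed

lemma mult_R: "mult R \<in> bilin_hom R (base_algebra R) (base_algebra R) (base_algebra R)"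
  using smult_bilin[OF mod_R] by simp

text \<open>The two weak counit axioms only differ in the order of the tensor factors in \<open>\<phi>\<close>.\<close>

lemma counit_mult_general:
  assumes h: "h \<in> carrier H" and l: "l \<in> carrier H" and k: "k \<in> carrier H"
    and bil: "\<phi> \<in> bilin_hom R H H (base_algebra R)"
    and \<phi>: "\<And>x y z b c. \<lbrakk>x \<in> X; y \<in> X; z \<in> X; b \<in> carrier (C x y); c \<in> carrier (C y z)\<rbrakk>
      \<Longrightarrow> \<phi> (\<iota> x y b) (\<iota> y z c)
        = (if x = y \<and> y = z then \<epsilon> x (h (x, x)) \<otimes> \<epsilon> x (l (x, x)) \<otimes> (\<epsilon> x b \<otimes> \<epsilon> x c) else \<zero>)"
  shows "E (h \<otimes>\<^bsub>H\<^esub> k \<otimes>\<^bsub>H\<^esub> l) = tensor_lift R (base_algebra R) \<phi> (D k)"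
proof (rule lin_hom_total_eqI[OF mod_R _ _ _ k])
  interpret B: module R "base_algebra R" by (rule mod_R)
  show "(\<lambda>k. E (h \<otimes>\<^bsub>H\<^esub> k \<otimes>\<^bsub>H\<^esub> l)) \<in> lin_hom R H (base_algebra R)"
    by (rule lin_hom_comp[OF lin_hom_comp[OF bilin_hom_right[OF H.mult_bilin h] bilin_hom_left[OF H.mult_bilin l]] E_lin])
  show "(\<lambda>k. tensor_lift R (base_algebra R) \<phi> (D k)) \<in> lin_hom R H (base_algebra R)"
    by (rule lin_hom_comp[OF D_lin tensor_lift_lin[OF mod_H mod_H mod_R bil]])
  fix x z a assume a: "x \<in> X" "z \<in> X" "a \<in> carrier (C x z)"
  \<comment> \<open>The scalar contributed by \<open>h\<close> and \<open>l\<close>: each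
    \<open>\<epsilon> x\<close> is multiplicative, so on the diagonal it splits off on both sides of
    the axiom.\<close>
  let ?r = "\<lambda>x. \<epsilon> x (h (x, x)) \<otimes> \<epsilon> x (l (x, x))"
  have r: "?r x \<in> carrier R" if "x \<in> X" for x
    using that h l by (simp add: eps_closed H_apply)
  let ?f = "\<lambda>y. tensor_lift R (base_algebra R) (\<lambda>b c. \<phi> (\<iota> x y b) (\<iota> y z c)) (\<Delta> x y z a)"
  have lift: "tensor_lift R (base_algebra R) \<phi> (D (\<iota> x z a)) = (\<Oplus>\<^bsub>base_algebra R\<^esub>y\<in>X. ?f y)"
    by (rule tensor_lift_D_incl[OF mod_R bil a])
  have zero: "?f y = \<zero>" if "y \<in> X" "\<not> (x = y \<and> y = z)" for y
  proof -
    have "?f y = \<zero>\<^bsub>base_algebra R\<^esub>"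
      using a that by (intro tensor_lift_eq_zero[where M = "C x y" and N = "C y z"] mod_C mod_R comult_closed)
        (auto simp: \<phi>)
    then show ?thesis by simp
  qed
  show "E (h \<otimes>\<^bsub>H\<^esub> \<iota> x z a \<otimes>\<^bsub>H\<^esub> l) = tensor_lift R (base_algebra R) \<phi> (D (\<iota> x z a))"
  proof (cases "x = z")
    case False
    have "E (h \<otimes>\<^bsub>H\<^esub> \<iota> x z a \<otimes>\<^bsub>H\<^esub> l) = \<zero>"
      using a h l False by (simp add: H_mult_incl E_incl mult_C H_apply)
    moreover have "(\<Oplus>\<^bsub>base_algebra R\<^esub>y\<in>X. ?f y) = \<zero>\<^bsub>base_algebra R\<^esub>"
      by (rule B.M.finsum_all_zero) (use False zero in auto)
    ultimately show ?thesis unfolding lift by simp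
  next
    case True
    have ax: "a \<in> carrier (C x x)" using a True by simp
    note mods = mod_C[OF a(1) a(1)] and t = comult_closed[OF a(1) a(1) a(1) ax]
    have bil': "(\<lambda>b c. \<epsilon> x b \<otimes> \<epsilon> x c) \<in> bilin_hom R (C x x) (C x x) (base_algebra R)"
      by (rule bilin_hom_comp2[OF mult_R eps_lin[OF a(1)] eps_lin[OF a(1)]])
    have rl: "(\<lambda>s. ?r x \<otimes> s) \<in> lin_hom R (base_algebra R) (base_algebra R)"
      by (rule bilin_hom_right[OF mult_R]) (use r a in simp)
    have "?f x = tensor_lift R (base_algebra R) (\<lambda>b c. ?r x \<otimes> (\<epsilon> x b \<otimes> \<epsilon> x c)) (\<Delta> x x x a)"
      unfolding True[symmetric]
      by (rule tensor_lift_cong[OF mods mods mod_R t bilin_hom_comp[OF bil' rl]])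
        (use a in \<open>simp add: \<phi>\<close>)
    also have "\<dots> = ?r x \<otimes> tensor_lift R (base_algebra R) (\<lambda>b c. \<epsilon> x b \<otimes> \<epsilon> x c) (\<Delta> x x x a)"
      by (rule lin_hom_tensor_lift[OF mods mods mod_R mod_R rl t bilin_hom_closed[OF bil'], symmetric])
    also have "\<dots> = ?r x \<otimes> \<epsilon> x a"
      using a ax by (simp add: tensor_lift_eps)
    finally have fx: "?f x = ?r x \<otimes> \<epsilon> x a" .
    have "(\<Oplus>\<^bsub>base_algebra R\<^esub>y\<in>X. ?f y) = ?f x"
    proof (rule B.M.finsum_single[OF finite_X a(1)])
      show "?f x \<in> carrier (base_algebra R)" using r a ax by (simp add: fx eps_closed)
      fix y assume "y \<in> X" "y \<noteq> x"
      then show "?f y = \<zero>\<^bsub>base_algebra R\<^esub>" using zero by simp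
    qed
    moreover have "E (h \<otimes>\<^bsub>H\<^esub> \<iota> x z a \<otimes>\<^bsub>H\<^esub> l) = ?r x \<otimes> \<epsilon> x a"
      using a ax h l unfolding True[symmetric]
      by (simp add: H_mult_incl E_incl mult_C H_apply eps_mult eps_closed m_ac)
    ultimately show ?thesis unfolding lift by (simp add: fx)
  qed
qed

lemma E_mult_lin:
  assumes "h \<in> carrier H"
  shows "(\<lambda>a. E (h \<otimes>\<^bsub>H\<^esub> a)) \<in> lin_hom R H (base_algebra R)" "(\<lambda>a. E (a \<otimes>\<^bsub>H\<^esub> h)) \<in> lin_hom R H (base_algebra R)"
  by (rule lin_hom_comp[OF bilin_hom_right[OF H.mult_bilin assms] E_lin]
      lin_hom_comp[OF bilin_hom_left[OF H.mult_bilin assms] E_lin])+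

text \<open>On matching indices the two leg orders give the same scalar, because
  \<open>\<epsilon> x\<close> is multiplicative and \<open>R\<close> is commutative.\<close>

lemma total_counit_mult:
  assumes h: "h \<in> carrier H" and k: "k \<in> carrier H" and l: "l \<in> carrier H"
  shows "E (h \<otimes>\<^bsub>H\<^esub> k \<otimes>\<^bsub>H\<^esub> l) = tensor_lift R (base_algebra R) (\<lambda>a b. E (h \<otimes>\<^bsub>H\<^esub> a) \<otimes> E (b \<otimes>\<^bsub>H\<^esub> l)) (D k)"
    and "E (h \<otimes>\<^bsub>H\<^esub> k \<otimes>\<^bsub>H\<^esub> l) = tensor_lift R (base_algebra R) (\<lambda>a b. E (h \<otimes>\<^bsub>H\<^esub> b) \<otimes> E (a \<otimes>\<^bsub>H\<^esub> l)) (D k)"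
proof -
  have cl: "\<epsilon> x (h (x, x)) \<in> carrier R" "\<epsilon> x (l (x, x)) \<in> carrier R" if "x \<in> X" for x
    using that h l by (simp_all add: eps_closed H_apply)
  show "E (h \<otimes>\<^bsub>H\<^esub> k \<otimes>\<^bsub>H\<^esub> l) = tensor_lift R (base_algebra R) (\<lambda>a b. E (h \<otimes>\<^bsub>H\<^esub> a) \<otimes> E (b \<otimes>\<^bsub>H\<^esub> l)) (D k)"
    by (rule counit_mult_general[OF h l k bilin_hom_comp2[OF mult_R E_mult_lin(1)[OF h] E_mult_lin(2)[OF l]]])
      (use h l in \<open>auto simp: E_mult_incl cl eps_closed m_ac\<close>)
  show "E (h \<otimes>\<^bsub>H\<^esub> k \<otimes>\<^bsub>H\<^esub> l) = tensor_lift R (base_algebra R) (\<lambda>a b. E (h \<otimes>\<^bsub>H\<^esub> b) \<otimes> E (a \<otimes>\<^bsub>H\<^esub> l)) (D k)"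
    by (rule counit_mult_general[OF h l k bilin_hom_flip[OF bilin_hom_comp2[OF mult_R E_mult_lin(1)[OF h] E_mult_lin(2)[OF l]]]])
      (use h l in \<open>auto simp: E_mult_incl cl eps_closed m_ac\<close>)
qed

section \<open>The antipode axioms\<close>

lemma antipode_right_incl:
  assumes a: "x \<in> X" "z \<in> X" "a \<in> carrier (C x z)"
  shows "tensor_lift R H (\<lambda>b c. b \<otimes>\<^bsub>H\<^esub> T c) (D (\<iota> x z a))
    = (if x = z then \<Oplus>\<^bsub>H\<^esub>y\<in>X. \<epsilon> x a \<odot>\<^bsub>H\<^esub> e x y else \<zero>\<^bsub>H\<^esub>)"
proof -
  let ?f = "\<lambda>y. tensor_lift R H (\<lambda>b c. \<iota> x y b \<otimes>\<^bsub>H\<^esub> T (\<iota> y z c)) (\<Delta> x y z a)"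
  have "tensor_lift R H (\<lambda>b c. b \<otimes>\<^bsub>H\<^esub> T c) (D (\<iota> x z a)) = (\<Oplus>\<^bsub>H\<^esub>y\<in>X. ?f y)"
    by (rule tensor_lift_D_incl[OF mod_H bilin_hom_comp2[OF H.mult_bilin lin_hom_id T_lin] a])
  also have "\<dots> = (if x = z then \<Oplus>\<^bsub>H\<^esub>y\<in>X. \<epsilon> x a \<odot>\<^bsub>H\<^esub> e x y else \<zero>\<^bsub>H\<^esub>)"
  proof (cases "x = z")
    case False
    \<comment> \<open>\<open>T\<close> sends the second leg from \<open>C y z\<close> to
      \<open>C z y\<close>, which is a different summand from that of the first leg,
      \<open>C x y\<close>.\<close>
    have "?f y = \<zero>\<^bsub>H\<^esub>" if "y \<in> X" for y
      using a that False
      by (intro tensor_lift_eq_zero[where M = "C x y" and N = "C y z"] mod_C mod_H comult_closed)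
        (simp_all add: T_incl incl_mult_zero S_closed)
    then show ?thesis using False by (simp add: H.M.finsum_all_zero)
  next
    case True
    have ax: "a \<in> carrier (C x x)" using a True by simp
    have "?f y = \<epsilon> x a \<odot>\<^bsub>H\<^esub> e x y" if y: "y \<in> X" for y
    proof -
      note xy = a(1) y and mods = mod_C[OF a(1) y] mod_C[OF y a(1)]
      note t = comult_closed[OF a(1) y a(1) ax]
      have bil: "(\<lambda>b c. b \<otimes>\<^bsub>C x y\<^esub> S x y c) \<in> bilin_hom R (C x y) (C y x) (C x y)"
        by (rule bilin_hom_comp2[OF mult_C_bilin[OF xy] lin_hom_id antipode_lin[OF xy]])
      have "?f y = tensor_lift R H (\<lambda>b c. \<iota> x y (b \<otimes>\<^bsub>C x y\<^esub> S x y c)) (\<Delta> x y x a)"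
        unfolding True[symmetric]
        by (rule tensor_lift_cong[OF mods mod_H t bilin_hom_comp[OF bil incl_lin[OF xy]]])
          (use xy in \<open>simp add: T_incl incl_mult S_closed\<close>)
      also have "\<dots> = \<iota> x y (tensor_lift R (C x y) (\<lambda>b c. b \<otimes>\<^bsub>C x y\<^esub> S x y c) (\<Delta> x y x a))"
        by (rule lin_hom_tensor_lift[OF mods mods(1) mod_H incl_lin[OF xy] t bilin_hom_closed[OF bil], symmetric])
      also have "\<dots> = \<epsilon> x a \<odot>\<^bsub>H\<^esub> e x y"
        using xy ax by (simp add: antipode_right lin_hom_smult[OF incl_lin[OF xy]] eps_closed one_C)
      finally show ?thesis .
    qed
    then have "(\<Oplus>\<^bsub>H\<^esub>y\<in>X. ?f y) = (\<Oplus>\<^bsub>H\<^esub>y\<in>X. \<epsilon> x a \<odot>\<^bsub>H\<^esub> e x y)"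
      using a ax by (intro H.M.finsum_cong') (auto simp: eps_closed e_closed)
    then show ?thesis using True by simp
  qed
  finally show ?thesis .
qed

text \<open>Besides its own axiom, this computes the factor \<open>S(h_1) h_2\<close> inside the
  triple product of \<open>total_antipode_both\<close>.\<close>

lemma antipode_left_incl:
  assumes a: "x \<in> X" "z \<in> X" "a \<in> carrier (C x z)"
  shows "tensor_lift R H (\<lambda>b c. T b \<otimes>\<^bsub>H\<^esub> c) (D (\<iota> x z a))
    = (if x = z then \<Oplus>\<^bsub>H\<^esub>y\<in>X. \<epsilon> x a \<odot>\<^bsub>H\<^esub> e y x else \<zero>\<^bsub>H\<^esub>)"
proof -
  let ?f = "\<lambda>y. tensor_lift R H (\<lambda>b c. T (\<iota> x y b) \<otimes>\<^bsub>H\<^esub> \<iota> y z c) (\<Delta> x y z a)"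
  have "tensor_lift R H (\<lambda>b c. T b \<otimes>\<^bsub>H\<^esub> c) (D (\<iota> x z a)) = (\<Oplus>\<^bsub>H\<^esub>y\<in>X. ?f y)"
    by (rule tensor_lift_D_incl[OF mod_H bilin_hom_comp2[OF H.mult_bilin T_lin lin_hom_id] a])
  also have "\<dots> = (if x = z then \<Oplus>\<^bsub>H\<^esub>y\<in>X. \<epsilon> x a \<odot>\<^bsub>H\<^esub> e y x else \<zero>\<^bsub>H\<^esub>)"
  proof (cases "x = z")
    case False
    have "?f y = \<zero>\<^bsub>H\<^esub>" if "y \<in> X" for y
      using a that False
      by (intro tensor_lift_eq_zero[where M = "C x y" and N = "C y z"] mod_C mod_H comult_closed)
        (simp_all add: T_incl incl_mult_zero S_closed)
    then show ?thesis using False by (simp add: H.M.finsum_all_zero)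
  next
    case True
    have ax: "a \<in> carrier (C x x)" using a True by simp
    have "?f y = \<epsilon> x a \<odot>\<^bsub>H\<^esub> e y x" if y: "y \<in> X" for y
    proof -
      note yx = y a(1) and mods = mod_C[OF a(1) y] mod_C[OF y a(1)]
      note t = comult_closed[OF a(1) y a(1) ax]
      have bil: "(\<lambda>b c. S y x b \<otimes>\<^bsub>C y x\<^esub> c) \<in> bilin_hom R (C x y) (C y x) (C y x)"
        by (rule bilin_hom_comp2[OF mult_C_bilin[OF yx] antipode_lin[OF yx] lin_hom_id])
      have "?f y = tensor_lift R H (\<lambda>b c. \<iota> y x (S y x b \<otimes>\<^bsub>C y x\<^esub> c)) (\<Delta> x y x a)"
        unfolding True[symmetric]
        by (rule tensor_lift_cong[OF mods mod_H t bilin_hom_comp[OF bil incl_lin[OF yx]]])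
          (use yx in \<open>simp add: T_incl incl_mult S_closed\<close>)
      also have "\<dots> = \<iota> y x (tensor_lift R (C y x) (\<lambda>b c. S y x b \<otimes>\<^bsub>C y x\<^esub> c) (\<Delta> x y x a))"
        by (rule lin_hom_tensor_lift[OF mods mods(2) mod_H incl_lin[OF yx] t bilin_hom_closed[OF bil], symmetric])
      also have "\<dots> = \<epsilon> x a \<odot>\<^bsub>H\<^esub> e y x"
        using yx ax by (simp add: antipode_left lin_hom_smult[OF incl_lin[OF yx]] eps_closed one_C)
      finally show ?thesis .
    qed
    then have "(\<Oplus>\<^bsub>H\<^esub>y\<in>X. ?f y) = (\<Oplus>\<^bsub>H\<^esub>y\<in>X. \<epsilon> x a \<odot>\<^bsub>H\<^esub> e y x)"
      using a ax by (intro H.M.finsum_cong') (auto simp: eps_closed e_closed)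
    then show ?thesis using True by simp
  qed
  finally show ?thesis .
qed

text \<open>Two vanishing effects combine: orthogonality forces the idempotent to belong to the
  summand of \<open>a\<close>, and the counit forces that summand to be diagonal.\<close>

lemma E_e_mult_incl:
  assumes "x \<in> X" "y \<in> X" "x' \<in> X" "z \<in> X" "a \<in> carrier (C x' z)"
  shows "E (e x y \<otimes>\<^bsub>H\<^esub> \<iota> x' z a) = (if x = x' \<and> y = z \<and> x' = z then \<epsilon> x' a else \<zero>)"
    and "E (\<iota> x' z a \<otimes>\<^bsub>H\<^esub> e x y) = (if x = x' \<and> y = z \<and> x' = z then \<epsilon> x' a else \<zero>)"
proof -
  have E0: "E \<zero>\<^bsub>H\<^esub> = \<zero>"
    using lin_hom_zero[OF mod_H mod_R E_lin] by simp
  have l: "e x y \<otimes>\<^bsub>H\<^esub> \<iota> x' z a = (if x = x' \<and> y = z then \<iota> x' z a else \<zero>\<^bsub>H\<^esub>)"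
    using assms incl_mult_zero[OF assms(1,2) one_C[OF assms(1,2)] assms(3-5)] by (auto simp: e_mult_incl)
  have r: "\<iota> x' z a \<otimes>\<^bsub>H\<^esub> e x y = (if x = x' \<and> y = z then \<iota> x' z a else \<zero>\<^bsub>H\<^esub>)"
    using assms incl_mult_zero[OF assms(3-5,1,2) one_C[OF assms(1,2)]] by (auto simp: e_mult_incl)
  show "E (e x y \<otimes>\<^bsub>H\<^esub> \<iota> x' z a) = (if x = x' \<and> y = z \<and> x' = z then \<epsilon> x' a else \<zero>)"
    using assms by (auto simp: l E_incl E0)
  show "E (\<iota> x' z a \<otimes>\<^bsub>H\<^esub> e x y) = (if x = x' \<and> y = z \<and> x' = z then \<epsilon> x' a else \<zero>)"
    using assms by (auto simp: r E_incl E0)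
qed

lemma E_smult_bilin:
  assumes "h \<in> carrier H"
  shows "(\<lambda>a b. E (a \<otimes>\<^bsub>H\<^esub> h) \<odot>\<^bsub>H\<^esub> b) \<in> bilin_hom R H H H"
    and "(\<lambda>a b. E (h \<otimes>\<^bsub>H\<^esub> b) \<odot>\<^bsub>H\<^esub> a) \<in> bilin_hom R H H H"
  by (rule bilin_hom_comp2[OF smult_bilin[OF mod_H] E_mult_lin(2)[OF assms] lin_hom_id]
      bilin_hom_flip[OF bilin_hom_comp2[OF smult_bilin[OF mod_H] E_mult_lin(1)[OF assms] lin_hom_id]])+

lemma E_smult_lin:
  assumes "a \<in> carrier H" "b \<in> carrier H"
  shows "(\<lambda>h. E (a \<otimes>\<^bsub>H\<^esub> h) \<odot>\<^bsub>H\<^esub> b) \<in> lin_hom R H H" "(\<lambda>h. E (h \<otimes>\<^bsub>H\<^esub> b) \<odot>\<^bsub>H\<^esub> a) \<in> lin_hom R H H"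
  by (rule lin_hom_comp[OF E_mult_lin(1)[OF assms(1)] bilin_hom_left[OF smult_bilin[OF mod_H] assms(2)]]
      lin_hom_comp[OF E_mult_lin(2)[OF assms(2)] bilin_hom_left[OF smult_bilin[OF mod_H] assms(1)]])+

text \<open>\<open>\<Delta>(1)\<close> contributes the terms \<open>e x' y \<otimes> e y z'\<close>.
  Pairing the first leg with an element of \<open>C x z\<close> forces \<open>x' = y = x = z\<close>
  and leaves \<open>z'\<close> free, which reproduces the sum in
  \<open>antipode_right_incl\<close>.\<close>

lemma total_antipode_right:
  assumes h: "h \<in> carrier H"
  shows "tensor_lift R H (\<lambda>a b. a \<otimes>\<^bsub>H\<^esub> T b) (D h) = tensor_lift R H (\<lambda>a b. E (a \<otimes>\<^bsub>H\<^esub> h) \<odot>\<^bsub>H\<^esub> b) (D \<one>\<^bsub>H\<^esub>)"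
proof (rule lin_hom_total_eqI[OF mod_H _ _ _ h])
  note D1 = D_closed[OF H.one_closed]
  show "(\<lambda>h. tensor_lift R H (\<lambda>a b. a \<otimes>\<^bsub>H\<^esub> T b) (D h)) \<in> lin_hom R H H"
    by (rule lin_hom_comp[OF D_lin tensor_lift_lin[OF mod_H mod_H mod_H
            bilin_hom_comp2[OF H.mult_bilin lin_hom_id T_lin]]])
  show "(\<lambda>h. tensor_lift R H (\<lambda>a b. E (a \<otimes>\<^bsub>H\<^esub> h) \<odot>\<^bsub>H\<^esub> b) (D \<one>\<^bsub>H\<^esub>)) \<in> lin_hom R H H"
    by (rule tensor_lift_param_lin[OF mod_H mod_H mod_H mod_H E_smult_bilin(1) E_smult_lin(1) D1])
  fix x z a assume a: "x \<in> X" "z \<in> X" "a \<in> carrier (C x z)"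
  let ?t = "\<lambda>x' y z'. E (e x' y \<otimes>\<^bsub>H\<^esub> \<iota> x z a) \<odot>\<^bsub>H\<^esub> e y z'"
  have "tensor_lift R H (\<lambda>b c. E (b \<otimes>\<^bsub>H\<^esub> \<iota> x z a) \<odot>\<^bsub>H\<^esub> c) (D \<one>\<^bsub>H\<^esub>) = (\<Oplus>\<^bsub>H\<^esub>x'\<in>X. \<Oplus>\<^bsub>H\<^esub>y\<in>X. \<Oplus>\<^bsub>H\<^esub>z'\<in>X. ?t x' y z')"
    by (rule tensor_lift_D_one[OF mod_H E_smult_bilin(1)[OF incl_closed[OF a]]])
  also have "\<dots> = (if x = z then \<Oplus>\<^bsub>H\<^esub>y\<in>X. \<epsilon> x a \<odot>\<^bsub>H\<^esub> e x y else \<zero>\<^bsub>H\<^esub>)"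
  proof -
    have t: "?t x' y z' \<in> carrier H" if "x' \<in> X" "y \<in> X" "z' \<in> X" for x' y z'
      using a that by (intro H.smult_closed E_closed H.m_closed incl_closed e_closed one_C)
    have zero: "?t x' y z' = \<zero>\<^bsub>H\<^esub>" if "x' \<in> X" "y \<in> X" "z' \<in> X" "x' \<noteq> x \<or> y \<noteq> z \<or> x \<noteq> z" for x' y z'
      using a that by (auto simp: E_e_mult_incl e_closed)
    show ?thesis
    proof (cases "x = z")
      case False
      have "(\<Oplus>\<^bsub>H\<^esub>x'\<in>X. \<Oplus>\<^bsub>H\<^esub>y\<in>X. \<Oplus>\<^bsub>H\<^esub>z'\<in>X. ?t x' y z') = \<zero>\<^bsub>H\<^esub>"
        by (intro H.M.finsum_all_zero zero) (use False in auto)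
      then show ?thesis using False by simp
    next
      case True
      have "(\<Oplus>\<^bsub>H\<^esub>x'\<in>X. \<Oplus>\<^bsub>H\<^esub>y\<in>X. \<Oplus>\<^bsub>H\<^esub>z'\<in>X. ?t x' y z') = (\<Oplus>\<^bsub>H\<^esub>y\<in>X. \<Oplus>\<^bsub>H\<^esub>z'\<in>X. ?t x y z')"
        using a by (intro H.M.finsum_single[where x = x] finite_X H.M.finsum_closed H.M.finsum_all_zero Pi_I t zero) auto
      also have "\<dots> = (\<Oplus>\<^bsub>H\<^esub>z'\<in>X. ?t x x z')"
        using a True
        by (intro H.M.finsum_single[where x = x] finite_X H.M.finsum_closed H.M.finsum_all_zero Pi_I t zero) auto
      also have "\<dots> = (\<Oplus>\<^bsub>H\<^esub>z'\<in>X. \<epsilon> x a \<odot>\<^bsub>H\<^esub> e x z')"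
        using a True by (intro H.M.finsum_cong') (auto simp: E_e_mult_incl eps_closed e_closed)
      finally show ?thesis using True by simp
    qed
  qed
  also have "\<dots> = tensor_lift R H (\<lambda>b c. b \<otimes>\<^bsub>H\<^esub> T c) (D (\<iota> x z a))"
    by (rule antipode_right_incl[OF a, symmetric])
  finally show "tensor_lift R H (\<lambda>b c. b \<otimes>\<^bsub>H\<^esub> T c) (D (\<iota> x z a))
      = tensor_lift R H (\<lambda>b c. E (b \<otimes>\<^bsub>H\<^esub> \<iota> x z a) \<odot>\<^bsub>H\<^esub> c) (D \<one>\<^bsub>H\<^esub>)" by (rule sym)
qed

text \<open>Now the second leg is paired, which forces \<open>y = z' = x = z\<close>. The free index
  is the outermost one, \<open>x'\<close>, so the two inner sums are collapsed for each fixed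
  \<open>x'\<close>.\<close>

lemma total_antipode_left:
  assumes h: "h \<in> carrier H"
  shows "tensor_lift R H (\<lambda>a b. T a \<otimes>\<^bsub>H\<^esub> b) (D h) = tensor_lift R H (\<lambda>a b. E (h \<otimes>\<^bsub>H\<^esub> b) \<odot>\<^bsub>H\<^esub> a) (D \<one>\<^bsub>H\<^esub>)"
proof (rule lin_hom_total_eqI[OF mod_H _ _ _ h])
  note D1 = D_closed[OF H.one_closed]
  show "(\<lambda>h. tensor_lift R H (\<lambda>a b. T a \<otimes>\<^bsub>H\<^esub> b) (D h)) \<in> lin_hom R H H"
    by (rule lin_hom_comp[OF D_lin tensor_lift_lin[OF mod_H mod_H mod_H
            bilin_hom_comp2[OF H.mult_bilin T_lin lin_hom_id]]])
  show "(\<lambda>h. tensor_lift R H (\<lambda>a b. E (h \<otimes>\<^bsub>H\<^esub> b) \<odot>\<^bsub>H\<^esub> a) (D \<one>\<^bsub>H\<^esub>)) \<in> lin_hom R H H"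
    by (rule tensor_lift_param_lin[OF mod_H mod_H mod_H mod_H E_smult_bilin(2) E_smult_lin(2) D1])
  fix x z a assume a: "x \<in> X" "z \<in> X" "a \<in> carrier (C x z)"
  let ?t = "\<lambda>x' y z'. E (\<iota> x z a \<otimes>\<^bsub>H\<^esub> e y z') \<odot>\<^bsub>H\<^esub> e x' y"
  have "tensor_lift R H (\<lambda>b c. E (\<iota> x z a \<otimes>\<^bsub>H\<^esub> c) \<odot>\<^bsub>H\<^esub> b) (D \<one>\<^bsub>H\<^esub>) = (\<Oplus>\<^bsub>H\<^esub>x'\<in>X. \<Oplus>\<^bsub>H\<^esub>y\<in>X. \<Oplus>\<^bsub>H\<^esub>z'\<in>X. ?t x' y z')"
    by (rule tensor_lift_D_one[OF mod_H E_smult_bilin(2)[OF incl_closed[OF a]]])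
  also have "\<dots> = (if x = z then \<Oplus>\<^bsub>H\<^esub>y\<in>X. \<epsilon> x a \<odot>\<^bsub>H\<^esub> e y x else \<zero>\<^bsub>H\<^esub>)"
  proof -
    have t: "?t x' y z' \<in> carrier H" if "x' \<in> X" "y \<in> X" "z' \<in> X" for x' y z'
      using a that by (intro H.smult_closed E_closed H.m_closed incl_closed e_closed one_C)
    have zero: "?t x' y z' = \<zero>\<^bsub>H\<^esub>" if "x' \<in> X" "y \<in> X" "z' \<in> X" "y \<noteq> x \<or> z' \<noteq> z \<or> x \<noteq> z" for x' y z'
      using a that by (auto simp: E_e_mult_incl e_closed)
    show ?thesis
    proof (cases "x = z")
      case False
      have "(\<Oplus>\<^bsub>H\<^esub>x'\<in>X. \<Oplus>\<^bsub>H\<^esub>y\<in>X. \<Oplus>\<^bsub>H\<^esub>z'\<in>X. ?t x' y z') = \<zero>\<^bsub>H\<^esub>"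
        by (intro H.M.finsum_all_zero zero) (use False in auto)
      then show ?thesis using False by simp
    next
      case True
      have "(\<Oplus>\<^bsub>H\<^esub>y\<in>X. \<Oplus>\<^bsub>H\<^esub>z'\<in>X. ?t x' y z') = \<epsilon> x a \<odot>\<^bsub>H\<^esub> e x' x" if x': "x' \<in> X" for x'
      proof -
        have "(\<Oplus>\<^bsub>H\<^esub>y\<in>X. \<Oplus>\<^bsub>H\<^esub>z'\<in>X. ?t x' y z') = (\<Oplus>\<^bsub>H\<^esub>z'\<in>X. ?t x' x z')"
          using a x' by (intro H.M.finsum_single[where x = x] finite_X H.M.finsum_closed H.M.finsum_all_zero Pi_I t zero) auto
        also have "\<dots> = ?t x' x x"
          using a x' True by (intro H.M.finsum_single[where x = x] finite_X t zero) auto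
        also have "\<dots> = \<epsilon> x a \<odot>\<^bsub>H\<^esub> e x' x"
          using a True by (simp add: E_e_mult_incl)
        finally show ?thesis .
      qed
      then have "(\<Oplus>\<^bsub>H\<^esub>x'\<in>X. \<Oplus>\<^bsub>H\<^esub>y\<in>X. \<Oplus>\<^bsub>H\<^esub>z'\<in>X. ?t x' y z') = (\<Oplus>\<^bsub>H\<^esub>x'\<in>X. \<epsilon> x a \<odot>\<^bsub>H\<^esub> e x' x)"
        using a True by (intro H.M.finsum_cong') (auto simp: eps_closed e_closed)
      then show ?thesis using True by simp
    qed
  qed
  also have "\<dots> = tensor_lift R H (\<lambda>b c. T b \<otimes>\<^bsub>H\<^esub> c) (D (\<iota> x z a))"
    by (rule antipode_left_incl[OF a, symmetric])
  finally show "tensor_lift R H (\<lambda>b c. T b \<otimes>\<^bsub>H\<^esub> c) (D (\<iota> x z a))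
      = tensor_lift R H (\<lambda>b c. E (\<iota> x z a \<otimes>\<^bsub>H\<^esub> c) \<odot>\<^bsub>H\<^esub> b) (D \<one>\<^bsub>H\<^esub>)" by (rule sym)
qed

text \<open>The product is grouped as \<open>(S(h_1) h_2) S(h_3)\<close>, so that its first factor
  is already known. That factor brings in a counit value, which the left counit law of
  \<open>C\<close> then absorbs.\<close>

lemma total_antipode_both:
  assumes h: "h \<in> carrier H"
  shows "tensor_lift R H (\<lambda>t c. tensor_lift R H (\<lambda>a b. T a \<otimes>\<^bsub>H\<^esub> b \<otimes>\<^bsub>H\<^esub> T c) t)
      (tensor_map R HH H D (\<lambda>b. b) (D h)) = T h"
proof -
  let ?L = "tensor_lift R H (\<lambda>a b. T a \<otimes>\<^bsub>H\<^esub> b)"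
  note bilL = bilin_hom_comp2[OF H.mult_bilin T_lin lin_hom_id]
  have L: "?L \<in> lin_hom R HH H" by (rule tensor_lift_lin[OF mod_H mod_H mod_H bilL])
  have Q: "(\<lambda>t c. ?L t \<otimes>\<^bsub>H\<^esub> T c) \<in> bilin_hom R HH H H"
    by (rule bilin_hom_comp2[OF H.mult_bilin L T_lin])
  have Q': "(\<lambda>b c. ?L (D b) \<otimes>\<^bsub>H\<^esub> T c) \<in> bilin_hom R H H H"
    by (rule bilin_hom_comp2[OF Q D_lin lin_hom_id])
  have "tensor_lift R H (\<lambda>t c. tensor_lift R H (\<lambda>a b. T a \<otimes>\<^bsub>H\<^esub> b \<otimes>\<^bsub>H\<^esub> T c) t)
      (tensor_map R HH H D (\<lambda>b. b) (D h))
    = tensor_lift R H (\<lambda>t c. ?L t \<otimes>\<^bsub>H\<^esub> T c) (tensor_map R HH H D (\<lambda>b. b) (D h))"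
  proof (rule tensor_lift_cong[OF mod_HH mod_H mod_H _ Q])
    show "tensor_map R HH H D (\<lambda>b. b) (D h) \<in> carrier (tensor R HH H)"
      by (rule tensor_map_closed[OF mod_H mod_H mod_HH mod_H D_lin lin_hom_id D_closed[OF h]])
    fix t c assume t: "t \<in> carrier HH" and c: "c \<in> carrier H"
    \<comment> \<open>For fixed \<open>c\<close>, right multiplication by \<open>T c\<close> is
      linear and leaves the inner lift.\<close>
    show "tensor_lift R H (\<lambda>a b. T a \<otimes>\<^bsub>H\<^esub> b \<otimes>\<^bsub>H\<^esub> T c) t = ?L t \<otimes>\<^bsub>H\<^esub> T c"
      by (rule lin_hom_tensor_lift[OF mod_H mod_H mod_H mod_H
            bilin_hom_left[OF H.mult_bilin lin_hom_closed[OF T_lin c]] t bilin_hom_closed[OF bilL], symmetric])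
  qed
  also have "\<dots> = tensor_lift R H (\<lambda>b c. ?L (D b) \<otimes>\<^bsub>H\<^esub> T c) (D h)"
    by (rule tensor_lift_map[OF mod_H mod_H mod_HH mod_H D_lin lin_hom_id mod_H Q D_closed[OF h]])
  also have "\<dots> = T h"
  proof (rule lin_hom_total_eqI[OF mod_H _ T_lin _ h])
    show "(\<lambda>h. tensor_lift R H (\<lambda>b c. ?L (D b) \<otimes>\<^bsub>H\<^esub> T c) (D h)) \<in> lin_hom R H H"
      by (rule lin_hom_comp[OF D_lin tensor_lift_lin[OF mod_H mod_H mod_H Q']])
    fix x z a assume a: "x \<in> X" "z \<in> X" "a \<in> carrier (C x z)"
    let ?f = "\<lambda>y. tensor_lift R H (\<lambda>b c. ?L (D (\<iota> x y b)) \<otimes>\<^bsub>H\<^esub> T (\<iota> y z c)) (\<Delta> x y z a)"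
    \<comment> \<open>By \<open>antipode_left_incl\<close> the first factor vanishes on
      \<open>C x y\<close> with \<open>y\<close> different from \<open>x\<close>, whatever the third
      leg is.\<close>
    have zero: "?f y = \<zero>\<^bsub>H\<^esub>" if "y \<in> X" "y \<noteq> x" for y
      using a that
      by (intro tensor_lift_eq_zero[where M = "C x y" and N = "C y z"] mod_C mod_H comult_closed)
        (auto simp: antipode_left_incl incl_closed lin_hom_closed[OF T_lin])
    note mods = mod_C[OF a(1) a(1)] mod_C[OF a(1,2)]
    note t = comult_closed[OF a(1,1,2,3)]
    have bil: "(\<lambda>b c. \<epsilon> x b \<odot>\<^bsub>C x z\<^esub> c) \<in> bilin_hom R (C x x) (C x z) (C x z)"
      by (rule bilin_hom_comp2[OF smult_bilin[OF mods(2)] eps_lin[OF a(1)] lin_hom_id])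
    note Ti = lin_hom_comp[OF incl_lin[OF a(1,2)] T_lin]
    have "?f x = tensor_lift R H (\<lambda>b c. T (\<iota> x z (\<epsilon> x b \<odot>\<^bsub>C x z\<^esub> c))) (\<Delta> x x z a)"
    proof (rule tensor_lift_cong[OF mods mod_H t bilin_hom_comp[OF bil Ti]])
      fix b c assume b: "b \<in> carrier (C x x)" and c: "c \<in> carrier (C x z)"
      have S: "S z x c \<in> carrier (C z x)" using a c by (simp add: S_closed)
      have \<epsilon>: "\<epsilon> x b \<in> carrier R" using a b by (simp add: eps_closed)
      \<comment> \<open>The terms of \<open>S(h_1) h_2\<close> multiplied by \<open>S(h_3)\<close>.
        The latter lies in \<open>C z x\<close>, so only \<open>e z x\<close> survives, and there it
        acts as the unit.\<close>
      let ?g = "\<lambda>u. (\<epsilon> x b \<odot>\<^bsub>H\<^esub> e u x) \<otimes>\<^bsub>H\<^esub> \<iota> z x (S z x c)"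
      have "?L (D (\<iota> x x b)) \<otimes>\<^bsub>H\<^esub> T (\<iota> x z c) = (\<Oplus>\<^bsub>H\<^esub>u\<in>X. \<epsilon> x b \<odot>\<^bsub>H\<^esub> e u x) \<otimes>\<^bsub>H\<^esub> \<iota> z x (S z x c)"
        using a b c by (simp add: antipode_left_incl T_incl)
      also have "\<dots> = (\<Oplus>\<^bsub>H\<^esub>u\<in>X. ?g u)"
        using a \<epsilon> S by (intro lin_hom_finsum[OF mod_H mod_H bilin_hom_left[OF H.mult_bilin]])
          (auto simp: incl_closed e_closed)
      also have "\<dots> = ?g z"
      proof (rule H.M.finsum_single[OF finite_X a(2)])
        show "?g z \<in> carrier H"
          using a \<epsilon> S by (simp add: incl_closed e_closed)
        fix u assume u: "u \<in> X" "u \<noteq> z"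
        show "?g u = \<zero>\<^bsub>H\<^esub>"
          using a \<epsilon> S u by (simp add: H.smult_mult_left incl_closed e_closed incl_mult_zero one_C)
      qed
      also have "\<dots> = \<epsilon> x b \<odot>\<^bsub>H\<^esub> T (\<iota> x z c)"
        using a \<epsilon> S c by (simp add: H.smult_mult_left incl_closed e_closed e_mult_incl T_incl)
      also have "\<dots> = T (\<iota> x z (\<epsilon> x b \<odot>\<^bsub>C x z\<^esub> c))"
        using \<epsilon> c by (simp add: lin_hom_smult[OF Ti])
      finally show "?L (D (\<iota> x x b)) \<otimes>\<^bsub>H\<^esub> T (\<iota> x z c) = T (\<iota> x z (\<epsilon> x b \<odot>\<^bsub>C x z\<^esub> c))" .
    qed
    also have "\<dots> = T (\<iota> x z (tensor_lift R (C x z) (\<lambda>b c. \<epsilon> x b \<odot>\<^bsub>C x z\<^esub> c) (\<Delta> x x z a)))"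
      by (rule lin_hom_tensor_lift[OF mods mods(2) mod_H Ti t bilin_hom_closed[OF bil], symmetric])
    also have "\<dots> = T (\<iota> x z a)"
      using a by (simp add: counit_left)
    finally have fx: "?f x = T (\<iota> x z a)" .
    have "(\<Oplus>\<^bsub>H\<^esub>y\<in>X. ?f y) = T (\<iota> x z a)"
      using a zero by (subst H.M.finsum_single[OF finite_X a(1)])
        (simp_all add: fx lin_hom_closed[OF T_lin] incl_closed)
    then show "tensor_lift R H (\<lambda>b c. ?L (D b) \<otimes>\<^bsub>H\<^esub> T c) (D (\<iota> x z a)) = T (\<iota> x z a)"
      using tensor_lift_D_incl[OF mod_H Q' a] by simp
  qed
  finally show ?thesis .
qed

end

theorem proposition6p3:
  fixes R :: "('k, 'r) ring_scheme"
    and X :: "'x set"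
    and C :: "'x \<Rightarrow> 'x \<Rightarrow> ('k, 'a, 'm) module_scheme"
    and \<Delta> :: "'x \<Rightarrow> 'x \<Rightarrow> 'x \<Rightarrow> 'a \<Rightarrow> ('a \<times> 'a \<Rightarrow> 'k) set"
    and \<epsilon> :: "'x \<Rightarrow> 'a \<Rightarrow> 'k"
    and S :: "'x \<Rightarrow> 'x \<Rightarrow> 'a \<Rightarrow> 'a"
  assumes "cring R"
    and "finite X"
    and "dual_hopf_category R X C \<Delta> \<epsilon> S"
  shows "weak_hopf_algebra R (total_algebra X C)
    (total_comult R X C \<Delta>) (total_counit R X \<epsilon>) (total_antipode X C S)"
proof -
  interpret finite_dual_hopf_category R X C \<Delta> \<epsilon> S
    using assms(2,3) by (simp add: finite_dual_hopf_category_def finite_dual_hopf_category_axioms_def)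
  show ?thesis
  proof (intro weak_hopf_algebra.intro coalgebra.intro)
    show "assoc_algebra R H" by (rule alg_H)
    show "module R H" by (rule mod_H)
    show "coalgebra_axioms R H D E"
      by (rule coalgebra_axioms.intro[OF D_lin E_lin total_coassoc total_counit_left total_counit_right])
    show "weak_hopf_algebra_axioms R H D E T"
      by (rule weak_hopf_algebra_axioms.intro[OF total_comult_mult total_counit_mult total_comult_one
            T_lin total_antipode_right total_antipode_left total_antipode_both])
  qed
qed

end
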